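(* Let $q$ be odd and let $G=\{N\in U(2m,\mathbb{F}_q): N^TJ_{2m}N=J_{2m}\}$ be the Sylow $p$-subgroup of $O^+(2m,q)$ consisting of its lower unitriangular matrices. Let $h_1=\sum_{i=1}^mx_{2m-i+1}x_i$ and, for $k\ge2$, $h_k=\sum_{i=1}^m\left(x_{2m-i+1}^{q^{k-1}}x_i+x_{2m-i+1}x_i^{q^{k-1}}\right)$. Then the invariant field $\mathbb{F}_q(V)^G$ is generated by the polynomials $N(x_i)$, $i=1,\dots,m+1$, and $h_k$, $k=1,\dots,m-1$; i.e. $$\mathbb{F}_q(V)^G=\mathbb{F}_q(x_1,N(x_2),\dots,N(x_{m+1}),h_1,\dots,h_{m-1}).$$
   Context: $q$ is a power of a prime $p$, $m\ge 1$, $V=\mathbb{F}_q^{2m}$ (column vectors) with $x_1,\dots,x_{2m}$ the dual basis of the standard basis; $\mathbb{F}_q[V]=\mathbb{F}_q[x_1,\dots,x_{2m}]$, $\mathbb{F}_q(V)$ is its fraction field, and $G$ acts by $(g\cdot f)(v)=f(g^{-1}v)$. $N(x_i)=\prod_{y\in G\cdot x_i}y$ is the product over the $G$-orbit of $x_i$ (so $N(x_1)=x_1$). $U(n,\mathbb{F})$ is the group of lower triangular $n\times n$ matrices over $\mathbb{F}$ with ones on the diagonal; $J_n$ is the $n\times n$ matrix with ones on the antidiagonal and zeros elsewhere. $O^+(2m,q)$ is the group of invertible matrices preserving the quadratic form $\sum_{i=1}^mx_{2m-i+1}x_i$ on $V$. *)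

theory Defs
  imports
    "Jordan_Normal_Form.VS_Connect"
    "HOL-Library.Cardinality"
    "HOL-Library.Poly_Mapping"
    "HOL-Algebra.Generated_Fields"
begin

text \<open>Polynomials over \<open>'a\<close> are finitely supported maps from monomials
  (\<open>nat \<Rightarrow>\<^sub>0 nat\<close>, variable index to exponent) to coefficients. The variables of \<open>\<F>[V]\<close> for
  \<open>V = \<F>\<^sup>n\<close> are \<open>x\<^sub>1, \<dots>, x\<^sub>n\<close>, so \<open>\<F>[V]\<close> and \<open>\<F>(V)\<close> are carved out of a polynomial ring in
  countably many variables and its fraction field. The finite field is the type \<open>'a\<close>,
  with \<open>q = CARD('a)\<close>.\<close>

type_synonym 'a mpoly = "(nat \<Rightarrow>\<^sub>0 nat) \<Rightarrow>\<^sub>0 'a"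

definition pconst :: "'a::field \<Rightarrow> 'a mpoly" where
  "pconst c = Poly_Mapping.single 0 c"

definition pvar :: "nat \<Rightarrow> 'a::field mpoly" where
  "pvar i = Poly_Mapping.single (Poly_Mapping.single i 1) 1"

definition poly_ring_V :: "nat \<Rightarrow> 'a::field mpoly set" where
  "poly_ring_V n = {f. \<forall>t\<in>Poly_Mapping.keys f. Poly_Mapping.keys t \<subseteq> {1..n}}"

definition fun_field_V :: "nat \<Rightarrow> 'a::field mpoly fract set" where
  "fun_field_V n = {Fract a b | a b. a \<in> poly_ring_V n \<and> b \<in> poly_ring_V n \<and> b \<noteq> 0}"

definition psubst :: "(nat \<Rightarrow> 'a::field mpoly) \<Rightarrow> 'a mpoly \<Rightarrow> 'a mpoly" where
  "psubst s f = (\<Sum>t\<in>Poly_Mapping.keys f.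
     pconst (Poly_Mapping.lookup f t) *
     (\<Prod>i\<in>Poly_Mapping.keys t. s i ^ Poly_Mapping.lookup t i))"

text \<open>\<open>(g \<cdot> f)(v) = f(g\<^sup>-\<^sup>1 v)\<close>: as \<open>x\<^sub>i(g\<^sup>-\<^sup>1 v) = \<Sum>\<^sub>j (g\<^sup>-\<^sup>1)\<^sub>i\<^sub>j x\<^sub>j(v)\<close>, the element \<open>g\<close> acts by
  substituting these linear forms. Matrix entries are indexed from 0, variables from 1.
  Variables outside \<open>x\<^sub>1, \<dots>, x\<^sub>n\<close>, which do not occur in \<open>\<F>[V]\<close>, are left alone.\<close>

definition act_var :: "nat \<Rightarrow> 'a::field mat \<Rightarrow> nat \<Rightarrow> 'a mpoly" where
  "act_var n g i = (if i \<in> {1..n}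
     then (\<Sum>j = 1..n. pconst ((inv\<^bsub>ring_mat TYPE('a) n ()\<^esub> g) $$ (i - 1, j - 1)) * pvar j)
     else pvar i)"

definition act_poly :: "nat \<Rightarrow> 'a::field mat \<Rightarrow> 'a mpoly \<Rightarrow> 'a mpoly" where
  "act_poly n g = psubst (act_var n g)"

text \<open>\<open>g \<cdot> (a/b) = (g \<cdot> a)/(g \<cdot> b)\<close>; lemma \<open>act_fract_Fract\<close> below shows that for invertible \<open>g\<close>
  this does not depend on the chosen representation as a fraction.\<close>

definition act_fract :: "nat \<Rightarrow> 'a::field mat \<Rightarrow> 'a mpoly fract \<Rightarrow> 'a mpoly fract" where
  "act_fract n g z =
     (let (a, b) = (SOME (a, b). b \<noteq> 0 \<and> z = Fract a b) in Fract (act_poly n g a) (act_poly n g b))"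

definition invariant_field :: "nat \<Rightarrow> 'a::field mat set \<Rightarrow> 'a mpoly fract set" where
  "invariant_field n G = {z \<in> fun_field_V n. \<forall>g\<in>G. act_fract n g z = z}"

text \<open>The subfield generated by the constants and a set \<open>S\<close> of polynomials.\<close>

definition field_gen :: "'a::field mpoly set \<Rightarrow> 'a mpoly fract set" where
  "field_gen S = generate_field class_ring (to_fract ` (range pconst \<union> S))"

definition orbit_norm :: "nat \<Rightarrow> 'a::field mat set \<Rightarrow> nat \<Rightarrow> 'a mpoly" where
  "orbit_norm n G i = \<Prod>((\<lambda>g. act_poly n g (pvar i)) ` G)"

definition lower_unitriangular :: "nat \<Rightarrow> 'a::field mat set" where
  "lower_unitriangular n = {N \<in> carrier_mat n n.
     (\<forall>i<n. N $$ (i, i) = 1) \<and> (\<forall>i<n. \<forall>j<n. i < j \<longrightarrow> N $$ (i, j) = 0)}"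

definition antidiag_mat :: "nat \<Rightarrow> 'a::field mat" where
  "antidiag_mat n = mat n n (\<lambda>(i, j). if i + j + 1 = n then 1 else 0)"

definition sylow_O_plus :: "nat \<Rightarrow> 'a::field mat set" where
  "sylow_O_plus m = {N \<in> lower_unitriangular (2 * m).
     transpose_mat N * antidiag_mat (2 * m) * N = antidiag_mat (2 * m)}"

text \<open>At \<open>k = 1\<close> the general formula would give \<open>2 h\<^sub>1\<close>, hence the case distinction.
  The index \<open>k = 0\<close> is not used.\<close>

definition h_poly :: "nat \<Rightarrow> nat \<Rightarrow> 'a::{field,finite} mpoly" where
  "h_poly m k = (if k = 1
     then (\<Sum>i = 1..m. pvar (2 * m - i + 1) * pvar i)
     else (\<Sum>i = 1..m. pvar (2 * m - i + 1) ^ (CARD('a) ^ (k - 1)) * pvar i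
                      + pvar (2 * m - i + 1) * pvar i ^ (CARD('a) ^ (k - 1))))"


subsection \<open>The action is well defined\<close>

lemma psubst_superset:
  assumes "finite A" "Poly_Mapping.keys f \<subseteq> A"
  shows "psubst s f = (\<Sum>t\<in>A. pconst (Poly_Mapping.lookup f t) *
     (\<Prod>i\<in>Poly_Mapping.keys t. s i ^ Poly_Mapping.lookup t i))"
  unfolding psubst_def
  by (rule sum.mono_neutral_left) (use assms in \<open>auto simp: pconst_def in_keys_iff\<close>)

lemma psubst_add: "psubst s (f + g) = psubst s f + psubst s g"
proof -
  let ?A = "Poly_Mapping.keys f \<union> Poly_Mapping.keys g"
  have "Poly_Mapping.keys (f + g) \<subseteq> ?A" by (rule Poly_Mapping.keys_add)
  then show ?thesis
    by (subst (1 2 3) psubst_superset[of ?A])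
       (auto simp: lookup_add pconst_def single_add distrib_right sum.distrib)
qed

lemma psubst_0: "psubst s 0 = 0"
  by (simp add: psubst_def)

lemma psubst_sum: "psubst s (sum f A) = (\<Sum>a\<in>A. psubst s (f a))"
  by (induction A rule: infinite_finite_induct) (auto simp: psubst_0 psubst_add)

lemma psubst_single: "psubst s (Poly_Mapping.single t c) =
    pconst c * (\<Prod>i\<in>Poly_Mapping.keys t. s i ^ Poly_Mapping.lookup t i)"
  by (subst psubst_superset[of "{t}"]) auto

lemma mpoly_sum_singles:
  "f = (\<Sum>t\<in>Poly_Mapping.keys f. Poly_Mapping.single t (Poly_Mapping.lookup f t))"
proof (rule poly_mapping_eqI)
  fix k
  have "(\<Sum>t\<in>Poly_Mapping.keys f. Poly_Mapping.lookup f t when t = k)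
      = (\<Sum>t\<in>Poly_Mapping.keys f. if t = k then Poly_Mapping.lookup f t else 0)"
    by (rule sum.cong) (auto simp: when_def)
  also have "\<dots> = Poly_Mapping.lookup f k"
    by (subst sum.delta) (auto simp: in_keys_iff)
  finally show "Poly_Mapping.lookup f k = Poly_Mapping.lookup
      (\<Sum>t\<in>Poly_Mapping.keys f. Poly_Mapping.single t (Poly_Mapping.lookup f t)) k"
    by (simp add: lookup_sum lookup_single)
qed

lemma monom_prod_superset:
  assumes "finite A" "Poly_Mapping.keys t \<subseteq> A"
  shows "(\<Prod>i\<in>Poly_Mapping.keys t. (s i :: 'b::comm_semiring_1) ^ Poly_Mapping.lookup t i)
       = (\<Prod>i\<in>A. s i ^ Poly_Mapping.lookup t i)"
  by (rule prod.mono_neutral_left) (use assms in \<open>auto simp: in_keys_iff\<close>)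

lemma psubst_single_mult:
  "psubst s (Poly_Mapping.single t c * Poly_Mapping.single u d) =
   psubst s (Poly_Mapping.single t c) * psubst s (Poly_Mapping.single u d)"
proof -
  let ?A = "Poly_Mapping.keys t \<union> Poly_Mapping.keys u"
  have k: "Poly_Mapping.keys (t + u) \<subseteq> ?A" by (rule Poly_Mapping.keys_add)
  have c: "pconst (c * d) = pconst c * pconst d"
    by (simp add: pconst_def mult_single)
  have m: "(\<Prod>i\<in>Poly_Mapping.keys v. s i ^ Poly_Mapping.lookup v i)
      = (\<Prod>i\<in>?A. s i ^ Poly_Mapping.lookup v i)" if "v \<in> {t, u, t + u}" for v
    by (rule monom_prod_superset) (use that k in auto)
  show ?thesis
    unfolding mult_single psubst_single c
    by (subst (1 2 3) m) (simp_all only: insert_iff simp_thms lookup_add power_add prod.distrib mult_ac)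
qed

lemma psubst_mult: "psubst s (f * g) = psubst s f * psubst s g"
proof -
  let ?S = "\<lambda>f t. Poly_Mapping.single t (Poly_Mapping.lookup f t)"
  have "psubst s (f * g) = psubst s ((\<Sum>t\<in>Poly_Mapping.keys f. ?S f t) * (\<Sum>u\<in>Poly_Mapping.keys g. ?S g u))"
    by (simp flip: mpoly_sum_singles)
  also have "\<dots> = (\<Sum>t\<in>Poly_Mapping.keys f. psubst s (?S f t)) * (\<Sum>u\<in>Poly_Mapping.keys g. psubst s (?S g u))"
    by (simp add: sum_product psubst_sum psubst_single_mult)
  also have "\<dots> = psubst s f * psubst s g"
    by (simp flip: psubst_sum mpoly_sum_singles)
  finally show ?thesis .
qed

lemma psubst_pconst: "psubst s (pconst c) = pconst c"
  unfolding pconst_def[of c] psubst_single by (simp add: pconst_def)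

lemma psubst_pvar: "psubst s (pvar i) = s i"
  unfolding pvar_def psubst_single by (simp add: pconst_def)

lemma psubst_one: "psubst s 1 = 1"
  using psubst_pconst[of s 1] by (simp add: pconst_def)

lemma psubst_power: "psubst s (f ^ k) = psubst s f ^ k"
  by (induction k) (auto simp: psubst_one psubst_mult)

lemma psubst_prod: "psubst s (prod f A) = (\<Prod>a\<in>A. psubst s (f a))"
  by (induction A rule: infinite_finite_induct) (auto simp: psubst_one psubst_mult)

lemma psubst_psubst: "psubst s (psubst s' f) = psubst (\<lambda>i. psubst s (s' i)) f"
  unfolding psubst_def[of s' f] psubst_def[of "\<lambda>i. psubst s (s' i)"]
  by (simp add: psubst_sum psubst_mult psubst_pconst psubst_prod psubst_power)

lemma pvar_power: "pvar i ^ k = Poly_Mapping.single (Poly_Mapping.single i k) 1"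
  by (induction k) (simp_all add: pvar_def mult_single flip: single_add)

lemma pvar_monom:
  "(\<Prod>i\<in>Poly_Mapping.keys t. pvar i ^ Poly_Mapping.lookup t i) =
    (Poly_Mapping.single t 1 :: 'a::field mpoly)"
proof -
  have prod_single: "(\<Prod>i\<in>A. Poly_Mapping.single (f i) 1) = Poly_Mapping.single (sum f A) (1::'a)"
    if "finite A" for A :: "nat set" and f :: "nat \<Rightarrow> nat \<Rightarrow>\<^sub>0 nat"
    using that by (induction A) (auto simp: mult_single)
  have "(\<Prod>i\<in>Poly_Mapping.keys t. pvar i ^ Poly_Mapping.lookup t i :: 'a mpoly) =
      Poly_Mapping.single (\<Sum>i\<in>Poly_Mapping.keys t. Poly_Mapping.single i (Poly_Mapping.lookup t i)) 1"
    unfolding pvar_power by (rule prod_single) simp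
  moreover have "(\<Sum>i\<in>Poly_Mapping.keys t. Poly_Mapping.single i (Poly_Mapping.lookup t i)) = t"
  proof (rule poly_mapping_eqI)
    fix k
    have "(\<Sum>i\<in>Poly_Mapping.keys t. Poly_Mapping.lookup t i when i = k)
        = (\<Sum>i\<in>Poly_Mapping.keys t. if i = k then Poly_Mapping.lookup t i else 0)"
      by (rule sum.cong) (auto simp: when_def)
    also have "\<dots> = Poly_Mapping.lookup t k"
      by (subst sum.delta) (auto simp: in_keys_iff)
    finally show "Poly_Mapping.lookup
        (\<Sum>i\<in>Poly_Mapping.keys t. Poly_Mapping.single i (Poly_Mapping.lookup t i)) k
        = Poly_Mapping.lookup t k"
      by (simp add: lookup_sum lookup_single)
  qed
  ultimately show ?thesis by simp
qed

lemma psubst_id: "psubst pvar f = f"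
  unfolding psubst_def pvar_monom
  by (simp add: pconst_def mult_single flip: mpoly_sum_singles)

lemma act_poly_inverse:
  fixes g :: "'a::field mat"
  assumes g: "g \<in> Units (ring_mat TYPE('a) n ())"
  shows "act_poly n g (act_poly n (inv\<^bsub>ring_mat TYPE('a) n ()\<^esub> g) f) = f"
proof -
  let ?R = "ring_mat TYPE('a) n ()"
  interpret ring ?R by (rule ring_mat)
  let ?h = "inv\<^bsub>?R\<^esub> g"
  have gC: "g \<in> carrier_mat n n" and hC: "?h \<in> carrier_mat n n"
    using g Units_closed[OF g] Units_inv_closed[OF g] by (auto simp: ring_mat_simps)
  have gh: "g * ?h = 1\<^sub>m n"
    using Units_r_inv[OF g] by (simp add: ring_mat_simps)
  have hh: "inv\<^bsub>?R\<^esub> ?h = g" using g by simp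
  have "psubst (act_var n g) (act_var n ?h i) = pvar i" for i
  proof (cases "i \<in> {1..n}")
    case True
    then have i: "i - 1 < n" by auto
    have "psubst (act_var n g) (act_var n ?h i) =
        (\<Sum>j = 1..n. pconst (g $$ (i - 1, j - 1)) *
          (\<Sum>k = 1..n. pconst (?h $$ (j - 1, k - 1)) * pvar k))"
      using True
      by (auto simp: act_var_def[of n ?h] hh psubst_sum psubst_mult psubst_pconst psubst_pvar
          act_var_def[of n g] intro!: sum.cong)
    also have "\<dots> = (\<Sum>j = 1..n. \<Sum>k = 1..n. pconst (g $$ (i - 1, j - 1) * ?h $$ (j - 1, k - 1)) * pvar k)"
      by (simp add: sum_distrib_left pconst_def mult_single flip: mult.assoc)
    also have "\<dots> = (\<Sum>k = 1..n. \<Sum>j = 1..n. pconst (g $$ (i - 1, j - 1) * ?h $$ (j - 1, k - 1)) * pvar k)"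
      by (rule sum.swap)
    also have "\<dots> = (\<Sum>k = 1..n. if k = i then pvar k else 0)"
    proof (rule sum.cong)
      fix k assume k: "k \<in> {1..n}"
      then have k': "k - 1 < n" by auto
      have "(\<Sum>j = 1..n. g $$ (i - 1, j - 1) * ?h $$ (j - 1, k - 1))
          = (\<Sum>j = 0..<n. g $$ (i - 1, j) * ?h $$ (j, k - 1))"
        by (rule sum.reindex_bij_witness[of _ Suc "\<lambda>j. j - 1"]) auto
      also have "\<dots> = (g * ?h) $$ (i - 1, k - 1)"
        using gC hC i k' by (auto simp: times_mat_def scalar_prod_def)
      also have "\<dots> = (if k = i then 1 else 0)"
        unfolding gh using True k by auto
      finally have e: "(\<Sum>j = 1..n. g $$ (i - 1, j - 1) * ?h $$ (j - 1, k - 1)) = (if k = i then 1 else 0)" .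
      have p: "(\<Sum>j\<in>A. pconst (c j)) = pconst (sum c A)" for A :: "nat set" and c :: "nat \<Rightarrow> 'a"
        by (induction A rule: infinite_finite_induct) (auto simp: pconst_def single_add)
      show "(\<Sum>j = 1..n. pconst (g $$ (i - 1, j - 1) * ?h $$ (j - 1, k - 1)) * pvar k)
          = (if k = i then pvar k else 0)"
        unfolding sum_distrib_right[symmetric] p e by (auto simp: pconst_def)
    qed simp
    also have "\<dots> = pvar i" using True by simp
    finally show ?thesis .
  next
    case False
    then show ?thesis by (auto simp: act_var_def psubst_pvar)
  qed
  then show ?thesis
    by (simp add: act_poly_def psubst_psubst psubst_id)
qed

lemma act_poly_eq_0_iff:
  fixes g :: "'a::field mat"
  assumes g: "g \<in> Units (ring_mat TYPE('a) n ())"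
  shows "act_poly n g f = 0 \<longleftrightarrow> f = 0"
proof
  interpret ring "ring_mat TYPE('a) n ()" by (rule ring_mat)
  assume "act_poly n g f = 0"
  then have "act_poly n (inv\<^bsub>ring_mat TYPE('a) n ()\<^esub> g) (act_poly n g f) = 0"
    by (simp add: act_poly_def psubst_0)
  then show "f = 0"
    using act_poly_inverse[of "inv\<^bsub>ring_mat TYPE('a) n ()\<^esub> g" n f] g by simp
qed (simp add: act_poly_def psubst_0)

lemma act_fract_Fract:
  fixes g :: "'a::field mat"
  assumes g: "g \<in> Units (ring_mat TYPE('a) n ())" and b: "b \<noteq> 0"
  shows "act_fract n g (Fract a b) = Fract (act_poly n g a) (act_poly n g b)"
proof -
  let ?P = "\<lambda>(c, d). d \<noteq> 0 \<and> Fract a b = Fract c d"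
  obtain c d where cd: "(SOME x. ?P x) = (c, d)"
    by (cases "SOME x. ?P x")
  have "?P (SOME x. ?P x)"
    by (rule someI[of ?P "(a, b)"]) (use b in simp)
  then have d: "d \<noteq> 0" and eq: "Fract a b = Fract c d"
    unfolding cd by simp_all
  have "a * d = c * b" using eq b d by (simp add: eq_fract)
  then have "act_poly n g a * act_poly n g d = act_poly n g c * act_poly n g b"
    by (simp only: act_poly_def flip: psubst_mult)
  moreover have "act_poly n g b \<noteq> 0" "act_poly n g d \<noteq> 0"
    using act_poly_eq_0_iff[OF g] b d by auto
  ultimately show ?thesis
    unfolding act_fract_def cd by (simp add: eq_fract)
qed

lemma sylow_O_plus_Units:
  fixes N :: "'a::field mat"
  assumes "N \<in> sylow_O_plus m"
  shows "N \<in> Units (ring_mat TYPE('a) (2 * m) ())"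
proof -
  have N: "N \<in> carrier_mat (2 * m) (2 * m)" "\<And>i. i < 2 * m \<Longrightarrow> N $$ (i, i) = 1"
    "\<And>i j. i < j \<Longrightarrow> j < 2 * m \<Longrightarrow> N $$ (i, j) = 0"
    using assms by (auto simp: sylow_O_plus_def lower_unitriangular_def)
  have "diag_mat N = replicate (2 * m) 1"
    using N by (intro nth_equalityI) (auto simp: diag_mat_def)
  moreover have "det N = prod_list (diag_mat N)"
    by (rule det_lower_triangular[OF N(3) N(1)]) auto
  ultimately have "det N = 1" by simp
  then show ?thesis
    using det_non_zero_imp_unit[OF N(1)] by simp
qed

lemma orbit_norm_1:
  fixes m :: nat
  assumes m: "m \<ge> 1"
  shows "orbit_norm (2 * m) (sylow_O_plus m :: 'a::field mat set) 1 = pvar 1"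
proof -
  let ?n = "2 * m"
  let ?R = "ring_mat TYPE('a) ?n ()"
  have fixed: "act_poly ?n N (pvar 1) = pvar 1" if N: "N \<in> sylow_O_plus m" for N :: "'a mat"
  proof -
    interpret ring ?R by (rule ring_mat)
    note U = sylow_O_plus_Units[OF N]
    let ?h = "inv\<^bsub>?R\<^esub> N"
    have NC: "N \<in> carrier_mat ?n ?n" and hC: "?h \<in> carrier_mat ?n ?n"
      using Units_closed[OF U] Units_inv_closed[OF U] by (auto simp: ring_mat_simps)
    have Nh: "N * ?h = 1\<^sub>m ?n"
      using Units_r_inv[OF U] by (simp add: ring_mat_simps)
    have N1: "N $$ (0, k) = (if k = 0 then 1 else 0)" if "k < ?n" for k
      using N that by (auto simp: sylow_O_plus_def lower_unitriangular_def)
    have "?h $$ (0, j) = (if j = 0 then 1 else 0)" if j: "j < ?n" for j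
    proof -
      have "(N * ?h) $$ (0, j) = (\<Sum>k = 0..<?n. N $$ (0, k) * ?h $$ (k, j))"
        using NC hC m j by (auto simp: times_mat_def scalar_prod_def)
      also have "\<dots> = (\<Sum>k = 0..<?n. if k = 0 then ?h $$ (k, j) else 0)"
        by (rule sum.cong) (auto simp: N1)
      also have "\<dots> = ?h $$ (0, j)" using m by (subst sum.delta) auto
      finally show ?thesis unfolding Nh using m j by auto
    qed
    then have "act_var ?n N 1 = (\<Sum>j = 1..?n. pconst (if j - 1 = 0 then 1 else 0) * pvar j)"
      unfolding act_var_def using m by (simp add: Suc_le_eq cong: sum.cong) (rule sum.cong, auto)
    also have "\<dots> = (\<Sum>j = 1..?n. if j = 1 then pvar j else 0)"
      by (rule sum.cong) (auto simp: pconst_def)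
    also have "\<dots> = pvar 1" using m by simp
    finally show ?thesis by (simp add: act_poly_def psubst_pvar)
  qed
  have "1\<^sub>m ?n \<in> (sylow_O_plus m :: 'a mat set)"
    by (auto simp: sylow_O_plus_def lower_unitriangular_def antidiag_mat_def)
  then have "(\<lambda>g. act_poly ?n g (pvar 1)) ` (sylow_O_plus m :: 'a mat set) = {pvar 1}"
    using fixed by auto
  then show ?thesis unfolding orbit_norm_def by simp
qed

end

theory Submission
  imports Defs "Jordan_Normal_Form.Char_Poly"
begin

text \<open>Let \<open>E\<close> be the field of fractions and \<open>K\<close> the field generated by the given invariants. If an
  invariant \<open>z = a/b\<close> were not in \<open>K\<close>, there would be a \<open>K\<close>-linear map \<open>L : E \<rightarrow> E\<close> with
  \<open>L b = 0\<close> and \<open>L a = 1\<close>. The ring \<open>E[T\<^sub>1, T\<^sub>2, \<dots>]\<close> acts on such maps, \<open>T\<^sub>i\<close> by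
  \<open>L \<mapsto> L(x\<^sub>i \<cdot> _)\<close>, and the annihilator \<open>I\<close> of \<open>L\<close> contains \<open>f(T) - f(x)\<close> for every generator
  \<open>f\<close> of \<open>K\<close>. It is enough to show \<open>b(x) a(T) - a(x) b(T) \<in> I\<close>, since this gives \<open>b = 0\<close>. To do so,
  \<open>I\<close> is written as an intersection of ideals containing \<open>T - g x\<close> for some \<open>g \<in> G\<close>, with the Chinese
  remainder theorem applied to polynomials with distinct roots in \<open>E\<close>.

  For \<open>i \<le> m + 1\<close> the orbit of \<open>x\<^sub>i\<close> is a coset of a space \<open>W\<close> spanned by earlier variables, and
  \<open>N(T\<^sub>i) = N(x\<^sub>i)\<close> becomes \<open>\<Prod>\<^sub>w (T\<^sub>i - x\<^sub>i - w) = 0\<close> as \<open>\<Prod>\<^sub>w (t + w)\<close> is additive. After a linear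
  change, the remaining variables differ from \<open>x\<^sub>m\<^sub>+\<^sub>2, \<dots>, x\<^sub>2\<^sub>m\<close> by a vector \<open>d\<close> such that the
  relations from the \<open>h\<^sub>k\<close> make \<open>(x, d)\<close> and its first Frobenius twists span a totally isotropic
  space. This forces \<open>d = A x\<close> with \<open>A\<^sub>i\<^sub>j\<^sup>q = A\<^sub>i\<^sub>j\<close>, so the entries of \<open>A\<close> can be split as well.\<close>

section \<open>Ideals and Frobenius-fixed alternating matrices\<close>

text \<open>The unit ideal is included: a branch of the splitting may end in it, and
  \<open>relation_mem\<close> treats that case on its own.\<close>

definition rideal :: "'b::comm_ring_1 set \<Rightarrow> bool" where
  "rideal I \<longleftrightarrow> 0 \<in> I \<and> (\<forall>a\<in>I. \<forall>b\<in>I. a + b \<in> I) \<and> (\<forall>a\<in>I. \<forall>r. r * a \<in> I)"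

lemma rideal_0: "rideal I \<Longrightarrow> 0 \<in> I"
  and rideal_add: "rideal I \<Longrightarrow> a \<in> I \<Longrightarrow> b \<in> I \<Longrightarrow> a + b \<in> I"
  and rideal_mult: "rideal I \<Longrightarrow> a \<in> I \<Longrightarrow> r * a \<in> I"
  by (auto simp: rideal_def)

lemma rideal_mult2: "rideal I \<Longrightarrow> a \<in> I \<Longrightarrow> a * r \<in> I"
  by (metis rideal_mult mult.commute)

lemma rideal_uminus: "rideal I \<Longrightarrow> a \<in> I \<Longrightarrow> - a \<in> I"
  using rideal_mult[of I a "-1"] by simp

lemma rideal_diff: "rideal I \<Longrightarrow> a \<in> I \<Longrightarrow> b \<in> I \<Longrightarrow> a - b \<in> I"
  using rideal_add[of I a "-b"] rideal_uminus by fastforce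

lemma rideal_sum: "rideal I \<Longrightarrow> (\<And>a. a \<in> A \<Longrightarrow> f a \<in> I) \<Longrightarrow> sum f A \<in> I"
  by (induction A rule: infinite_finite_induct) (auto simp: rideal_0 rideal_add)

lemma rideal_power: "rideal I \<Longrightarrow> a \<in> I \<Longrightarrow> k > 0 \<Longrightarrow> a ^ k \<in> I"
  by (cases k) (auto simp: rideal_mult2)

lemma rideal_sym: "rideal I \<Longrightarrow> a - b \<in> I \<Longrightarrow> b - a \<in> I"
  using rideal_uminus[of I "a - b"] by simp

lemma rideal_trans: "rideal I \<Longrightarrow> a - b \<in> I \<Longrightarrow> b - c \<in> I \<Longrightarrow> a - c \<in> I"
  using rideal_add[of I "a - b" "b - c"] by simp

lemma rideal_cong_add:
  "rideal I \<Longrightarrow> a - a' \<in> I \<Longrightarrow> b - b' \<in> I \<Longrightarrow> (a + b) - (a' + b') \<in> I"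
  using rideal_add[of I "a - a'" "b - b'"] by (simp add: algebra_simps)

lemma rideal_cong_mult:
  assumes "rideal I" "a - a' \<in> I" "b - b' \<in> I"
  shows "a * b - a' * b' \<in> I"
proof -
  have "a * b - a' * b' = (a - a') * b + a' * (b - b')" by (simp add: algebra_simps)
  then show ?thesis using assms by (simp add: rideal_add rideal_mult rideal_mult2)
qed

lemma rideal_cong_sum:
  "rideal I \<Longrightarrow> (\<And>a. a \<in> A \<Longrightarrow> f a - g a \<in> I) \<Longrightarrow> sum f A - sum g A \<in> I"
  by (simp add: rideal_sum flip: sum_subtractf)

lemma rideal_cong_prod:
  "rideal I \<Longrightarrow> (\<And>a. a \<in> A \<Longrightarrow> f a - g a \<in> I) \<Longrightarrow> prod f A - prod g A \<in> I"
  by (induction A rule: infinite_finite_induct) (auto simp: rideal_0 intro: rideal_cong_mult)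

lemma rideal_cong_power: "rideal I \<Longrightarrow> a - b \<in> I \<Longrightarrow> a ^ k - b ^ k \<in> I"
  by (induction k) (auto simp: rideal_0 intro: rideal_cong_mult)

text \<open>The set is \<open>I + (p)\<close>, so passing to it imposes the congruence
  \<open>p = 0\<close>.\<close>

lemma rideal_adjoin:
  assumes "rideal I"
  shows "rideal {i + s * p | i s. i \<in> I}" (is "rideal ?J")
  unfolding rideal_def
proof (intro conjI ballI allI)
  have "0 = 0 + 0 * p" by simp
  then show "0 \<in> ?J" using rideal_0[OF assms] by blast
next
  fix a b assume "a \<in> ?J" "b \<in> ?J"
  then obtain i s i' s' where "a = i + s * p" "b = i' + s' * p" "i \<in> I" "i' \<in> I" by blast
  then have "a + b = (i + i') + (s + s') * p" "i + i' \<in> I"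
    by (auto simp: algebra_simps rideal_add[OF assms])
  then show "a + b \<in> ?J" by blast
next
  fix a r assume "a \<in> ?J"
  then obtain i s where "a = i + s * p" "i \<in> I" by blast
  then have "r * a = r * i + (r * s) * p" "r * i \<in> I"
    by (auto simp: algebra_simps rideal_mult2[OF assms])
  then show "r * a \<in> ?J" by blast
qed

lemma rideal_adjoin_supset: "I \<subseteq> {i + s * (p::'b::comm_ring_1) | i s. i \<in> I}"
proof
  fix i assume "i \<in> I"
  moreover have "i = i + 0 * p" by simp
  ultimately show "i \<in> {i + s * p | i s. i \<in> I}" by blast
qed

lemma rideal_adjoin_mem: "rideal I \<Longrightarrow> (p::'b::comm_ring_1) \<in> {i + s * p | i s. i \<in> I}"
proof -
  assume "rideal I"
  moreover have "p = 0 + 1 * p" by simp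
  ultimately show "p \<in> {i + s * p | i s. i \<in> I}" using rideal_0 by blast
qed

lemma prod_unit:
  "(\<And>c. c \<in> C \<Longrightarrow> \<exists>u. u * f c = (1::'b::comm_ring_1)) \<Longrightarrow> \<exists>u. u * prod f C = 1"
proof (induction C rule: infinite_finite_induct)
  case (insert c C)
  then obtain u v where "u * prod f C = 1" "v * f c = 1" by blast
  then have "(u * prod f C) * (v * f c) = 1" by simp
  then have "(u * v) * prod f (insert c C) = 1" using insert.hyps by (simp add: mult_ac)
  then show ?case by blast
qed (auto intro: exI[of _ 1])

text \<open>The Chinese remainder theorem: the intersection of the ideals \<open>I + (p - c)\<close> is \<open>I\<close>.\<close>

lemma rideal_split:
  fixes p :: "'b::comm_ring_1"
  assumes "finite C" "rideal I" "(\<Prod>c\<in>C. p - c) \<in> I"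
    and "\<And>c d. c \<in> C \<Longrightarrow> d \<in> C \<Longrightarrow> c \<noteq> d \<Longrightarrow> \<exists>u. u * (c - d) = 1"
    and "\<And>c J. c \<in> C \<Longrightarrow> rideal J \<Longrightarrow> I \<subseteq> J \<Longrightarrow> p - c \<in> J \<Longrightarrow> r \<in> J"
  shows "r \<in> I"
  using assms
proof (induction C arbitrary: I rule: finite_induct)
  case empty
  then show ?case using rideal_mult[of I 1 r] by simp
next
  case (insert c C)
  note I = insert.prems(1)
  \<comment> \<open>The ideal quotient \<open>I : (p - c)\<close> contains the product over the
    remaining \<open>C\<close>, so the induction hypothesis applies to it and yields
    \<open>r * (p - c) \<in> I\<close>.\<close>
  define I' where "I' = {s. s * (p - c) \<in> I}"
  have I': "rideal I'" unfolding rideal_def I'_def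
    using I by (auto simp: rideal_0 rideal_add rideal_mult distrib_right mult.assoc)
  have sub: "I \<subseteq> I'" unfolding I'_def using I by (auto simp: rideal_mult2)
  have "r \<in> I'"
  proof (rule insert.IH[OF I'])
    show "(\<Prod>c\<in>C. p - c) \<in> I'"
      using insert.prems(2) insert.hyps by (simp add: I'_def mult.commute)
    show "r \<in> J" if "c' \<in> C" "rideal J" "I' \<subseteq> J" "p - c' \<in> J" for c' J
      using insert.prems(4)[of c' J] that sub by auto
  qed (use insert.prems(3) in auto)
  then have rp: "r * (p - c) \<in> I" by (simp add: I'_def)
  have "r \<in> {i + s * (p - c) | i s. i \<in> I}"
    by (rule insert.prems(4)[of c, OF insertI1 rideal_adjoin[OF I] rideal_adjoin_supset
          rideal_adjoin_mem[OF I]])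
  then obtain i s where rs: "r = i + s * (p - c)" "i \<in> I" by blast
  \<comment> \<open>The value at \<open>p = c\<close> of the product over \<open>C\<close>. It is a
    unit, so \<open>r * ?v \<in> I\<close> will suffice.\<close>
  let ?v = "\<Prod>c'\<in>C. c - c'"
  \<comment> \<open>Adjoining \<open>p - c\<close> to the zero ideal gives an exact quotient
    \<open>w\<close>, without an error term from \<open>I\<close>.\<close>
  have "(\<Prod>c'\<in>C. p - c') - ?v \<in> {i + s * (p - c) | i s. i \<in> {0}}"
  proof (rule rideal_cong_prod)
    show "rideal {i + s * (p - c) | i s. i \<in> {0}}"
      by (rule rideal_adjoin) (auto simp: rideal_def)
    fix c' have "p - c' - (c - c') = 0 + 1 * (p - c)" by simp
    then show "p - c' - (c - c') \<in> {i + s * (p - c) | i s. i \<in> {0}}" by blast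
  qed
  then obtain w where w: "(\<Prod>c'\<in>C. p - c') = ?v + w * (p - c)"
    by (auto simp: algebra_simps)
  have "r * (\<Prod>c'\<in>C. p - c') = i * (\<Prod>c'\<in>C. p - c') + s * (\<Prod>c'\<in>insert c C. p - c')"
    using insert.hyps by (simp add: rs(1) algebra_simps)
  also have "\<dots> \<in> I"
    using I rs(2) insert.prems(2) by (intro rideal_add rideal_mult rideal_mult2)
  finally have "r * ?v + w * (r * (p - c)) \<in> I" unfolding w by (simp add: algebra_simps)
  then have rv: "r * ?v \<in> I"
    using rideal_diff[OF I, of "r * ?v + w * (r * (p - c))" "w * (r * (p - c))"]
      rideal_mult[OF I rp, of w] by simp
  have "\<exists>u. u * ?v = 1"
    by (rule prod_unit) (use insert.prems(3) insert.hyps in auto)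
  then obtain u where "u * ?v = 1" by blast
  then have "u * (r * ?v) = r" by (simp add: mult.left_commute)
  then show ?case using rideal_mult[OF I rv, of u] by simp
qed

text \<open>The elements of \<open>F\<close> are split one at a time; each branch enlarges the ideal
  by fixing one more of them to a value in \<open>C\<close>.\<close>

lemma rideal_split_many:
  fixes r :: "'b::comm_ring_1"
  assumes "finite F" "rideal I" "finite C" "\<And>p. p \<in> F \<Longrightarrow> (\<Prod>c\<in>C. p - c) \<in> I"
    and "\<And>c d. c \<in> C \<Longrightarrow> d \<in> C \<Longrightarrow> c \<noteq> d \<Longrightarrow> \<exists>u. u * (c - d) = 1"
    and "\<And>J. rideal J \<Longrightarrow> I \<subseteq> J \<Longrightarrow> (\<And>p. p \<in> F \<Longrightarrow> \<exists>c\<in>C. p - c \<in> J) \<Longrightarrow> r \<in> J"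
  shows "r \<in> I"
  using assms(1,2,4,6)
proof (induction F arbitrary: I rule: finite_induct)
  case empty
  then show ?case by blast
next
  case (insert p F)
  show ?case
  proof (rule rideal_split[OF assms(3) insert.prems(1) insert.prems(2)[of p] assms(5)])
    fix c J assume c: "c \<in> C" and J: "rideal J" "I \<subseteq> J" "p - c \<in> J"
    show "r \<in> J"
    proof (rule insert.IH[OF J(1)])
      show "(\<Prod>c\<in>C. p - c) \<in> J" if "p \<in> F" for p using insert.prems(2)[of p] that J by auto
      fix J' assume J': "rideal J'" "J \<subseteq> J'" "\<And>p. p \<in> F \<Longrightarrow> \<exists>c\<in>C. p - c \<in> J'"
      show "r \<in> J'"
        by (rule insert.prems(3)[OF J'(1)]) (use J J' c in auto)
    qed
  qed auto
qed

section \<open>Frobenius twists of isotropic vectors\<close>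

context
  fixes q :: nat
  assumes frob: "\<And>a b::'b::comm_ring_1. (a + b) ^ q = a ^ q + b ^ q" and q0: "q > 0"
begin

lemma frob_sum: "(\<Sum>i\<in>A. f i) ^ q = (\<Sum>i\<in>A. f i ^ q :: 'b)"
  by (induction A rule: infinite_finite_induct) (use q0 in \<open>auto simp: frob zero_power\<close>)

lemma frob_iter_add: "(a + b :: 'b) ^ (q ^ k) = a ^ (q ^ k) + b ^ (q ^ k)"
  by (induction k) (simp_all add: power_mult frob mult.commute[of q])

lemma frob_iter_sum: "(\<Sum>i\<in>A. f i) ^ (q ^ k) = (\<Sum>i\<in>A. f i ^ (q ^ k) :: 'b)"
  by (induction A rule: infinite_finite_induct) (use q0 in \<open>auto simp: frob_iter_add zero_power\<close>)

text \<open>Modulo \<open>I\<close>, the matrix \<open>A\<close> maps the Frobenius twist \<open>\<phi>\<^sup>k x\<close> to \<open>\<phi>\<^sup>k d\<close> for \<open>k < n\<close>. It is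
  alternating because the twists of \<open>(x, d)\<close> span a totally isotropic space, and hence so is its
  difference \<open>C\<close> with its own twist. But \<open>C\<close> kills the \<open>n - 1\<close> vectors \<open>\<phi> x, \<dots>, \<phi>\<^sup>n\<^sup>-\<^sup>1 x\<close>,
  and alternating matrices have even rank, so \<open>C = 0\<close>.\<close>

lemma frob_fixed_of_isotropic:
  fixes x d :: "nat \<Rightarrow> 'b" and Y :: "nat \<Rightarrow> nat \<Rightarrow> 'b"
  assumes I: "rideal I" and two: "h * 2 = (1::'b)"
    and XY: "\<And>i j. i \<in> {1..n} \<Longrightarrow> j \<in> {1..n} \<Longrightarrow>
      (\<Sum>k<n. x i ^ (q ^ k) * Y k j) = (if i = j then 1 else 0)"
    and YX: "\<And>k l. k < n \<Longrightarrow> l < n \<Longrightarrow>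
      (\<Sum>j=1..n. Y k j * x j ^ (q ^ l)) = (if k = l then 1 else 0)"
    and S: "\<And>k. k < n \<Longrightarrow> (\<Sum>i=1..n. x i * d i ^ (q ^ k) + x i ^ (q ^ k) * d i) \<in> I"
  defines "A \<equiv> \<lambda>i j. \<Sum>k<n. d i ^ (q ^ k) * Y k j"
  assumes ij: "i \<in> {1..n}" "j \<in> {1..n}"
  shows "A i j ^ q - A i j \<in> I" and "(\<Sum>j=1..n. A i j * x j) = d i"
proof -
  have n0: "0 < n" using ij by auto
  \<comment> \<open>\<open>Y\<close> inverts the Moore matrix of \<open>x\<close>, so
    \<open>A\<close> is the matrix sending each twist of \<open>x\<close> to the same twist of
    \<open>d\<close>.\<close>
  have Ax: "(\<Sum>j=1..n. A i j * x j ^ (q ^ k)) = d i ^ (q ^ k)" if "k < n" for i k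
  proof -
    have "(\<Sum>j=1..n. A i j * x j ^ (q ^ k)) =
        (\<Sum>l<n. d i ^ (q ^ l) * (\<Sum>j=1..n. Y l j * x j ^ (q ^ k)))"
      unfolding A_def sum_distrib_left sum_distrib_right
      by (subst sum.swap) (simp add: mult.assoc)
    also have "\<dots> = (\<Sum>l<n. if l = k then d i ^ (q ^ l) else 0)"
      by (rule sum.cong) (auto simp: YX[unfolded One_nat_def] that)
    also have "\<dots> = d i ^ (q ^ k)" using that by simp
    finally show ?thesis .
  qed
  from Ax[of 0 i] n0 show "(\<Sum>j=1..n. A i j * x j) = d i" by simp
  define S' where "S' = (\<lambda>k l. \<Sum>i=1..n. x i ^ (q ^ k) * d i ^ (q ^ l))"
  \<comment> \<open>This is the \<open>q ^ k\<close>-th power of the relation \<open>S\<close> at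
    \<open>e\<close>, as Frobenius is additive.\<close>
  have S1: "S' k (k + e) + S' (k + e) k \<in> I" if "e < n" for k e
  proof -
    have "S' k (k + e) + S' (k + e) k = (\<Sum>i=1..n. x i * d i ^ (q ^ e) + x i ^ (q ^ e) * d i) ^ (q ^ k)"
      unfolding frob_iter_sum frob_iter_add S'_def sum.distrib[symmetric]
      by (simp add: power_mult_distrib power_add mult.commute[of "q ^ k"] flip: power_mult)
    then show ?thesis using rideal_power[OF I S[OF that]] q0 by simp
  qed
  have S2: "S' k l + S' l k \<in> I" if "k < n" "l < n" for k l
  proof (cases "k \<le> l")
    case True
    then show ?thesis using S1[of "l - k" k] that by simp
  next
    case False
    then show ?thesis using S1[of "k - l" l] that by (simp add: add.commute)
  qed
  \<comment> \<open>In matrix terms \<open>A = Y^T S' Y\<close>, so the skew-symmetry of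
    \<open>S'\<close> modulo \<open>I\<close> passes to \<open>A\<close>.\<close>
  have AS: "A i j = (\<Sum>k<n. \<Sum>r<n. Y k i * Y r j * S' k r)" if "i \<in> {1..n}" for i j
  proof -
    have "(\<Sum>k<n. \<Sum>r<n. Y k i * Y r j * S' k r) =
        (\<Sum>k<n. \<Sum>r<n. \<Sum>l=1..n. (x l ^ (q ^ k) * Y k i) * (d l ^ (q ^ r) * Y r j))"
      unfolding S'_def sum_distrib_left by (intro sum.cong refl) (simp add: mult_ac)
    also have "\<dots> = (\<Sum>l=1..n. \<Sum>k<n. \<Sum>r<n. (x l ^ (q ^ k) * Y k i) * (d l ^ (q ^ r) * Y r j))"
      by (subst (2) sum.swap) (subst sum.swap, rule refl)
    also have "\<dots> = (\<Sum>l=1..n. (\<Sum>k<n. x l ^ (q ^ k) * Y k i) * A l j)"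
      unfolding A_def by (simp only: sum_product)
    also have "\<dots> = (\<Sum>l=1..n. if l = i then A l j else 0)"
      by (rule sum.cong) (use that in \<open>auto simp: XY\<close>)
    also have "\<dots> = A i j" using that by simp
    finally show ?thesis ..
  qed
  have skewA: "A i j + A j i \<in> I" if "i \<in> {1..n}" "j \<in> {1..n}" for i j
  proof -
    have "A j i = (\<Sum>r<n. \<Sum>k<n. Y r j * Y k i * S' r k)" by (rule AS[OF that(2)])
    also have "\<dots> = (\<Sum>k<n. \<Sum>r<n. Y r j * Y k i * S' r k)" by (rule sum.swap)
    finally have "A i j + A j i = (\<Sum>k<n. \<Sum>r<n. Y k i * Y r j * (S' k r + S' r k))"
      unfolding AS[OF that(1)] by (simp add: algebra_simps sum.distrib)
    also have "\<dots> \<in> I" using S2 by (intro rideal_sum[OF I] rideal_mult[OF I]) auto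
    finally show ?thesis .
  qed
  define C where "C = (\<lambda>i j. A i j - A i j ^ q)"
  have skewC: "C i j + C j i \<in> I" if "i \<in> {1..n}" "j \<in> {1..n}" for i j
  proof -
    have "C i j + C j i = (A i j + A j i) - (A i j + A j i) ^ q"
      unfolding C_def frob by (simp add: algebra_simps)
    then show ?thesis using rideal_diff[OF I] rideal_power[OF I] skewA[OF that] q0 by metis
  qed
  define e where "e = (\<lambda>i. \<Sum>l=1..n. C i l * x l)"
  \<comment> \<open>For \<open>k > 0\<close> the \<open>q\<close>-th power of \<open>Ax\<close> at
    \<open>k - 1\<close> shows that the twist of \<open>A\<close> also sends the \<open>k\<close>-th
    twist of \<open>x\<close> to that of \<open>d\<close>, so the two cancel.\<close>
  have Cx: "(\<Sum>l=1..n. C i l * x l ^ (q ^ k)) = (if k = 0 then e i else 0)" if k: "k < n" for i k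
  proof (cases k)
    case 0 then show ?thesis by (simp add: e_def)
  next
    case (Suc k')
    have "(\<Sum>l=1..n. A i l ^ q * x l ^ (q ^ k)) = (\<Sum>l=1..n. A i l * x l ^ (q ^ k')) ^ q"
      unfolding frob_sum Suc by (simp add: power_mult_distrib mult.commute[of q] flip: power_mult)
    also have "\<dots> = d i ^ (q ^ k)"
      using k Suc by (simp add: Ax[unfolded One_nat_def] mult.commute[of q] flip: power_mult)
    finally show ?thesis using Ax[OF k, of i] Suc
      by (simp add: C_def left_diff_distrib sum_subtractf)
  qed
  \<comment> \<open>Inserting the identity \<open>X Y = 1\<close> leaves only the term
    \<open>k = 0\<close>: \<open>C\<close> has rank at most one.\<close>
  have CY: "C i j = e i * Y 0 j" if "j \<in> {1..n}" for i j
  proof -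
    have "C i j = (\<Sum>l=1..n. C i l * (if l = j then 1 else 0))"
      using that by (simp add: if_distrib[of "(*) _"] cong: if_cong)
    also have "\<dots> = (\<Sum>l=1..n. C i l * (\<Sum>k<n. x l ^ (q ^ k) * Y k j))"
      by (rule sum.cong) (use that in \<open>auto simp: XY\<close>)
    also have "\<dots> = (\<Sum>k<n. (\<Sum>l=1..n. C i l * x l ^ (q ^ k)) * Y k j)"
      unfolding sum_distrib_left sum_distrib_right by (subst sum.swap) (simp add: mult.assoc)
    also have "\<dots> = (\<Sum>k<n. if k = 0 then e i * Y k j else 0)"
      by (rule sum.cong) (auto simp: Cx[unfolded One_nat_def] e_def)
    also have "\<dots> = e i * Y 0 j" using n0 by simp
    finally show ?thesis .
  qed
  \<comment> \<open>\<open>E\<close> is \<open>x^T C x\<close>, so the skew-symmetry of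
    \<open>C\<close> puts \<open>2 E\<close> into \<open>I\<close>; here 2 has to be a unit.\<close>
  define E where "E = (\<Sum>l=1..n. e l * x l)"
  have E: "E = (\<Sum>l=1..n. \<Sum>k=1..n. C l k * x k * x l)"
    unfolding E_def e_def sum_distrib_right ..
  have "E = (\<Sum>l=1..n. \<Sum>k=1..n. C k l * x k * x l)"
    unfolding E by (subst sum.swap) (simp add: mult_ac)
  then have "E + E = (\<Sum>l=1..n. \<Sum>k=1..n. (C l k + C k l) * (x k * x l))"
    by (subst E, simp add: sum.distrib algebra_simps)
  also have "\<dots> \<in> I" using skewC by (intro rideal_sum[OF I] rideal_mult2[OF I]) auto
  finally have "h * (E + E) \<in> I" by (rule rideal_mult[OF I])
  moreover have "h * (E + E) = (h * 2) * E" by (simp add: algebra_simps)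
  ultimately have EI: "E \<in> I" using two by simp
  \<comment> \<open>\<open>Y 0 i * E\<close> is the \<open>i\<close>-th entry of
    \<open>C^T x\<close> and \<open>e i\<close> that of \<open>C x\<close>, hence their sum lies in
    \<open>I\<close>.\<close>
  have eI: "e i \<in> I" if i: "i \<in> {1..n}" for i
  proof -
    have "Y 0 i * E = (\<Sum>l=1..n. C l i * x l)"
      unfolding E_def sum_distrib_left by (simp add: CY[OF i] mult_ac)
    then have "e i + Y 0 i * E = (\<Sum>l=1..n. (C i l + C l i) * x l)"
      by (simp add: e_def distrib_right sum.distrib)
    also have "\<dots> \<in> I" using skewC i by (intro rideal_sum[OF I] rideal_mult2[OF I]) auto
    finally show ?thesis
      using rideal_diff[OF I, of "e i + Y 0 i * E" "Y 0 i * E"] rideal_mult[OF I EI] by simp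
  qed
  have "C i j \<in> I" using CY[OF ij(2)] rideal_mult2[OF I eI[OF ij(1)]] by simp
  then show "A i j ^ q - A i j \<in> I" using rideal_uminus[OF I] unfolding C_def by fastforce
qed

end

section \<open>Finite fields and Moore matrices\<close>

lemma power_card_eq_same: "(x::'a::{field,finite}) ^ CARD('a) = x"
proof (cases "x = 0")
  case False
  have "x * (\<Prod>y\<in>UNIV-{0}. x * y) = x * x ^ (CARD('a) - 1) * \<Prod>(UNIV-{0})"
    by (simp add: prod.distrib mult_ac)
  also have "x * x ^ (CARD('a) - 1) = x ^ Suc (CARD('a) - 1)"
    by (subst power_Suc) auto
  also have "Suc (CARD('a) - 1) = CARD('a)"
    using finite_UNIV_card_ge_0[where ?'a = 'a] by simp
  also have "(\<Prod>y\<in>UNIV-{0}. x * y) = (\<Prod>y\<in>UNIV-{0}. y)"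
    by (rule prod.reindex_bij_witness[of _ "\<lambda>y. y / x" "\<lambda>y. x * y"]) (use False in auto)
  finally show ?thesis by simp
qed (use finite_UNIV_card_ge_0[where ?'a = 'a] in \<open>auto simp: zero_power\<close>)

lemma card_field_ge_2: "CARD('a::{field,finite}) \<ge> 2"
  using card_mono[of "UNIV :: 'a set" "{0, 1}"] by simp

text \<open>The polynomial \<open>(t + 1)\<^sup>q - t\<^sup>q - 1\<close> has degree less than \<open>q\<close> and \<open>q\<close> roots.\<close>

lemma of_nat_card_choose_eq_0:
  assumes "0 < i" "i < CARD('a)"
  shows "of_nat (CARD('a) choose i) = (0::'a::{field,finite})"
proof -
  let ?q = "CARD('a)"
  define p :: "'a poly" where "p = (\<Sum>i\<in>{1..<?q}. Polynomial.monom (of_nat (?q choose i)) i)"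
  have q: "?q \<ge> 2" by (rule card_field_ge_2)
  have p0: "poly p x = 0" for x
  proof -
    have "{..?q} = insert 0 (insert ?q {1..<?q})" using q by auto
    then have "(x + 1) ^ ?q = 1 + (x ^ ?q + poly p x)"
      unfolding binomial_ring using q by (simp add: p_def poly_sum poly_monom)
    then show ?thesis by (simp add: power_card_eq_same)
  qed
  have "degree p \<le> ?q - 1"
    unfolding p_def by (rule degree_sum_le) (auto intro: order_trans[OF degree_monom_le])
  then have "p = 0"
    using q by (intro poly_eqI_degree[of UNIV]) (auto simp: p0)
  moreover have "poly.coeff p i = of_nat (?q choose i)"
    using assms by (auto simp: p_def coeff_sum)
  ultimately show ?thesis by simp
qed

lemma frobenius_add_of_choose:
  fixes a b :: "'b::comm_ring_1"
  assumes "q > 0" "\<And>i. 0 < i \<Longrightarrow> i < q \<Longrightarrow> of_nat (q choose i) = (0::'b)"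
  shows "(a + b) ^ q = a ^ q + b ^ q"
proof -
  have "(a + b) ^ q = (\<Sum>k\<in>{0, q}. of_nat (q choose k) * a ^ k * b ^ (q - k))"
    unfolding binomial_ring by (rule sum.mono_neutral_right) (use assms in auto)
  then show ?thesis using assms(1) by (simp add: add.commute)
qed

text \<open>Vanishing binomial coefficients are preserved by ring homomorphisms. This serves the
  polynomial ring, its fraction field and the polynomials over the latter.\<close>

lemma (in comm_ring_hom) frobenius_add_hom:
  fixes a b :: 'b
  assumes "q > 0" "\<And>i. 0 < i \<Longrightarrow> i < q \<Longrightarrow> of_nat (q choose i) = (0::'a)"
  shows "(a + b) ^ q = a ^ q + b ^ q"
  by (rule frobenius_add_of_choose) (use assms hom_of_nat hom_zero in \<open>metis+\<close>)

section \<open>Polynomials with prescribed roots\<close>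

lemma monic_linear_prod:
  fixes f :: "'c \<Rightarrow> 'e::idom"
  shows "degree (\<Prod>u\<in>W. [:f u, 1:]) = card W" "poly.coeff (\<Prod>u\<in>W. [:f u, 1:]) (card W) = 1"
proof -
  show d: "degree (\<Prod>u\<in>W. [:f u, 1:]) = card W"
    by (subst degree_prod_eq_sum_degree) auto
  have "lead_coeff (\<Prod>u\<in>W. [:f u, 1:]) = 1" by (simp add: lead_coeff_prod)
  then show "poly.coeff (\<Prod>u\<in>W. [:f u, 1:]) (card W) = 1" by (simp only: d)
qed

text \<open>Both sides are monic of degree \<open>card W\<close> and vanish on the coset
  \<open>x + W\<close>; on the left this is because translation by an element of \<open>W\<close>
  permutes the factors.\<close>

lemma coset_poly_identity:
  fixes W :: "'e::field set" and x :: 'e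
  assumes W: "finite W" "0 \<in> W" "\<And>u w. u \<in> W \<Longrightarrow> w \<in> W \<Longrightarrow> u + w \<in> W" "\<And>u. u \<in> W \<Longrightarrow> - u \<in> W"
  shows "(\<Prod>u\<in>W. [:u, 1:]) - [:\<Prod>u\<in>W. x + u:] = (\<Prod>u\<in>W. [:- (x + u), 1:])"
proof (rule poly_eqI_degree_lead_coeff[of _ "card W" _ "(\<lambda>u. x + u) ` W"])
  have n: "card W > 0" using W(1,2) by (auto simp: card_gt_0_iff)
  show "poly.coeff ((\<Prod>u\<in>W. [:u, 1:]) - [:\<Prod>u\<in>W. x + u:]) (card W) =
      poly.coeff (\<Prod>u\<in>W. [:- (x + u), 1:]) (card W)"
    using n by (simp add: monic_linear_prod coeff_pCons split: nat.split)
  show "card W \<le> card ((\<lambda>u. x + u) ` W)" by (simp add: card_image)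
  show "degree ((\<Prod>u\<in>W. [:u, 1:]) - [:\<Prod>u\<in>W. x + u:]) \<le> card W"
    by (rule degree_diff_le) (simp_all add: monic_linear_prod)
  show "degree (\<Prod>u\<in>W. [:- (x + u), 1:]) \<le> card W" by (simp add: monic_linear_prod)
  fix z assume "z \<in> (\<lambda>u. x + u) ` W"
  then obtain w where w: "w \<in> W" "z = x + w" by blast
  have "(\<Prod>u\<in>W. x + w + u) = (\<Prod>u\<in>W. x + u)"
    by (rule prod.reindex_bij_witness[of _ "\<lambda>u. u + - w" "\<lambda>u. w + u"])
      (use W(3) W(4)[OF w(1)] w in \<open>auto simp: add.assoc simp del: add_uminus_conv_diff\<close>)
  then have "(\<Prod>u\<in>W. u + z) = (\<Prod>u\<in>W. x + u)" by (simp add: w(2) add_ac)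
  moreover have "(\<Prod>u\<in>W. - (x + u) + z) = 0" using W(1) w by auto
  ultimately show "poly ((\<Prod>u\<in>W. [:u, 1:]) - [:\<Prod>u\<in>W. x + u:]) z = poly (\<Prod>u\<in>W. [:- (x + u), 1:]) z"
    by (simp add: poly_prod)
qed

lemma field_poly_identity:
  "(\<Prod>c\<in>UNIV. [:- c, 1:]) = Polynomial.monom 1 CARD('a) - [:0, 1:: 'a::{field,finite}:]"
proof (rule poly_eqI_degree_lead_coeff[of _ "CARD('a)" _ UNIV])
  have q: "CARD('a) \<ge> 2" by (rule card_field_ge_2)
  show "poly.coeff (\<Prod>c\<in>UNIV. [:- c, 1:]) CARD('a) = poly.coeff (Polynomial.monom 1 CARD('a) - [:0, 1::'a:]) CARD('a)"
    using q by (simp add: monic_linear_prod coeff_pCons split: nat.split)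
  show "degree (Polynomial.monom 1 CARD('a) - [:0, 1::'a:]) \<le> CARD('a)"
    using q by (intro degree_diff_le) (auto simp: degree_monom_eq)
  show "poly (\<Prod>c\<in>UNIV. [:- c, 1:]) z = poly (Polynomial.monom 1 CARD('a) - [:0, 1::'a:]) z" for z
    by (simp add: poly_prod poly_monom power_card_eq_same)
qed (simp_all add: monic_linear_prod)

context comm_ring_hom
begin

text \<open>Polynomial identities over a domain are proved by counting roots; this evaluation
  carries them to a ring above it.\<close>

definition hom_eval :: "'b \<Rightarrow> 'a poly \<Rightarrow> 'b" where "hom_eval t P = poly (map_poly hom P) t"

lemma hom_eval_simps:
  "hom_eval t (P - Q) = hom_eval t P - hom_eval t Q"
  "hom_eval t (prod f A) = (\<Prod>a\<in>A. hom_eval t (f a))"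
  "hom_eval t [:c:] = hom c"
  "hom_eval t [:c, 1:] = hom c + t"
  "hom_eval t (Polynomial.monom 1 n) = t ^ n"
proof -
  interpret mp: map_poly_comm_ring_hom hom ..
  show "hom_eval t (P - Q) = hom_eval t P - hom_eval t Q" 
    "hom_eval t (prod f A) = (\<Prod>a\<in>A. hom_eval t (f a))"
    by (simp_all add: hom_eval_def mp.hom_minus mp.hom_prod poly_prod)
  show "hom_eval t [:c:] = hom c" "hom_eval t [:c, 1:] = hom c + t" "hom_eval t (Polynomial.monom 1 n) = t ^ n"
    by (simp_all add: hom_eval_def poly_monom map_poly_monom map_poly_pCons_hom)
qed

end

lemma (in comm_ring_hom) coset_prod_identity:
  fixes t :: 'b
  assumes "P - [:N:] = (\<Prod>u\<in>W. [:- (x + u), 1:])" "P = (\<Prod>u\<in>W. [:u, 1:])"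
  shows "(\<Prod>u\<in>W. t + hom u) - hom N = (\<Prod>u\<in>W. t - hom (x + u))"
  using arg_cong[OF assms(1), of "hom_eval t"] 
  by (simp add: assms(2) hom_eval_simps add.commute hom_distribs algebra_simps)

lemma prod_minus_hom_eq_power_diff:
  fixes \<kappa> :: "'a::{field,finite} \<Rightarrow> 'b::comm_ring_1"
  assumes "comm_ring_hom \<kappa>"
  shows "(\<Prod>c\<in>UNIV. p - \<kappa> c) = p ^ CARD('a) - p"
proof -
  interpret comm_ring_hom \<kappa> by fact
  show ?thesis
    using arg_cong[OF field_poly_identity, of "hom_eval p"]
    by (simp add: hom_eval_simps hom_distribs)
qed

text \<open>A nonzero kernel vector of the Moore matrix would be the coefficient vector of a nonzero
  additive polynomial of degree below \<open>q ^ n\<close> that vanishes at all \<open>q ^ n\<close>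
  combinations of the \<open>x j\<close>, which are distinct by \<open>indep\<close>.\<close>

lemma moore_matrix_inverse:
  fixes \<kappa> :: "'a::{field,finite} \<Rightarrow> 'e::field" and x :: "nat \<Rightarrow> 'e"
  defines "q \<equiv> CARD('a)"
  assumes hom: "comm_ring_hom \<kappa>"
    and frob: "\<And>a b::'e. (a + b) ^ q = a ^ q + b ^ q"
    and indep: "\<And>c j. (\<Sum>j=1..n. \<kappa> (c j) * x j) = 0 \<Longrightarrow> j \<in> {1..n} \<Longrightarrow> c j = 0"
  shows "\<exists>Y. (\<forall>i\<in>{1..n}. \<forall>j\<in>{1..n}. (\<Sum>k<n. x i ^ (q ^ k) * Y k j) = (if i = j then 1 else 0)) \<and>
    (\<forall>k<n. \<forall>l<n. (\<Sum>j=1..n. Y k j * x j ^ (q ^ l)) = (if k = l then 1 else 0))"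
proof -
  interpret comm_ring_hom \<kappa> by fact
  have q: "q \<ge> 2" unfolding q_def by (rule card_field_ge_2)
  then have q0: "q > 0" by simp
  define M where "M = mat n n (\<lambda>(i, k). x (Suc i) ^ (q ^ k))"
  have M: "M \<in> carrier_mat n n" by (simp add: M_def)
  have "det M \<noteq> 0"
  proof
    assume "det M = 0"
    then obtain v where v: "v \<in> carrier_vec n" "v \<noteq> 0\<^sub>v n" "M *\<^sub>v v = 0\<^sub>v n"
      using det_0_iff_vec_prod_zero_field[OF M] by blast
    define f where "f = (\<Sum>k<n. Polynomial.monom (v $ k) (q ^ k))"
    have root1: "poly f (x j) = 0" if "j \<in> {1..n}" for j
    proof -
      have "(M *\<^sub>v v) $ (j - 1) = (\<Sum>k<n. x j ^ (q ^ k) * v $ k)"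
        using that v(1) by (auto simp: M_def scalar_prod_def atLeast0LessThan intro!: sum.cong)
      moreover have "(0\<^sub>v n :: 'e vec) $ (j - 1) = 0" using that by (subst index_zero_vec) auto
      ultimately show ?thesis using v(3) by (simp add: f_def poly_sum poly_monom mult.commute)
    qed
    have kq: "\<kappa> c ^ q ^ k = \<kappa> c" for c k
      by (induction k) (simp_all add: power_mult mult.commute[of q] power_card_eq_same
          flip: hom_power, simp_all add: q_def power_card_eq_same flip: hom_power)
    \<comment> \<open>\<open>f\<close> is additive and, as scalars are fixed by \<open>kq\<close>,
      linear over the finite field, so its roots form a subspace.\<close>
    have roots: "poly f (\<Sum>j=1..n. \<kappa> (c j) * x j) = 0" for c
    proof -
      have "poly f (\<Sum>j=1..n. \<kappa> (c j) * x j) =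
          (\<Sum>k<n. \<Sum>j=1..n. \<kappa> (c j) * (v $ k * x j ^ (q ^ k)))"
        by (simp add: f_def poly_sum poly_monom frob_iter_sum[OF frob q0] sum_distrib_left
            power_mult_distrib kq mult.left_commute)
      also have "\<dots> = (\<Sum>j=1..n. \<Sum>k<n. \<kappa> (c j) * (v $ k * x j ^ (q ^ k)))"
        by (rule sum.swap)
      also have "\<dots> = (\<Sum>j=1..n. \<kappa> (c j) * poly f (x j))"
        by (simp add: sum_distrib_left f_def poly_sum poly_monom)
      also have "\<dots> = 0" by (simp add: root1)
      finally show ?thesis .
    qed
    let ?L = "\<lambda>c. \<Sum>j=1..n. \<kappa> (c j) * x j"
    have inj: "inj_on ?L ({1..n} \<rightarrow>\<^sub>E UNIV)"
    proof (rule inj_onI)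
      fix c d assume cd: "c \<in> {1..n} \<rightarrow>\<^sub>E UNIV" "d \<in> {1..n} \<rightarrow>\<^sub>E UNIV" "?L c = ?L d"
      have "?L (\<lambda>j. c j - d j) = 0"
        using cd(3) by (simp add: hom_distribs left_diff_distrib sum_subtractf)
      from indep[OF this] show "c = d"
        by (intro PiE_ext[OF cd(1,2)]) auto
    qed
    have "card (?L ` ({1..n} \<rightarrow>\<^sub>E UNIV)) = q ^ n"
      unfolding card_image[OF inj] by (simp add: card_PiE q_def)
    moreover have "degree f < q ^ n"
    proof (cases n)
      case 0 then show ?thesis by (simp add: f_def)
    next
      case (Suc n')
      have "degree f \<le> q ^ n'" unfolding f_def
        by (rule degree_sum_le)
          (use q Suc in \<open>auto intro!: order_trans[OF degree_monom_le] power_increasing\<close>)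
      also have "\<dots> < q ^ n" using q Suc by simp
      finally show ?thesis .
    qed
    ultimately have "f = 0"
      by (intro poly_eqI_degree[of "?L ` ({1..n} \<rightarrow>\<^sub>E UNIV)"]) (use q in \<open>auto simp: roots[unfolded One_nat_def]\<close>)
    have "v $ k = 0" if "k < n" for k
    proof -
      have "poly.coeff f (q ^ k) = (\<Sum>l<n. if l = k then v $ l else 0)"
        unfolding f_def coeff_sum by (rule sum.cong) (use q in auto)
      then show ?thesis using \<open>f = 0\<close> that by simp
    qed
    then show False using v(1,2) by auto
  qed
  from det_non_zero_imp_unit[OF M this] obtain N where
    N: "N \<in> carrier_mat n n" "M * N = 1\<^sub>m n" "N * M = 1\<^sub>m n"
    unfolding Units_def by (auto simp: ring_mat_simps)
  have MN: "(\<Sum>k<n. x (Suc i) ^ (q ^ k) * N $$ (k, j)) = (if i = j then 1 else 0)"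
    if "i < n" "j < n" for i j
  proof -
    have "(M * N) $$ (i, j) = (\<Sum>k<n. x (Suc i) ^ (q ^ k) * N $$ (k, j))"
      using that N(1) by (auto simp: M_def scalar_prod_def atLeast0LessThan intro!: sum.cong)
    then show ?thesis using N(2) that by simp
  qed
  have NM: "(\<Sum>j=1..n. N $$ (k, j - 1) * x j ^ (q ^ l)) = (if k = l then 1 else 0)"
    if "k < n" "l < n" for k l
  proof -
    have "(N * M) $$ (k, l) = (\<Sum>j=0..<n. N $$ (k, j) * x (Suc j) ^ (q ^ l))"
      using that N(1) by (auto simp: M_def scalar_prod_def intro!: sum.cong)
    also have "\<dots> = (\<Sum>j=1..n. N $$ (k, j - 1) * x j ^ (q ^ l))"
      by (rule sum.reindex_bij_witness[of _ "\<lambda>j. j - 1" Suc]) auto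
    finally show ?thesis using N(3) that by simp
  qed
  show ?thesis
  proof (intro exI[of _ "\<lambda>k j. N $$ (k, j - 1)"] conjI ballI allI impI)
    fix i j assume "i \<in> {1..n}" "j \<in> {1..n}"
    then show "(\<Sum>k<n. x i ^ (q ^ k) * N $$ (k, j - 1)) = (if i = j then 1 else 0)"
      using MN[of "i - 1" "j - 1"] by (cases i; cases j) auto
  qed (rule NM)
qed

section \<open>Evaluation of polynomials and the action on linear maps\<close>

text \<open>The formula of \<open>psubst\<close> with values in any commutative ring, so that
  polynomials can be evaluated at field vectors and in the polynomial ring over the function
  field.\<close>

definition meval :: "('a::field \<Rightarrow> 'b::comm_ring_1) \<Rightarrow> (nat \<Rightarrow> 'b) \<Rightarrow> 'a mpoly \<Rightarrow> 'b" where
  "meval \<kappa> s f = (\<Sum>t\<in>Poly_Mapping.keys f.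
     \<kappa> (Poly_Mapping.lookup f t) * (\<Prod>i\<in>Poly_Mapping.keys t. s i ^ Poly_Mapping.lookup t i))"

lemma psubst_eq_meval: "psubst = meval pconst"
  by (intro ext) (simp add: psubst_def meval_def)

context
  fixes \<kappa> :: "'a::field \<Rightarrow> 'b::comm_ring_1" and s :: "nat \<Rightarrow> 'b"
  assumes hom: "comm_ring_hom \<kappa>"
begin

interpretation comm_ring_hom \<kappa> by (rule hom)

lemma meval_superset:
  assumes "finite A" "Poly_Mapping.keys f \<subseteq> A"
  shows "meval \<kappa> s f = (\<Sum>t\<in>A. \<kappa> (Poly_Mapping.lookup f t) *
     (\<Prod>i\<in>Poly_Mapping.keys t. s i ^ Poly_Mapping.lookup t i))"
  unfolding meval_def
  by (rule sum.mono_neutral_left) (use assms in \<open>auto simp: in_keys_iff\<close>)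

lemma meval_add: "meval \<kappa> s (f + g) = meval \<kappa> s f + meval \<kappa> s g"
proof -
  let ?A = "Poly_Mapping.keys f \<union> Poly_Mapping.keys g"
  have "Poly_Mapping.keys (f + g) \<subseteq> ?A" by (rule Poly_Mapping.keys_add)
  then show ?thesis
    by (subst (1 2 3) meval_superset[of ?A])
       (auto simp: lookup_add hom_add distrib_right sum.distrib)
qed

lemma meval_sum: "meval \<kappa> s (sum f A) = (\<Sum>a\<in>A. meval \<kappa> s (f a))"
  by (induction A rule: infinite_finite_induct) (auto simp: meval_def[of _ _ 0] meval_add)

lemma meval_single: "meval \<kappa> s (Poly_Mapping.single t c) =
    \<kappa> c * (\<Prod>i\<in>Poly_Mapping.keys t. s i ^ Poly_Mapping.lookup t i)"
  by (subst meval_superset[of "{t}"]) auto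

lemma meval_single_mult:
  "meval \<kappa> s (Poly_Mapping.single t c * Poly_Mapping.single u d) =
   meval \<kappa> s (Poly_Mapping.single t c) * meval \<kappa> s (Poly_Mapping.single u d)"
proof -
  let ?A = "Poly_Mapping.keys t \<union> Poly_Mapping.keys u"
  have k: "Poly_Mapping.keys (t + u) \<subseteq> ?A" by (rule Poly_Mapping.keys_add)
  have m: "(\<Prod>i\<in>Poly_Mapping.keys v. s i ^ Poly_Mapping.lookup v i)
      = (\<Prod>i\<in>?A. s i ^ Poly_Mapping.lookup v i)" if "v \<in> {t, u, t + u}" for v
    by (rule monom_prod_superset) (use that k in auto)
  show ?thesis
    unfolding mult_single meval_single hom_mult
    by (subst (1 2 3) m) (simp_all only: insert_iff simp_thms lookup_add power_add prod.distrib mult_ac)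
qed

lemma meval_mult: "meval \<kappa> s (f * g) = meval \<kappa> s f * meval \<kappa> s g"
proof -
  let ?S = "\<lambda>f t. Poly_Mapping.single t (Poly_Mapping.lookup f t)"
  have "meval \<kappa> s (f * g) = meval \<kappa> s ((\<Sum>t\<in>Poly_Mapping.keys f. ?S f t) * (\<Sum>u\<in>Poly_Mapping.keys g. ?S g u))"
    by (simp flip: mpoly_sum_singles)
  also have "\<dots> = (\<Sum>t\<in>Poly_Mapping.keys f. meval \<kappa> s (?S f t)) * (\<Sum>u\<in>Poly_Mapping.keys g. meval \<kappa> s (?S g u))"
    by (simp add: sum_product meval_sum meval_single_mult)
  also have "\<dots> = meval \<kappa> s f * meval \<kappa> s g"
    by (simp flip: meval_sum mpoly_sum_singles)
  finally show ?thesis .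
qed

lemma meval_pconst: "meval \<kappa> s (pconst c) = \<kappa> c"
  unfolding pconst_def[of c] meval_single by simp

lemma meval_pvar: "meval \<kappa> s (pvar i) = s i"
  unfolding pvar_def meval_single by simp

lemma meval_hom: "comm_ring_hom (meval \<kappa> s)"
proof
  show "meval \<kappa> s 1 = 1" using meval_pconst[of 1] by (simp add: pconst_def)
qed (auto simp: meval_add meval_mult meval_def[of _ _ 0])

end

lemma (in comm_ring_hom) hom_meval:
  fixes \<kappa> :: "'c::field \<Rightarrow> 'a"
  shows "hom (meval \<kappa> s f) = meval (\<lambda>c. hom (\<kappa> c)) (\<lambda>i. hom (s i)) f"
  by (simp add: meval_def hom_distribs)

lemma comm_ring_hom_comp: "comm_ring_hom f \<Longrightarrow> comm_ring_hom g \<Longrightarrow> comm_ring_hom (\<lambda>x. f (g x))"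
proof -
  assume "comm_ring_hom f" "comm_ring_hom g"
  then interpret f: comm_ring_hom f + g: comm_ring_hom g by simp_all
  show ?thesis by standard (simp_all add: f.hom_add g.hom_add f.hom_mult g.hom_mult)
qed

lemma comm_ring_hom_pconst: "comm_ring_hom pconst"
  by standard (simp_all add: pconst_def mult_single single_add)

lemma comm_ring_hom_to_fract: "comm_ring_hom to_fract"
  by standard simp_all

interpretation pconst: comm_ring_hom pconst by (rule comm_ring_hom_pconst)

interpretation to_fract: comm_ring_hom to_fract by (rule comm_ring_hom_to_fract)

lemma pconst_add: "pconst (a + b) = pconst a + pconst b"
  and pconst_mult: "pconst (a * b) = pconst a * pconst b"
  and pconst_0: "pconst 0 = 0"
  and pconst_1: "pconst 1 = 1"
  by (simp_all add: pconst_def mult_single single_add)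

lemma pconst_uminus: "pconst (- a) = - pconst a"
  by (simp add: pconst.hom_uminus)

lemma pconst_sum: "pconst (sum f A) = (\<Sum>a\<in>A. pconst (f a))"
  by (simp add: pconst.hom_sum)

lemma pconst_power: "pconst (a ^ k) = pconst a ^ k"
  by (simp add: pconst.hom_power)

lemma pconst_inj: "pconst a = pconst b \<longleftrightarrow> a = b"
  unfolding pconst_def by (metis lookup_single_eq)

lemma to_fract_sum: "to_fract (sum f A) = (\<Sum>a\<in>A. to_fract (f a))"
  by (simp add: to_fract.hom_sum)

lemma to_fract_prod: "to_fract (prod f A) = (\<Prod>a\<in>A. to_fract (f a))"
  by (simp add: to_fract.hom_prod)

lemma rideal_cong_meval:
  assumes J: "rideal J" and f: "f \<in> poly_ring_V n" and s: "\<And>i. i \<in> {1..n} \<Longrightarrow> s i - s' i \<in> J"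
  shows "meval \<kappa> s f - meval \<kappa> s' f \<in> J"
  unfolding meval_def
proof (intro rideal_cong_sum[OF J] rideal_cong_mult[OF J] rideal_cong_prod[OF J] rideal_cong_power[OF J])
  fix t i assume "t \<in> Poly_Mapping.keys f" "i \<in> Poly_Mapping.keys t"
  then have "i \<in> {1..n}" using f unfolding poly_ring_V_def by blast
  then show "s i - s' i \<in> J" by (rule s)
qed (simp add: rideal_0[OF J])

lemma meval_cong:
  assumes "f \<in> poly_ring_V n" "\<And>i. i \<in> {1..n} \<Longrightarrow> s i = s' i"
  shows "meval \<kappa> s f = meval \<kappa> s' f"
  using rideal_cong_meval[of "{0}" f n s s' \<kappa>] assms by (auto simp: rideal_def)

lemma pconst_poly_ring_V: "pconst c \<in> poly_ring_V n"
  by (auto simp: poly_ring_V_def pconst_def)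

lemma pvar_poly_ring_V: "i \<in> {1..n} \<Longrightarrow> pvar i \<in> poly_ring_V n"
  by (auto simp: poly_ring_V_def pvar_def)

lemma poly_ring_V_add: "f \<in> poly_ring_V n \<Longrightarrow> g \<in> poly_ring_V n \<Longrightarrow> f + g \<in> poly_ring_V n"
  using Poly_Mapping.keys_add[of f g] by (auto simp: poly_ring_V_def)

lemma poly_ring_V_mult: 
  assumes "f \<in> poly_ring_V n" "g \<in> poly_ring_V n" shows "f * g \<in> poly_ring_V n"
  unfolding poly_ring_V_def
proof (intro CollectI ballI)
  fix t assume "t \<in> Poly_Mapping.keys (f * g)"
  then obtain a b where "t = a + b" "a \<in> Poly_Mapping.keys f" "b \<in> Poly_Mapping.keys g"
    using keys_mult[of f g] by auto
  then show "Poly_Mapping.keys t \<subseteq> {1..n}"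
    using assms Poly_Mapping.keys_add[of a b] unfolding poly_ring_V_def by blast
qed

lemma poly_ring_V_0: "0 \<in> poly_ring_V n"
  and poly_ring_V_1: "1 \<in> poly_ring_V n"
  by (simp_all add: poly_ring_V_def)

lemma poly_ring_V_sum: "(\<And>a. a \<in> A \<Longrightarrow> f a \<in> poly_ring_V n) \<Longrightarrow> sum f A \<in> poly_ring_V n"
  by (induction A rule: infinite_finite_induct) (auto simp: poly_ring_V_0 poly_ring_V_add)

lemma poly_ring_V_prod: "(\<And>a. a \<in> A \<Longrightarrow> f a \<in> poly_ring_V n) \<Longrightarrow> prod f A \<in> poly_ring_V n"
  by (induction A rule: infinite_finite_induct) (auto simp: poly_ring_V_1 poly_ring_V_mult)

lemma poly_ring_V_power: "f \<in> poly_ring_V n \<Longrightarrow> f ^ k \<in> poly_ring_V n"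
  by (induction k) (auto simp: poly_ring_V_1 poly_ring_V_mult)

section \<open>Polynomials over the function field acting on linear maps\<close>

definition fconst :: "'a::field \<Rightarrow> 'a mpoly fract" where "fconst c = to_fract (pconst c)"

definition fvar :: "nat \<Rightarrow> 'a::field mpoly fract" where "fvar i = to_fract (pvar i)"

lemma comm_ring_hom_fconst: "comm_ring_hom fconst"
  unfolding fconst_def by (rule comm_ring_hom_comp[OF comm_ring_hom_to_fract comm_ring_hom_pconst])

text \<open>This is \<open>f(T)\<close>: the variables of the outer polynomial ring stand for the
  \<open>T_i\<close>, and the coefficients are embedded as constants.\<close>

definition ev_fract :: "'a::field mpoly \<Rightarrow> 'a mpoly fract mpoly" where
  "ev_fract = meval (\<lambda>c. pconst (fconst c)) pvar"

lemma comm_ring_hom_ev_coeff: "comm_ring_hom (\<lambda>c. pconst (fconst c))"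
  by (rule comm_ring_hom_comp[OF comm_ring_hom_pconst comm_ring_hom_fconst])

lemma comm_ring_hom_ev_fract: "comm_ring_hom ev_fract"
  unfolding ev_fract_def by (rule meval_hom[OF comm_ring_hom_ev_coeff])

lemma ev_fract_singles:
  "ev_fract f = (\<Sum>t\<in>Poly_Mapping.keys f. Poly_Mapping.single t (fconst (Poly_Mapping.lookup f t)))"
  unfolding ev_fract_def meval_def pvar_monom by (simp add: pconst_def mult_single)

text \<open>The polynomial ring over \<open>E = \<F>(V)\<close> acts on the \<open>K\<close>-linear maps \<open>L : E \<rightarrow> E\<close>: its
  variables act by precomposition with multiplication by the corresponding variable of \<open>E\<close>,
  and its coefficients by postcomposition.\<close>

definition lin_act :: "('a::field mpoly fract \<Rightarrow> 'a mpoly fract) \<Rightarrow> 'a mpoly fract mpoly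
    \<Rightarrow> 'a mpoly fract \<Rightarrow> 'a mpoly fract" where
  "lin_act L p e = (\<Sum>t\<in>Poly_Mapping.keys p.
     Poly_Mapping.lookup p t * L (to_fract (Poly_Mapping.single t 1) * e))"

definition annih :: "('a::field mpoly fract \<Rightarrow> 'a mpoly fract) \<Rightarrow> 'a mpoly fract mpoly set" where
  "annih L = {p. \<forall>e. lin_act L p e = 0}"

lemma lin_act_superset:
  assumes "finite A" "Poly_Mapping.keys p \<subseteq> A"
  shows "lin_act L p e = (\<Sum>t\<in>A.
     Poly_Mapping.lookup p t * L (to_fract (Poly_Mapping.single t 1) * e))"
  unfolding lin_act_def
  by (rule sum.mono_neutral_left) (use assms in \<open>auto simp: in_keys_iff\<close>)

lemma lin_act_add: "lin_act L (p + r) e = lin_act L p e + lin_act L r e"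
proof -
  let ?A = "Poly_Mapping.keys p \<union> Poly_Mapping.keys r"
  have "Poly_Mapping.keys (p + r) \<subseteq> ?A" by (rule Poly_Mapping.keys_add)
  then show ?thesis
    by (subst (1 2 3) lin_act_superset[of ?A]) (auto simp: lookup_add distrib_right sum.distrib)
qed

lemma lin_act_0: "lin_act L 0 e = 0"
  by (simp add: lin_act_def)

lemma lin_act_sum: "lin_act L (sum f A) e = (\<Sum>a\<in>A. lin_act L (f a) e)"
  by (induction A rule: infinite_finite_induct) (auto simp: lin_act_0 lin_act_add)

lemma lin_act_single:
  "lin_act L (Poly_Mapping.single t c) e = c * L (to_fract (Poly_Mapping.single t 1) * e)"
  by (subst lin_act_superset[of "{t}"]) auto

text \<open>Associativity of the action for a monomial factor, which is what makes the annihilator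
  an ideal.\<close>

lemma lin_act_single_mult:
  "lin_act L (Poly_Mapping.single t c * p) e = c * lin_act L p (to_fract (Poly_Mapping.single t 1) * e)"
proof -
  have "lin_act L (Poly_Mapping.single t c * Poly_Mapping.single u d) e =
      c * lin_act L (Poly_Mapping.single u d) (to_fract (Poly_Mapping.single t 1) * e)" for u d
  proof -
    have eq: "Poly_Mapping.single (t + u) (1::'a) = Poly_Mapping.single u 1 * Poly_Mapping.single t 1"
      by (simp add: mult_single add.commute)
    show ?thesis
      unfolding mult_single[of t c u d] lin_act_single by (simp only: eq to_fract_mult mult.assoc)
  qed
  then have "lin_act L (Poly_Mapping.single t c *
      (\<Sum>u\<in>Poly_Mapping.keys p. Poly_Mapping.single u (Poly_Mapping.lookup p u))) e =
      c * lin_act L (\<Sum>u\<in>Poly_Mapping.keys p. Poly_Mapping.single u (Poly_Mapping.lookup p u))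
        (to_fract (Poly_Mapping.single t 1) * e)"
    by (simp add: sum_distrib_left lin_act_sum)
  then show ?thesis by (simp flip: mpoly_sum_singles)
qed

lemma rideal_annih: "rideal (annih L)"
  unfolding rideal_def
proof (intro conjI ballI allI)
  fix p r assume p: "p \<in> annih L"
  have "lin_act L ((\<Sum>u\<in>Poly_Mapping.keys r. Poly_Mapping.single u (Poly_Mapping.lookup r u)) * p) e = 0" for e
    using p by (simp add: sum_distrib_right lin_act_sum lin_act_single_mult annih_def)
  then show "r * p \<in> annih L" by (simp add: annih_def flip: mpoly_sum_singles)
qed (auto simp: annih_def lin_act_0 lin_act_add)

context
  fixes L :: "'a::field mpoly fract \<Rightarrow> 'a mpoly fract"
  assumes L_add: "\<And>x y. L (x + y) = L x + L y"
    and L_const: "\<And>c x. L (fconst c * x) = fconst c * L x"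
begin

lemma L_sum: "L (sum f A) = (\<Sum>a\<in>A. L (f a))"
proof -
  have "L 0 = 0" using L_add[of 0 0] by (metis add_0_left add_cancel_left_left)
  then show ?thesis by (induction A rule: infinite_finite_induct) (auto simp: L_add)
qed

text \<open>The coefficients of \<open>f(T)\<close> are scalars that commute with \<open>L\<close>,
  so \<open>f(T)\<close> acts purely by precomposition with multiplication by
  \<open>f\<close>.\<close>

lemma lin_act_ev_fract: "lin_act L (ev_fract f) e = L (to_fract f * e)"
proof -
  let ?c = "\<lambda>t. Poly_Mapping.lookup f t"
  have "lin_act L (ev_fract f) e =
      (\<Sum>t\<in>Poly_Mapping.keys f. L (fconst (?c t) * (to_fract (Poly_Mapping.single t 1) * e)))"
    by (simp add: ev_fract_singles lin_act_sum lin_act_single L_const)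
  also have "\<dots> = L ((\<Sum>t\<in>Poly_Mapping.keys f. to_fract (Poly_Mapping.single t (?c t))) * e)"
    by (simp add: L_sum sum_distrib_right fconst_def pconst_def mult_single flip: to_fract_mult mult.assoc)
  also have "\<dots> = L (to_fract f * e)" by (simp flip: to_fract_sum mpoly_sum_singles)
  finally show ?thesis .
qed

lemma lin_act_pconst: "lin_act L (pconst c) e = c * L e"
  unfolding pconst_def lin_act_single by simp

text \<open>If \<open>L\<close> commutes with multiplication by \<open>f\<close>, then
  precomposition, which is how \<open>f(T)\<close> acts, agrees with postcomposition, which is how
  the constant \<open>f(x)\<close> acts.\<close>

lemma ev_fract_mem_annih:
  assumes "\<And>x. L (to_fract f * x) = to_fract f * L x"
  shows "ev_fract f - pconst (to_fract f) \<in> annih L"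
  unfolding annih_def
proof (intro CollectI allI)
  fix e
  have "lin_act L (pconst (to_fract f)) e = lin_act L (ev_fract f) e"
    by (simp add: lin_act_ev_fract lin_act_pconst assms)
  then show "lin_act L (ev_fract f - pconst (to_fract f)) e = 0"
    using lin_act_add[of L "ev_fract f - pconst (to_fract f)" "pconst (to_fract f)" e] by simp
qed

text \<open>The annihilating element is applied to \<open>L\<close> and evaluated at 1.\<close>

lemma ev_fract_relation:
  assumes "pconst (to_fract b) * ev_fract a - pconst (to_fract a) * ev_fract b \<in> annih L"
  shows "to_fract b * L (to_fract a) = to_fract a * L (to_fract b)"
proof -
  let ?p = "pconst (to_fract b) * ev_fract a" and ?r = "pconst (to_fract a) * ev_fract b"
  have c: "lin_act L (pconst c * p) 1 = c * lin_act L p 1" for c p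
    unfolding pconst_def lin_act_single_mult by simp
  have "lin_act L (?p - ?r) 1 = 0" using assms by (simp add: annih_def)
  then have "lin_act L ?p 1 = lin_act L ?r 1"
    using lin_act_add[of L "?p - ?r" ?r 1] by simp
  then show ?thesis by (simp add: c lin_act_ev_fract)
qed

end

text \<open>By Zorn's lemma there is a subspace \<open>M\<close> maximal among those containing
  \<open>b\<close> but not \<open>a\<close>. It is a complement of the line \<open>K a\<close>, and
  \<open>L\<close> reads off the coefficient of \<open>a\<close>.\<close>

lemma exists_linear_functional:
  fixes K :: "'e::field set"
  assumes K: "0 \<in> K" "1 \<in> K" "\<And>x y. x \<in> K \<Longrightarrow> y \<in> K \<Longrightarrow> x + y \<in> K"
    "\<And>x y. x \<in> K \<Longrightarrow> y \<in> K \<Longrightarrow> x * y \<in> K" "\<And>x. x \<in> K \<Longrightarrow> - x \<in> K"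
    "\<And>x. x \<in> K \<Longrightarrow> x \<noteq> 0 \<Longrightarrow> inverse x \<in> K"
    and a: "\<And>k. k \<in> K \<Longrightarrow> a \<noteq> k * b"
  shows "\<exists>L. (\<forall>x y. L (x + y) = L x + L y) \<and> (\<forall>k\<in>K. \<forall>x. L (k * x) = k * L x) \<and> L b = 0 \<and> L a = (1::'e)"
proof -
  define S where "S = {U. b \<in> U \<and> a \<notin> U \<and> (\<forall>x\<in>U. \<forall>y\<in>U. x + y \<in> U) \<and> (\<forall>k\<in>K. \<forall>x\<in>U. k * x \<in> U)}"
  have "(\<lambda>k. k * b) ` K \<in> S"
    unfolding S_def
  proof (intro CollectI conjI ballI)
    show "b \<in> (\<lambda>k. k * b) ` K" using K(2) by (intro image_eqI[of _ _ 1]) auto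
    show "a \<notin> (\<lambda>k. k * b) ` K" using a by blast
  next
    fix x y assume "x \<in> (\<lambda>k. k * b) ` K" "y \<in> (\<lambda>k. k * b) ` K"
    then obtain k l where "k \<in> K" "l \<in> K" "x + y = (k + l) * b" by (auto simp: distrib_right)
    then show "x + y \<in> (\<lambda>k. k * b) ` K" using K(3) by blast
  next
    fix l x assume "l \<in> K" "x \<in> (\<lambda>k. k * b) ` K"
    then obtain k where "k \<in> K" "l \<in> K" "l * x = (l * k) * b" by (auto simp: mult.assoc)
    then show "l * x \<in> (\<lambda>k. k * b) ` K" using K(4) by blast
  qed
  moreover have "\<Union>C \<in> S" if "C \<noteq> {}" "subset.chain S C" for C
  proof -
    have CS: "C \<subseteq> S" and chain: "\<And>U V. U \<in> C \<Longrightarrow> V \<in> C \<Longrightarrow> U \<subseteq> V \<or> V \<subseteq> U"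
      using that(2) by (auto simp: subset_chain_def)
    have "x + y \<in> \<Union>C" if xy: "x \<in> \<Union>C" "y \<in> \<Union>C" for x y
    proof -
      obtain U V where UV: "U \<in> C" "V \<in> C" "x \<in> U" "y \<in> V" using xy by blast
      then obtain X where "X \<in> C" "x \<in> X" "y \<in> X" using chain[of U V] by blast
      then show ?thesis using CS unfolding S_def by blast
    qed
    then show ?thesis using CS that(1) unfolding S_def by blast
  qed
  ultimately obtain M where M: "M \<in> S" "\<And>X. X \<in> S \<Longrightarrow> M \<subseteq> X \<Longrightarrow> X = M"
    using subset_Zorn_nonempty[of S] by blast
  have Mb: "b \<in> M" and Ma: "a \<notin> M" and Madd: "\<And>x y. x \<in> M \<Longrightarrow> y \<in> M \<Longrightarrow> x + y \<in> M"
    and Mk: "\<And>k x. k \<in> K \<Longrightarrow> x \<in> M \<Longrightarrow> k * x \<in> M"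
    using M(1) unfolding S_def by auto
  have Mneg: "- x \<in> M" if "x \<in> M" for x
    using Mk[of "-1" x] K(2,5) that by auto
  have M0: "0 \<in> M" using Mk[OF K(1) Mb] by simp
  have ex: "\<exists>k\<in>K. x - k * a \<in> M" for x
  proof (rule ccontr)
    assume n: "\<not> ?thesis"
    let ?X = "{u + k * x | u k. u \<in> M \<and> k \<in> K}"
    have "M \<subseteq> ?X"
    proof
      fix u assume "u \<in> M"
      moreover have "u = u + 0 * x" by simp
      ultimately show "u \<in> ?X" using K(1) by blast
    qed
    moreover have "x \<in> ?X"
    proof -
      have "x = 0 + 1 * x" by simp
      then show ?thesis using M0 K(2) by blast
    qed
    moreover have "x \<notin> M" using n K(1) by (auto dest!: bspec[of _ _ 0])
    ultimately have "?X \<notin> S" using M(2) by blast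
    moreover have "b \<in> ?X" using \<open>M \<subseteq> ?X\<close> Mb by blast
    moreover have "y + z \<in> ?X" if yz: "y \<in> ?X" "z \<in> ?X" for y z
    proof -
      obtain u k v l where "y = u + k * x" "z = v + l * x" "u \<in> M" "v \<in> M" "k \<in> K" "l \<in> K"
        using yz by blast
      moreover from this have "y + z = (u + v) + (k + l) * x" by (simp add: algebra_simps)
      ultimately show ?thesis using Madd K(3) by blast
    qed
    moreover have "l * y \<in> ?X" if yl: "y \<in> ?X" "l \<in> K" for y l
    proof -
      obtain u k where "y = u + k * x" "u \<in> M" "k \<in> K" using yl by blast
      moreover from this have "l * y = l * u + (l * k) * x" by (simp add: algebra_simps)
      ultimately show ?thesis using Mk K(4) yl(2) by blast
    qed
    \<comment> \<open>By maximality the subspace \<open>M + K x\<close> can only fail to lie in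
      \<open>S\<close> by containing \<open>a\<close>; solving for \<open>x\<close> then contradicts
      the choice of \<open>x\<close>.\<close>
    ultimately have "a \<in> ?X" unfolding S_def by blast
    then obtain u k where uk: "a = u + k * x" "u \<in> M" "k \<in> K" by blast
    then have "k \<noteq> 0" using Ma by auto
    then have "x - inverse k * a = inverse k * (- u)" using uk(1) by (simp add: field_simps)
    also have "\<dots> \<in> M" using uk K(6) \<open>k \<noteq> 0\<close> by (intro Mk Mneg) auto
    finally show False using n K(6) uk(3) \<open>k \<noteq> 0\<close> by blast
  qed
  have uniq: "k = l" if "k \<in> K" "l \<in> K" "x - k * a \<in> M" "x - l * a \<in> M" for k l x
  proof (rule ccontr)
    assume "k \<noteq> l"
    have "(x - l * a) + - (x - k * a) \<in> M" using that by (intro Madd Mneg)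
    moreover have "(x - l * a) + - (x - k * a) = (k - l) * a" by (simp add: algebra_simps)
    ultimately have "(k - l) * a \<in> M" by simp
    moreover have "inverse (k - l) \<in> K"
      using K(3)[OF that(1) K(5)[OF that(2)]] K(6) \<open>k \<noteq> l\<close> by simp
    ultimately have "inverse (k - l) * ((k - l) * a) \<in> M" by (rule Mk[rotated])
    then show False using Ma \<open>k \<noteq> l\<close> by (simp flip: mult.assoc)
  qed
  define L where "L x = (THE k. k \<in> K \<and> x - k * a \<in> M)" for x
  have L1: "L x \<in> K \<and> x - L x * a \<in> M" for x
    unfolding L_def by (rule theI') (use ex uniq in blast)
  have L2: "L x = k" if "k \<in> K" "x - k * a \<in> M" for x k
    using uniq L1 that by blast
  have "L (x + y) = L x + L y" for x y
  proof (rule L2)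
    have "(x - L x * a) + (y - L y * a) \<in> M" using Madd L1 by blast
    then show "x + y - (L x + L y) * a \<in> M" by (simp add: algebra_simps)
  qed (use L1 K(3) in blast)
  moreover have "L (k * x) = k * L x" if k: "k \<in> K" for k x
  proof (rule L2)
    have "k * (x - L x * a) \<in> M" using Mk L1 k by blast
    then show "k * x - k * L x * a \<in> M" by (simp add: algebra_simps)
  qed (use L1 K(4) k in blast)
  moreover have "L b = 0" "L a = 1"
    by (rule L2; use K M0 Mb in simp)+
  ultimately show ?thesis by blast
qed

section \<open>The group and the orbits of the variables\<close>

text \<open>Summing all field elements before and after the shift by 1 gives \<open>q = 0\<close> in
  the field; together with \<open>2 = 0\<close> an odd \<open>q\<close> would give
  \<open>1 = 0\<close>.\<close>

lemma two_neq_0_of_odd_card: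
  assumes "odd CARD('a::{field,finite})"
  shows "(2::'a) \<noteq> 0"
proof
  assume two: "(2::'a) = 0"
  have "(\<Sum>x\<in>UNIV. x + 1) = (\<Sum>x\<in>UNIV. x :: 'a)"
    by (rule sum.reindex_bij_witness[of _ "\<lambda>x. x - 1" "\<lambda>x. x + 1"]) auto
  then have "of_nat CARD('a) = (0::'a)" by (simp add: sum.distrib)
  moreover obtain k where "CARD('a) = 2 * k + 1" using assms by (elim oddE)
  ultimately show False using two by simp
qed

text \<open>The reflection of the indices swaps the two halves. This turns the sums defining
  \<open>h_k\<close> into values of the bilinear form.\<close>

lemma sum_pair_reflect:
  fixes f :: "nat \<Rightarrow> nat \<Rightarrow> 'b::comm_monoid_add"
  shows "(\<Sum>i=1..m. f (2 * m - i + 1) i + f i (2 * m - i + 1)) = (\<Sum>i=1..2*m. f (2 * m - i + 1) i)"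
proof -
  have "{1..2*m} = {1..m} \<union> {m+1..2*m}" by auto
  then have "(\<Sum>i=1..2*m. f (2 * m - i + 1) i) =
      (\<Sum>i=1..m. f (2 * m - i + 1) i) + (\<Sum>i=m+1..2*m. f (2 * m - i + 1) i)"
    by (simp add: sum.union_disjoint)
  moreover have "(\<Sum>i=m+1..2*m. f (2 * m - i + 1) i) = (\<Sum>i=1..m. f i (2 * m - i + 1))"
    by (rule sum.reindex_bij_witness[of _ "\<lambda>i. 2 * m - i + 1" "\<lambda>i. 2 * m - i + 1"]) auto
  ultimately show ?thesis by (simp add: sum.distrib)
qed

section \<open>Linear forms in the first \<open>k\<close> variables\<close>

definition lcomb :: "nat \<Rightarrow> (nat \<Rightarrow> 'a::field) \<Rightarrow> 'a mpoly" where
  "lcomb k c = (\<Sum>j=1..k. pconst (c j) * pvar j)"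

definition lspan :: "nat \<Rightarrow> 'a::field mpoly set" where
  "lspan k = range (lcomb k)"

lemma lspan_add: "u \<in> lspan k \<Longrightarrow> v \<in> lspan k \<Longrightarrow> u + v \<in> lspan k"
proof -
  assume "u \<in> lspan k" "v \<in> lspan k"
  then obtain c d where "u = lcomb k c" "v = lcomb k d" unfolding lspan_def by blast
  then have "u + v = lcomb k (\<lambda>j. c j + d j)"
    by (simp add: lcomb_def pconst_add distrib_right sum.distrib)
  then show ?thesis unfolding lspan_def by simp
qed

lemma lspan_scale: "u \<in> lspan k \<Longrightarrow> pconst a * u \<in> lspan k"
proof -
  assume "u \<in> lspan k"
  then obtain c where "u = lcomb k c" unfolding lspan_def by blast
  then have "pconst a * u = lcomb k (\<lambda>j. a * c j)"
    by (simp add: lcomb_def pconst_mult sum_distrib_left mult.assoc)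
  then show ?thesis unfolding lspan_def by simp
qed

lemma lspan_0: "0 \<in> lspan k"
  using lspan_scale[of "lcomb k (\<lambda>_. 0)" k 0] by (simp add: lspan_def pconst_0)

lemma lspan_uminus: "u \<in> lspan k \<Longrightarrow> - u \<in> lspan k"
  using lspan_scale[of u k "-1"] by (simp add: pconst_uminus pconst_1)

lemma lspan_diff: "u \<in> lspan k \<Longrightarrow> v \<in> lspan k \<Longrightarrow> u - v \<in> lspan k"
  using lspan_add[of u k "- v"] lspan_uminus by fastforce

lemma lspan_sum: "(\<And>a. a \<in> A \<Longrightarrow> f a \<in> lspan k) \<Longrightarrow> sum f A \<in> lspan k"
  by (induction A rule: infinite_finite_induct) (auto simp: lspan_0 lspan_add)

lemma pvar_lspan: "j \<in> {1..k} \<Longrightarrow> (pvar j :: 'a::field mpoly) \<in> lspan k"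
proof -
  assume "j \<in> {1..k}"
  then have "(pvar j :: 'a mpoly) = lcomb k (\<lambda>i. if i = j then 1 else 0)"
    by (simp add: lcomb_def if_distrib[of pconst] if_distrib[of "\<lambda>x. x * _"] pconst_0 pconst_1
        cong: if_cong)
  then show ?thesis unfolding lspan_def by simp
qed

lemma lspan_mono: "k \<le> l \<Longrightarrow> lspan k \<subseteq> lspan l"
proof
  fix u :: "'a mpoly" assume kl: "k \<le> l" and "u \<in> lspan k"
  then obtain c where "u = lcomb k c" unfolding lspan_def by blast
  then show "u \<in> lspan l" using kl unfolding lcomb_def
    by (auto intro!: lspan_sum lspan_scale pvar_lspan)
qed

lemma finite_lspan: "finite (lspan k :: 'a::{field,finite} mpoly set)"
proof -
  have "lspan k \<subseteq> (lcomb k :: _ \<Rightarrow> 'a mpoly) ` ({1..k} \<rightarrow>\<^sub>E UNIV)"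
  proof
    fix u :: "'a mpoly" assume "u \<in> lspan k"
    then obtain c where "u = lcomb k c" unfolding lspan_def by blast
    then show "u \<in> lcomb k ` ({1..k} \<rightarrow>\<^sub>E UNIV)"
      by (intro image_eqI[of _ _ "restrict c {1..k}"]) (simp_all add: lcomb_def)
  qed
  then show ?thesis by (rule finite_subset) (simp add: finite_PiE)
qed

lemma lspan_poly_ring_V: "u \<in> lspan k \<Longrightarrow> k \<le> n \<Longrightarrow> u \<in> poly_ring_V n"
  unfolding lspan_def lcomb_def
  by (auto intro!: poly_ring_V_sum poly_ring_V_mult pconst_poly_ring_V pvar_poly_ring_V)

text \<open>For invertible \<open>M\<close> this is the image of \<open>x_i\<close> under the
  inverse of \<open>M\<close>, because the action itself involves an inverse.\<close>

definition row_form :: "nat \<Rightarrow> 'a::field mat \<Rightarrow> nat \<Rightarrow> 'a mpoly" where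
  "row_form n M i = (\<Sum>j=1..n. pconst (M $$ (i - 1, j - 1)) * pvar j)"

lemma row_form_diff_lspan:
  assumes M: "M \<in> lower_unitriangular n" and i: "i \<in> {1..n}" and k: "k < i"
    and z: "\<And>j. k < j \<Longrightarrow> j < i \<Longrightarrow> M $$ (i - 1, j - 1) = 0"
  shows "row_form n M i - pvar i \<in> lspan k"
proof -
  have "row_form n M i = (\<Sum>j\<in>{1..k} \<union> {i}. pconst (M $$ (i - 1, j - 1)) * pvar j)"
    unfolding row_form_def
  proof (rule sum.mono_neutral_right)
    show "\<forall>j\<in>{1..n} - ({1..k} \<union> {i}). pconst (M $$ (i - 1, j - 1)) * pvar j = 0"
    proof
      fix j assume j: "j \<in> {1..n} - ({1..k} \<union> {i})"
      then have "j < i \<or> i - 1 < j - 1" using i by auto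
      then have "M $$ (i - 1, j - 1) = 0"
        using z[of j] j i M by (auto simp: lower_unitriangular_def)
      then show "pconst (M $$ (i - 1, j - 1)) * pvar j = 0" by (simp add: pconst_0)
    qed
  qed (use i k in auto)
  also have "\<dots> = (\<Sum>j=1..k. pconst (M $$ (i - 1, j - 1)) * pvar j) + pvar i"
    using M i k by (subst sum.union_disjoint) (auto simp: lower_unitriangular_def pconst_1)
  finally show ?thesis
    by (auto intro!: lspan_sum lspan_scale pvar_lspan)
qed

section \<open>The matrix equation of the group in terms of entries\<close>

lemma mult_mat_entry:
  "A \<in> carrier_mat n n \<Longrightarrow> B \<in> carrier_mat n n \<Longrightarrow> i < n \<Longrightarrow> j < n \<Longrightarrow>
    (A * B) $$ (i, j) = (\<Sum>k=0..<n. A $$ (i, k) * B $$ (k, j))"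
  by (auto simp: scalar_prod_def intro!: sum.cong)

lemma antidiag_carrier: "antidiag_mat n \<in> carrier_mat n n"
  by (simp add: antidiag_mat_def)

lemma antidiag_mult_left:
  assumes "A \<in> carrier_mat n n" "i < n" "j < n"
  shows "(antidiag_mat n * A) $$ (i, j) = A $$ (n - 1 - i, j)"
proof -
  have "(antidiag_mat n * A) $$ (i, j) = (\<Sum>k=0..<n. if k = n - 1 - i then A $$ (k, j) else 0)"
    unfolding mult_mat_entry[OF antidiag_carrier assms]
    by (rule sum.cong) (use assms(2) in \<open>auto simp: antidiag_mat_def\<close>)
  then show ?thesis using assms by auto
qed

lemma antidiag_mult_right:
  assumes "A \<in> carrier_mat n n" "i < n" "j < n"
  shows "(A * antidiag_mat n) $$ (i, j) = A $$ (i, n - 1 - j)"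
proof -
  have "(A * antidiag_mat n) $$ (i, j) = (\<Sum>k=0..<n. if k = n - 1 - j then A $$ (i, k) else 0)"
    unfolding mult_mat_entry[OF assms(1) antidiag_carrier assms(2,3)]
    by (rule sum.cong) (use assms(3) in \<open>auto simp: antidiag_mat_def\<close>)
  then show ?thesis using assms by auto
qed

lemma antidiag_conj_entry:
  assumes M: "M \<in> carrier_mat n n" and jl: "j < n" "l < n"
  shows "(transpose_mat M * antidiag_mat n * M) $$ (j, l) = (\<Sum>i=1..n. M $$ (n - i, j) * M $$ (i - 1, l))"
proof -
  have T: "transpose_mat M \<in> carrier_mat n n" using M by simp
  have "(transpose_mat M * antidiag_mat n * M) $$ (j, l) =
      (\<Sum>k=0..<n. (transpose_mat M * antidiag_mat n) $$ (j, k) * M $$ (k, l))"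
    by (rule mult_mat_entry[OF mult_carrier_mat[OF T antidiag_carrier] M jl])
  also have "\<dots> = (\<Sum>k=0..<n. M $$ (n - 1 - k, j) * M $$ (k, l))"
  proof (rule sum.cong)
    fix k assume k: "k \<in> {0..<n}"
    then have "(transpose_mat M * antidiag_mat n) $$ (j, k) = M $$ (n - 1 - k, j)"
      using antidiag_mult_right[OF T jl(1), of k] M jl by simp
    then show "(transpose_mat M * antidiag_mat n) $$ (j, k) * M $$ (k, l) = M $$ (n - 1 - k, j) * M $$ (k, l)"
      by simp
  qed simp
  also have "\<dots> = (\<Sum>i=1..n. M $$ (n - i, j) * M $$ (i - 1, l))"
    by (rule sum.reindex_bij_witness[of _ "\<lambda>i. i - 1" Suc]) auto
  finally show ?thesis .
qed

lemma sylow_O_plus_iff: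
  "M \<in> sylow_O_plus m \<longleftrightarrow> M \<in> lower_unitriangular (2 * m) \<and>
    (\<forall>j\<in>{1..2*m}. \<forall>l\<in>{1..2*m}. (\<Sum>i=1..2*m. M $$ (2 * m - i, j - 1) * M $$ (i - 1, l - 1)) =
      (if j + l = 2 * m + 1 then 1 else 0))"
proof (cases "M \<in> lower_unitriangular (2 * m)")
  case True
  let ?n = "2 * m"
  have M: "M \<in> carrier_mat ?n ?n" using True by (simp add: lower_unitriangular_def)
  let ?E = "transpose_mat M * antidiag_mat ?n * M"
  have "M \<in> sylow_O_plus m \<longleftrightarrow> (\<forall>j<?n. \<forall>l<?n. ?E $$ (j, l) = antidiag_mat ?n $$ (j, l))"
  proof -
    have "?E = antidiag_mat ?n" if h: "\<forall>j<?n. \<forall>l<?n. ?E $$ (j, l) = antidiag_mat ?n $$ (j, l)"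
    proof (rule eq_matI)
      fix i j assume "i < dim_row (antidiag_mat ?n :: 'a mat)" "j < dim_col (antidiag_mat ?n :: 'a mat)"
      then show "?E $$ (i, j) = antidiag_mat ?n $$ (i, j)"
        by (intro h[rule_format]) (simp_all add: antidiag_mat_def)
    qed (use M in \<open>simp_all add: antidiag_mat_def\<close>)
    then show ?thesis using True unfolding sylow_O_plus_def by auto
  qed
  also have "\<dots> \<longleftrightarrow> (\<forall>j\<in>{1..?n}. \<forall>l\<in>{1..?n}. ?E $$ (j - 1, l - 1) = antidiag_mat ?n $$ (j - 1, l - 1))"
  proof (intro iffI allI impI ballI)
    fix j l assume h: "\<forall>j\<in>{1..?n}. \<forall>l\<in>{1..?n}. ?E $$ (j - 1, l - 1) = antidiag_mat ?n $$ (j - 1, l - 1)"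
      and "j < ?n" "l < ?n"
    then show "?E $$ (j, l) = antidiag_mat ?n $$ (j, l)"
      using bspec[OF bspec[OF h, of "Suc j"], of "Suc l"] by simp
  qed auto
  also have "\<dots> \<longleftrightarrow> (\<forall>j\<in>{1..?n}. \<forall>l\<in>{1..?n}.
      (\<Sum>i=1..?n. M $$ (?n - i, j - 1) * M $$ (i - 1, l - 1)) = (if j + l = ?n + 1 then 1 else 0))"
  proof (intro ball_cong refl)
    fix j l assume jl: "j \<in> {1..?n}" "l \<in> {1..?n}"
    then have "?E $$ (j - 1, l - 1) = (\<Sum>i=1..?n. M $$ (?n - i, j - 1) * M $$ (i - 1, l - 1))"
      by (intro antidiag_conj_entry[OF M]) auto
    moreover have "antidiag_mat ?n $$ (j - 1, l - 1) = (if j + l = ?n + 1 then 1 else (0::'a))"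
      using jl by (auto simp: antidiag_mat_def)
    ultimately show "(?E $$ (j - 1, l - 1) = antidiag_mat ?n $$ (j - 1, l - 1)) =
        ((\<Sum>i=1..?n. M $$ (?n - i, j - 1) * M $$ (i - 1, l - 1)) = (if j + l = ?n + 1 then 1 else 0))"
      by (simp only:)
  qed
  finally show ?thesis using True by simp
qed (simp add: sylow_O_plus_def)

context
  fixes M :: "'a::field mat" and m n :: nat
  assumes M: "M \<in> sylow_O_plus m" and n: "n = 2 * m"
begin

interpretation ring "ring_mat TYPE('a) n ()" by (rule ring_mat)

abbreviation "minv \<equiv> inv\<^bsub>ring_mat TYPE('a) n ()\<^esub> M"

lemma sylow_carrier: "M \<in> carrier_mat n n" "minv \<in> carrier_mat n n"
  and sylow_inv_r: "M * minv = 1\<^sub>m n"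
  using sylow_O_plus_Units[OF M] Units_closed Units_inv_closed Units_r_inv
  unfolding n[symmetric] by (auto simp: ring_mat_simps)

text \<open>As \<open>J J = 1\<close>, the equation \<open>M^T J M = J\<close> makes
  \<open>J M^T J\<close> a left inverse of \<open>M\<close>.\<close>

lemma sylow_inv_eq: "minv = antidiag_mat n * transpose_mat M * antidiag_mat n" (is "_ = ?H")
proof -
  let ?J = "antidiag_mat n :: 'a mat"
  have J: "?J \<in> carrier_mat n n" by (simp add: antidiag_mat_def)
  have JJ: "?J * ?J = 1\<^sub>m n"
  proof (rule eq_matI)
    fix i j assume ij: "i < dim_row (1\<^sub>m n :: 'a mat)" "j < dim_col (1\<^sub>m n :: 'a mat)"
    then have "(?J * ?J) $$ (i, j) = ?J $$ (n - 1 - i, j)"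
      by (intro antidiag_mult_left[OF J]) auto
    then show "(?J * ?J) $$ (i, j) = 1\<^sub>m n $$ (i, j)"
      using ij by (auto simp: antidiag_mat_def)
  qed (simp_all add: antidiag_mat_def)
  have T: "transpose_mat M \<in> carrier_mat n n" using sylow_carrier by simp
  have H: "?H \<in> carrier_mat n n" using J T by simp
  have "?H * M = ?J * (transpose_mat M * ?J * M)"
    using J T sylow_carrier by (simp add: assoc_mult_mat[where n\<^sub>2=n and n\<^sub>3=n and n\<^sub>4=n])
  also have "\<dots> = 1\<^sub>m n" using M JJ by (simp add: sylow_O_plus_def n)
  finally have HM: "?H * M = 1\<^sub>m n" .
  have "minv = (?H * M) * minv" using HM sylow_carrier by simp
  also have "\<dots> = ?H * (M * minv)"
    by (rule assoc_mult_mat[OF H sylow_carrier])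
  also have "\<dots> = ?H" by (simp only: sylow_inv_r right_mult_one_mat[OF H])
  finally show ?thesis .
qed

lemma sylow_inv_entry: "i < n \<Longrightarrow> j < n \<Longrightarrow> minv $$ (i, j) = M $$ (n - 1 - j, n - 1 - i)"
proof -
  assume ij: "i < n" "j < n"
  have T: "transpose_mat M \<in> carrier_mat n n" using sylow_carrier by simp
  have "minv $$ (i, j) = (antidiag_mat n * transpose_mat M) $$ (i, n - 1 - j)"
    unfolding sylow_inv_eq by (rule antidiag_mult_right[OF mult_carrier_mat[OF antidiag_carrier T] ij])
  also have "\<dots> = transpose_mat M $$ (n - 1 - i, n - 1 - j)"
    using ij by (intro antidiag_mult_left[OF T]) auto
  finally show ?thesis using ij sylow_carrier by simp
qed

lemma sylow_inv_mem: "minv \<in> sylow_O_plus m"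
proof -
  have L: "minv \<in> lower_unitriangular n"
  proof -
    have "M $$ (i, i) = 1" if "i < n" for i
      using M that by (simp add: sylow_O_plus_def lower_unitriangular_def n)
    moreover have "M $$ (i, j) = 0" if "i < j" "j < n" for i j
      using M that by (simp add: sylow_O_plus_def lower_unitriangular_def n)
    ultimately show ?thesis
      using sylow_carrier by (auto simp: lower_unitriangular_def sylow_inv_entry)
  qed
  let ?J = "antidiag_mat n :: 'a mat"
  have J: "?J \<in> carrier_mat n n" by (simp add: antidiag_mat_def)
  note C = sylow_carrier J transpose_carrier_mat[THEN iffD2, OF sylow_carrier(1)]
    transpose_carrier_mat[THEN iffD2, OF sylow_carrier(2)]
  have MJ: "transpose_mat M * ?J * M = ?J" using M by (simp add: sylow_O_plus_def n)
  have "transpose_mat minv * ?J * minv = transpose_mat minv * (transpose_mat M * ?J * M) * minv"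
    by (simp only: MJ)
  also have "\<dots> = (transpose_mat minv * transpose_mat M) * ?J * (M * minv)"
    using C by (simp add: assoc_mult_mat[where n\<^sub>2=n and n\<^sub>3=n and n\<^sub>4=n])
  also have "transpose_mat minv * transpose_mat M = 1\<^sub>m n"
    using transpose_mult[OF sylow_carrier] by (simp add: sylow_inv_r)
  finally have "transpose_mat minv * ?J * minv = ?J"
    using J sylow_inv_r by simp
  then show ?thesis using L by (simp add: sylow_O_plus_def n)
qed

lemma sylow_inv_inv: "inv\<^bsub>ring_mat TYPE('a) n ()\<^esub> minv = M"
  by (rule Units_inv_inv[OF sylow_O_plus_Units[OF M, folded n]])

lemma act_var_inv: "i \<in> {1..n} \<Longrightarrow> act_var n minv i = row_form n M i"
  unfolding act_var_def row_form_def by (simp add: sylow_inv_inv)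

text \<open>The sum is the entry of \<open>M * minv\<close> at \<open>(i, n - 1 - i)\<close>, which
  is off the diagonal because \<open>n\<close> is even.\<close>

lemma sylow_row_isotropic:
  assumes "i < n"
  shows "(\<Sum>k=0..<n. M $$ (i, k) * M $$ (i, n - 1 - k)) = 0"
proof -
  have "n - 1 - i \<noteq> i" "n - 1 - i < n" using assms n by presburger+
  then have "0 = (M * minv) $$ (i, n - 1 - i)" using assms by (simp add: sylow_inv_r)
  also have "\<dots> = (\<Sum>k=0..<n. M $$ (i, k) * minv $$ (k, n - 1 - i))"
    using assms sylow_carrier by (auto simp: scalar_prod_def intro!: sum.cong)
  also have "\<dots> = (\<Sum>k=0..<n. M $$ (i, k) * M $$ (i, n - 1 - k))"
    using assms by (intro sum.cong) (auto simp: sylow_inv_entry)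
  finally show ?thesis ..
qed

end

text \<open>In the isotropy relation of row \<open>m\<close> (counted from 0) triangularity leaves
  two equal terms, so twice the entry is 0. Hence \<open>x_m\<close> does not occur in the orbit of
  \<open>x_{m+1}\<close>.\<close>

lemma sylow_middle_entry:
  fixes M :: "'a::field mat"
  assumes M: "M \<in> sylow_O_plus m" and m: "m \<ge> 1" and two: "(2::'a) \<noteq> 0"
  shows "M $$ (m, m - 1) = 0"
proof -
  have L: "M \<in> lower_unitriangular (2 * m)" using M by (simp add: sylow_O_plus_def)
  have "0 = (\<Sum>k=0..<2*m. M $$ (m, k) * M $$ (m, 2 * m - 1 - k))"
    using sylow_row_isotropic[OF M refl, of m] m by simp
  also have "\<dots> = (\<Sum>k\<in>{m - 1, m}. M $$ (m, k) * M $$ (m, 2 * m - 1 - k))"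
  proof (rule sum.mono_neutral_right)
    show "\<forall>k\<in>{0..<2 * m} - {m - 1, m}. M $$ (m, k) * M $$ (m, 2 * m - 1 - k) = 0"
    proof
      fix k assume k: "k \<in> {0..<2 * m} - {m - 1, m}"
      then have "k > m \<or> 2 * m - 1 - k > m" by auto
      then show "M $$ (m, k) * M $$ (m, 2 * m - 1 - k) = 0"
        using L k m by (auto simp: lower_unitriangular_def)
    qed
  qed (use m in auto)
  also have "\<dots> = 2 * M $$ (m, m - 1)"
  proof -
    have "2 * m - 1 - (m - 1) = m" "2 * m - 1 - m = m - 1" "M $$ (m, m) = 1" "m - 1 \<noteq> m"
      using L m by (auto simp: lower_unitriangular_def)
    then show ?thesis by simp
  qed
  finally show ?thesis using two by simp
qed

text \<open>For \<open>i \<le> m + 1\<close>, the number of initial variables that can be added to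
  \<open>x_i\<close> within its orbit: all earlier ones, except that \<open>x_{m+1}\<close> misses
  \<open>x_m\<close>.\<close>

definition orbit_dim :: "nat \<Rightarrow> nat \<Rightarrow> nat" where
  "orbit_dim m i = min (i - 1) (m - 1)"

lemma row_form_sylow:
  fixes M :: "'a::field mat"
  assumes M: "M \<in> sylow_O_plus m" and m: "m \<ge> 1" and two: "(2::'a) \<noteq> 0" and i: "i \<in> {1..m + 1}"
  shows "row_form (2 * m) M i - pvar i \<in> lspan (orbit_dim m i)"
proof (rule row_form_diff_lspan)
  show "M \<in> lower_unitriangular (2 * m)" using M by (simp add: sylow_O_plus_def)
  fix j assume j: "orbit_dim m i < j" "j < i"
  then have "i = m + 1" "j = m" using i by (auto simp: orbit_dim_def)
  then show "M $$ (i - 1, j - 1) = 0" using sylow_middle_entry[OF M m two] by simp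
qed (use i m in \<open>auto simp: orbit_dim_def\<close>)

text \<open>The element of \<open>G\<close> with \<open>x\<^sub>i \<mapsto> x\<^sub>i + \<Sum>\<^sub>j c\<^sub>j x\<^sub>j\<close> and \<open>x\<^sub>j\<^sub>* \<mapsto> x\<^sub>j\<^sub>* - c\<^sub>j x\<^sub>i\<^sub>*\<close>, where
  \<open>i* = 2m + 1 - i\<close>.\<close>

definition transvection :: "nat \<Rightarrow> nat \<Rightarrow> (nat \<Rightarrow> 'a::field) \<Rightarrow> 'a mat" where
  "transvection m i c = mat (2 * m) (2 * m) (\<lambda>(r, s). (if r = s then 1 else 0) +
     (if r = i - 1 \<and> s < orbit_dim m i then c (s + 1)
      else if s = 2 * m - i \<and> 2 * m - 1 - r < orbit_dim m i then - c (2 * m - r) else 0))"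

text \<open>Writing the matrix as \<open>1 + N\<close>, the terms of the form quadratic in
  \<open>N\<close> vanish and the two linear ones cancel.\<close>

lemma transvection_mem:
  assumes m: "m \<ge> 1" and i: "i \<in> {1..m + 1}"
  shows "transvection m i c \<in> sylow_O_plus m"
  unfolding sylow_O_plus_iff
proof (intro conjI ballI)
  let ?k = "orbit_dim m i"
  show "transvection m i c \<in> lower_unitriangular (2 * m)"
    unfolding lower_unitriangular_def transvection_def using m i by (auto simp: orbit_dim_def)
  define N where "N = (\<lambda>r s. if r = i - 1 \<and> s < ?k then c (s + 1)
      else if s = 2 * m - i \<and> 2 * m - 1 - r < ?k then - c (2 * m - r) else 0)"
  fix j l assume jl: "j \<in> {1..2 * m}" "l \<in> {1..2 * m}"
  have T: "transvection m i c $$ (r, s) = (if r = s then 1 else 0) + N r s" if "r < 2 * m" "s < 2 * m" for r s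
    using that by (simp add: transvection_def N_def)
  have "(\<Sum>r=1..2*m. transvection m i c $$ (2 * m - r, j - 1) * transvection m i c $$ (r - 1, l - 1)) =
     (\<Sum>r=1..2*m. (if r = 2 * m + 1 - j then (if r = l then 1 else 0) else 0)
       + (if r = 2 * m + 1 - j then N (r - 1) (l - 1) else 0)
       + (if r = l then N (2 * m - r) (j - 1) else 0))"
  proof (rule sum.cong)
    fix r assume r: "r \<in> {1..2*m}"
    have a: "2 * m - r < 2 * m" "j - 1 < 2 * m" "r - 1 < 2 * m" "l - 1 < 2 * m"
      using r jl by auto
    have k: "?k \<le> i - 1" "?k \<le> m - 1" by (auto simp: orbit_dim_def)
    have r': "1 \<le> r" "r \<le> 2 * m" "1 \<le> i" "i \<le> m + 1" using r i by auto
    \<comment> \<open>Otherwise an index would be its own mirror image, against the parity of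
      \<open>2 * m + 1\<close>.\<close>
    have z1: "\<not> (2 * m - r = i - 1 \<and> r - 1 = i - 1)"
    proof
      assume "2 * m - r = i - 1 \<and> r - 1 = i - 1"
      then have "2 * i = 2 * m + 1" using r' by linarith
      then show False by presburger
    qed
    have z2: "\<not> (2 * m - r = i - 1 \<and> 2 * m - 1 - (r - 1) < ?k)"
      using r' k by linarith
    have z3: "\<not> (2 * m - 1 - (2 * m - r) < ?k \<and> r - 1 = i - 1)"
      using r' k by linarith
    have z4: "\<not> (2 * m - 1 - (2 * m - r) < ?k \<and> 2 * m - 1 - (r - 1) < ?k)"
      using r' k by linarith
    from z1 z2 z3 z4 have z: "N (2 * m - r) (j - 1) * N (r - 1) (l - 1) = 0"
      by (simp add: N_def split: if_split)
    have d: "2 * m - r = j - 1 \<longleftrightarrow> r = 2 * m + 1 - j" "r - 1 = l - 1 \<longleftrightarrow> r = l"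
      using r jl by auto
    show "transvection m i c $$ (2 * m - r, j - 1) * transvection m i c $$ (r - 1, l - 1) =
      (if r = 2 * m + 1 - j then (if r = l then 1 else 0) else 0)
       + (if r = 2 * m + 1 - j then N (r - 1) (l - 1) else 0)
       + (if r = l then N (2 * m - r) (j - 1) else 0)"
      unfolding T[OF a(1,2)] T[OF a(3,4)] d distrib_left distrib_right z by simp
  qed simp
  also have "\<dots> = (if 2 * m + 1 - j = l then 1 else 0) + N (2 * m - j) (l - 1) + N (2 * m - l) (j - 1)"
  proof -
    have "2 * m + 1 - j \<in> {1..2*m}" "2 * m + 1 - j - 1 = 2 * m - j" using jl by auto
    then show ?thesis unfolding sum.distrib sum.delta[OF finite_atLeastAtMost] using jl by simp
  qed
  finally have S: "(\<Sum>r=1..2*m. transvection m i c $$ (2 * m - r, j - 1) * transvection m i c $$ (r - 1, l - 1)) =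
      (if 2 * m + 1 - j = l then 1 else 0) + N (2 * m - j) (l - 1) + N (2 * m - l) (j - 1)" .
  have zero: "N (2 * m - j) (l - 1) + N (2 * m - l) (j - 1) = 0"
  proof -
    have k: "?k \<le> i - 1" "?k \<le> m - 1" by (auto simp: orbit_dim_def)
    have jl': "1 \<le> j" "j \<le> 2 * m" "1 \<le> l" "l \<le> 2 * m" "1 \<le> i" "i \<le> m + 1" using jl i by auto
    have e: "2 * m - j = i - 1 \<longleftrightarrow> j - 1 = 2 * m - i" "2 * m - l = i - 1 \<longleftrightarrow> l - 1 = 2 * m - i"
      "2 * m - 1 - (2 * m - j) = j - 1" "2 * m - 1 - (2 * m - l) = l - 1"
      "2 * m - (2 * m - j) = j" "2 * m - (2 * m - l) = l" "l - 1 + 1 = l" "j - 1 + 1 = j"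
      using jl' m by linarith+
    have "\<not> 2 * m - i < ?k" using k jl' by linarith
    then show ?thesis unfolding N_def e by auto
  qed
  have "2 * m + 1 - j = l \<longleftrightarrow> j + l = 2 * m + 1" using jl by auto
  then show "(\<Sum>r=1..2*m. transvection m i c $$ (2 * m - r, j - 1) * transvection m i c $$ (r - 1, l - 1)) =
      (if j + l = 2 * m + 1 then 1 else 0)"
    unfolding S add.assoc zero by simp
qed

lemma row_form_transvection:
  assumes m: "m \<ge> 1" and i: "i \<in> {1..m + 1}"
  shows "row_form (2 * m) (transvection m i c) i = pvar i + (\<Sum>j=1..orbit_dim m i. pconst (c j) * pvar j)"
proof -
  let ?k = "orbit_dim m i"
  have k: "?k < i" "?k \<le> 2 * m" "i \<le> 2 * m" using i m by (auto simp: orbit_dim_def)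
  have "row_form (2 * m) (transvection m i c) i =
      (\<Sum>j=1..2*m. (if j = i then pvar j else 0) + (if j \<le> ?k then pconst (c j) * pvar j else 0))"
    unfolding row_form_def
  proof (rule sum.cong)
    fix j assume j: "j \<in> {1..2*m}"
    have "transvection m i c $$ (i - 1, j - 1) = (if j = i then 1 else 0) + (if j \<le> ?k then c j else 0)"
    proof -
      have "i - 1 < 2 * m" "j - 1 < 2 * m" "i - 1 = j - 1 \<longleftrightarrow> j = i" "j - 1 < ?k \<longleftrightarrow> j \<le> ?k"
        "j - 1 + 1 = j" "\<not> 2 * m - 1 - (i - 1) < ?k"
        using i j m by (auto simp: orbit_dim_def)
      then show ?thesis unfolding transvection_def by simp
    qed
    then show "pconst (transvection m i c $$ (i - 1, j - 1)) * pvar j =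
      (if j = i then pvar j else 0) + (if j \<le> ?k then pconst (c j) * pvar j else 0)"
      by (simp add: pconst_add pconst_0 pconst_1 distrib_right)
  qed simp
  also have "\<dots> = pvar i + (\<Sum>j=1..2*m. if j \<le> ?k then pconst (c j) * pvar j else 0)"
    using i k by (simp add: sum.distrib)
  also have "(\<Sum>j=1..2*m. if j \<le> ?k then pconst (c j) * pvar j else 0) = (\<Sum>j=1..?k. pconst (c j) * pvar j)"
    using k by (intro sum.mono_neutral_cong_right) auto
  finally show ?thesis .
qed

text \<open>The shape of the rows bounds the orbit from above, and the inverses of the transvections
  reach every point of the coset.\<close>

lemma orbit_eq:
  assumes m: "m \<ge> 1" and two: "(2::'a::field) \<noteq> 0" and i: "i \<in> {1..m + 1}"
  shows "(\<lambda>g. act_poly (2 * m) g (pvar i)) ` (sylow_O_plus m :: 'a mat set) =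
    (\<lambda>u. pvar i + u) ` lspan (orbit_dim m i)" (is "?O = ?S")
proof
  have i': "i \<in> {1..2*m}" using i m by auto
  have act: "act_poly (2 * m) g (pvar i) = act_var (2 * m) g i" for g :: "'a mat"
    by (simp add: act_poly_def psubst_pvar)
  show "?O \<subseteq> ?S"
  proof
    fix y assume "y \<in> ?O"
    then obtain g :: "'a mat" where g: "g \<in> sylow_O_plus m" "y = act_var (2 * m) g i" by (auto simp: act)
    let ?h = "inv\<^bsub>ring_mat TYPE('a) (2 * m) ()\<^esub> g"
    have "y = row_form (2 * m) ?h i" using g(2) i' by (simp add: act_var_def row_form_def)
    then have "y - pvar i \<in> lspan (orbit_dim m i)"
      using row_form_sylow[OF sylow_inv_mem[OF g(1) refl] m two i] by simp
    then show "y \<in> ?S" by (intro image_eqI[of _ _ "y - pvar i"]) auto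
  qed
  show "?S \<subseteq> ?O"
  proof
    fix y assume "y \<in> ?S"
    then obtain c where y: "y = pvar i + (\<Sum>j=1..orbit_dim m i. pconst (c j) * pvar j)"
      unfolding lspan_def lcomb_def by blast
    let ?T = "transvection m i c"
    note T = transvection_mem[OF m i, of c]
    have "y = act_poly (2 * m) (inv\<^bsub>ring_mat TYPE('a) (2 * m) ()\<^esub> ?T) (pvar i)"
      unfolding act act_var_inv[OF T refl i'] row_form_transvection[OF m i] y ..
    then show "y \<in> ?O" using sylow_inv_mem[OF T refl] by blast
  qed
qed

lemma orbit_norm_eq:
  assumes m: "m \<ge> 1" and two: "(2::'a::field) \<noteq> 0" and i: "i \<in> {1..m + 1}"
  shows "orbit_norm (2 * m) (sylow_O_plus m :: 'a mat set) i = (\<Prod>u\<in>lspan (orbit_dim m i). pvar i + u)"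
  unfolding orbit_norm_def orbit_eq[OF assms] by (subst prod.reindex) auto

text \<open>The identity of quadratic forms is evaluated at field vectors, polarised to the bilinear
  form, and read off at pairs of unit vectors.\<close>

lemma sylow_of_form:
  fixes M :: "'a::field mat"
  assumes M: "M \<in> lower_unitriangular (2 * m)"
    and form: "(\<Sum>i=1..m. row_form (2 * m) M (2 * m - i + 1) * row_form (2 * m) M i) =
      (\<Sum>i=1..m. pvar (2 * m - i + 1) * pvar i)"
  shows "M \<in> sylow_O_plus m"
  unfolding sylow_O_plus_iff
proof (intro conjI ballI)
  let ?n = "2 * m"
  define R where "R = (\<lambda>v i. \<Sum>j=1..?n. M $$ (i - 1, j - 1) * v j)"
  have hid: "comm_ring_hom (\<lambda>x. x :: 'a)" by standard auto
  have ev: "(\<Sum>i=1..m. R v (?n - i + 1) * R v i) = (\<Sum>i=1..m. v (?n - i + 1) * v i)" for v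
  proof -
    interpret e: comm_ring_hom "meval (\<lambda>x. x) v" by (rule meval_hom[OF hid])
    have "meval (\<lambda>x. x) v (row_form ?n M i) = R v i" for i
      by (simp add: row_form_def R_def e.hom_sum e.hom_mult meval_pconst[OF hid] meval_pvar[OF hid])
    then show ?thesis
      using arg_cong[OF form, of "meval (\<lambda>x. x) v"]
      by (simp add: e.hom_sum e.hom_mult meval_pvar[OF hid])
  qed
  have add: "R (\<lambda>j. v j + w j) i = R v i + R w i" for v w i
    by (simp add: R_def distrib_left sum.distrib)
  have pol: "(\<Sum>i=1..?n. R v (?n - i + 1) * R w i) = (\<Sum>i=1..?n. v (?n - i + 1) * w i)" for v w
  proof -
    have "(\<Sum>i=1..m. R v (?n - i + 1) * R w i + R v i * R w (?n - i + 1)) =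
        (\<Sum>i=1..m. v (?n - i + 1) * w i + v i * w (?n - i + 1))"
      using ev[of "\<lambda>j. v j + w j"] ev[of v] ev[of w]
      unfolding add by (simp add: algebra_simps sum.distrib)
    then show ?thesis
      by (simp only: sum_pair_reflect[of "\<lambda>a b. R v a * R w b"] sum_pair_reflect[of "\<lambda>a b. v a * w b"])
  qed
  fix j l assume jl: "j \<in> {1..?n}" "l \<in> {1..?n}"
  define e :: "nat \<Rightarrow> nat \<Rightarrow> 'a" where "e = (\<lambda>j i. if i = j then 1 else 0)"
  have Re: "R (e j) i = M $$ (i - 1, j - 1)" if "j \<in> {1..?n}" for j i
    using that by (simp add: R_def e_def if_distrib[of "(*) _"] cong: if_cong)
  have "(\<Sum>i=1..?n. M $$ (?n - i, j - 1) * M $$ (i - 1, l - 1)) =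
      (\<Sum>i=1..?n. R (e j) (?n - i + 1) * R (e l) i)"
    using jl by (simp add: Re)
  also have "\<dots> = (\<Sum>i=1..?n. e j (?n - i + 1) * e l i)" by (rule pol)
  also have "\<dots> = (\<Sum>i=1..?n. if i = l then (if ?n - i + 1 = j then 1 else 0) else 0)"
    by (rule sum.cong) (auto simp: e_def)
  also have "\<dots> = (if j + l = ?n + 1 then 1 else 0)" using jl by auto
  finally show "(\<Sum>i=1..?n. M $$ (?n - i, j - 1) * M $$ (i - 1, l - 1)) = (if j + l = ?n + 1 then 1 else 0)" .
qed (rule M)

section \<open>Invariants\<close>

lemma frobenius_add_mpoly:
  "(a + b) ^ CARD('a) = a ^ CARD('a) + (b :: 'a::{field,finite} mpoly) ^ CARD('a)"
  by (rule comm_ring_hom.frobenius_add_hom[OF comm_ring_hom_pconst])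
     (use card_field_ge_2[where 'a='a] of_nat_card_choose_eq_0[where 'a='a] in auto)

lemma frobenius_add_fract:
  "(a + b) ^ CARD('a) = a ^ CARD('a) + (b :: 'a::{field,finite} mpoly fract) ^ CARD('a)"
  by (rule comm_ring_hom.frobenius_add_hom[OF comm_ring_hom_fconst])
     (use card_field_ge_2[where 'a='a] of_nat_card_choose_eq_0[where 'a='a] in auto)

lemma frobenius_add_mpoly_fract:
  "(a + b) ^ CARD('a) = a ^ CARD('a) + (b :: 'a::{field,finite} mpoly fract mpoly) ^ CARD('a)"
  by (rule comm_ring_hom.frobenius_add_hom[OF comm_ring_hom_ev_coeff])
     (use card_field_ge_2[where 'a='a] of_nat_card_choose_eq_0[where 'a='a] in auto)

lemma power_card_power_eq_same: "(c::'a::{field,finite}) ^ (CARD('a) ^ k) = c"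
  by (induction k) (simp_all add: power_mult power_card_eq_same)

lemma card_field_pos: "CARD('a::{field,finite}) > 0"
  using card_field_ge_2[where 'a='a] by simp

lemma comm_ring_hom_act_poly: "comm_ring_hom (act_poly n g)"
  unfolding act_poly_def psubst_eq_meval by (rule meval_hom[OF comm_ring_hom_pconst])

lemma act_poly_pvar: "act_poly n g (pvar i) = act_var n g i"
  by (simp add: act_poly_def psubst_pvar)

lemma act_poly_pconst: "act_poly n g (pconst c) = pconst c"
  by (simp add: act_poly_def psubst_pconst)

lemma act_var_eq_row_form:
  "i \<in> {1..n} \<Longrightarrow> act_var n g i = row_form n (inv\<^bsub>ring_mat TYPE('a::field) n ()\<^esub> g) i"
  by (simp add: act_var_def row_form_def)

lemma inj_act_poly:
  fixes g :: "'a::field mat"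
  assumes g: "g \<in> Units (ring_mat TYPE('a) n ())"
  shows "inj (act_poly n g)"
proof (rule injI)
  interpret act: comm_ring_hom "act_poly n g" by (rule comm_ring_hom_act_poly)
  fix a b assume "act_poly n g a = act_poly n g b"
  then have "act_poly n g (a - b) = 0" by (simp add: act.hom_minus)
  then show "a = b" using act_poly_eq_0_iff[OF g] by auto
qed

text \<open>\<open>g\<close> acts injectively and maps the finite coset of factors into itself, so
  it permutes them.\<close>

lemma act_poly_orbit_norm:
  fixes g :: "'a::{field,finite} mat"
  assumes g: "g \<in> sylow_O_plus m" and m: "m \<ge> 1" and two: "(2::'a) \<noteq> 0" and i: "i \<in> {1..m + 1}"
  shows "act_poly (2 * m) g (orbit_norm (2 * m) (sylow_O_plus m) i) = orbit_norm (2 * m) (sylow_O_plus m) i"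
proof -
  let ?k = "orbit_dim m i" and ?n = "2 * m"
  let ?S = "(\<lambda>u. pvar i + u) ` (lspan ?k :: 'a mpoly set)"
  let ?h = "inv\<^bsub>ring_mat TYPE('a) ?n ()\<^esub> g"
  have h: "?h \<in> sylow_O_plus m" by (rule sylow_inv_mem[OF g refl])
  interpret act: comm_ring_hom "act_poly ?n g" by (rule comm_ring_hom_act_poly)
  have inj: "inj (act_poly ?n g)" by (rule inj_act_poly[OF sylow_O_plus_Units[OF g]])
  have var: "act_poly ?n g (pvar j) - pvar j \<in> lspan (orbit_dim m j)" if "j \<in> {1..m + 1}" for j
    using row_form_sylow[OF h m two that] that m by (simp add: act_poly_pvar act_var_eq_row_form)
  have span: "act_poly ?n g u \<in> lspan ?k" if "u \<in> lspan ?k" for u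
  proof -
    obtain c where "u = lcomb ?k c" using \<open>u \<in> lspan ?k\<close> unfolding lspan_def by blast
    then have u: "u = (\<Sum>j=1..?k. pconst (c j) * pvar j)" by (simp add: lcomb_def)
    have "act_poly ?n g (pvar j) \<in> lspan ?k" if j: "j \<in> {1..?k}" for j
    proof -
      have j': "j \<in> {1..m + 1}" "orbit_dim m j \<le> ?k" using j i by (auto simp: orbit_dim_def)
      have "(act_poly ?n g (pvar j) - pvar j) + pvar j \<in> lspan ?k"
        using var[OF j'(1)] lspan_mono[OF j'(2)] by (intro lspan_add pvar_lspan j) auto
      then show ?thesis by simp
    qed
    then show ?thesis unfolding u
      by (auto simp: act.hom_sum act.hom_mult act_poly_pconst intro!: lspan_sum lspan_scale)
  qed
  have "act_poly ?n g ` ?S \<subseteq> ?S"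
  proof
    fix y assume "y \<in> act_poly ?n g ` ?S"
    then obtain u where u: "u \<in> lspan ?k" "y = act_poly ?n g (pvar i + u)" by blast
    have "(act_poly ?n g (pvar i) - pvar i) + act_poly ?n g u \<in> lspan ?k"
      by (intro lspan_add var i span u)
    then show "y \<in> ?S"
      by (intro image_eqI[of _ _ "(act_poly ?n g (pvar i) - pvar i) + act_poly ?n g u"])
         (auto simp: u(2) act.hom_add)
  qed
  then have "act_poly ?n g ` ?S = ?S"
    by (intro endo_inj_surj) (auto simp: finite_lspan intro: inj_on_subset[OF inj])
  moreover have norm: "orbit_norm ?n (sylow_O_plus m) i = \<Prod>?S"
    unfolding orbit_norm_def orbit_eq[OF m two i] ..
  ultimately show ?thesis
    unfolding norm act.hom_prod by (metis (no_types, lifting) inj inj_on_subset prod.reindex_cong subset_UNIV)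
qed

text \<open>For \<open>k = 1\<close> the full sum meets every product twice, hence the factor
  2.\<close>

lemma h_poly_full_sum:
  fixes m :: nat
  assumes "k \<ge> 1"
  shows "(if k = 1 then 2 else 1) * (h_poly m k :: 'a::{field,finite} mpoly) =
    (\<Sum>i=1..2*m. pvar (2 * m - i + 1) ^ (CARD('a) ^ (k - 1)) * pvar i)"
proof -
  have "(if k = 1 then 2 else 1) * (h_poly m k :: 'a mpoly) =
    (\<Sum>i=1..m. pvar (2 * m - i + 1) ^ (CARD('a) ^ (k - 1)) * pvar i +
      pvar i ^ (CARD('a) ^ (k - 1)) * pvar (2 * m - i + 1))"
    by (simp add: h_poly_def mult.commute mult_2_right sum.distrib)
  also have "\<dots> = (\<Sum>i=1..2*m. pvar (2 * m - i + 1) ^ (CARD('a) ^ (k - 1)) * pvar i)"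
    by (rule sum_pair_reflect)
  finally show ?thesis .
qed

text \<open>Two independent vectors over an extension ring are allowed, so that one of them can be a
  Frobenius twist of the other.\<close>

lemma sylow_bilinear:
  fixes M :: "'a::field mat" and x y :: "nat \<Rightarrow> 'b::comm_ring_1"
  assumes M: "M \<in> sylow_O_plus m" and \<kappa>: "comm_ring_hom \<kappa>"
  shows "(\<Sum>i=1..2*m. (\<Sum>j=1..2*m. \<kappa> (M $$ (2 * m - i, j - 1)) * x j) *
      (\<Sum>l=1..2*m. \<kappa> (M $$ (i - 1, l - 1)) * y l)) = (\<Sum>i=1..2*m. x (2 * m - i + 1) * y i)"
proof -
  interpret comm_ring_hom \<kappa> by fact
  let ?n = "2 * m"
  have "(\<Sum>i=1..?n. (\<Sum>j=1..?n. \<kappa> (M $$ (?n - i, j - 1)) * x j) *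
      (\<Sum>l=1..?n. \<kappa> (M $$ (i - 1, l - 1)) * y l)) =
     (\<Sum>i=1..?n. \<Sum>l=1..?n. \<Sum>j=1..?n. \<kappa> (M $$ (?n - i, j - 1) * M $$ (i - 1, l - 1)) * (x j * y l))"
    unfolding sum_product by (rule sum.cong[OF refl], subst sum.swap) (simp only: hom_mult mult_ac)
  also have "\<dots> = (\<Sum>l=1..?n. \<Sum>j=1..?n. \<Sum>i=1..?n. \<kappa> (M $$ (?n - i, j - 1) * M $$ (i - 1, l - 1)) * (x j * y l))"
    by (subst sum.swap, rule sum.cong[OF refl], rule sum.swap)
  also have "\<dots> = (\<Sum>l=1..?n. \<Sum>j=1..?n. \<kappa> (\<Sum>i=1..?n. M $$ (?n - i, j - 1) * M $$ (i - 1, l - 1)) * (x j * y l))"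
    by (simp only: hom_sum sum_distrib_right)
  also have "\<dots> = (\<Sum>l=1..?n. \<Sum>j=1..?n. if j = ?n - l + 1 then x j * y l else 0)"
  proof (intro sum.cong refl)
    fix l j assume lj: "l \<in> {1..?n}" "j \<in> {1..?n}"
    have "(\<Sum>i=1..?n. M $$ (?n - i, j - 1) * M $$ (i - 1, l - 1)) = (if j = ?n - l + 1 then 1 else 0)"
      using M lj unfolding sylow_O_plus_iff by auto
    then show "\<kappa> (\<Sum>i=1..?n. M $$ (?n - i, j - 1) * M $$ (i - 1, l - 1)) * (x j * y l) =
      (if j = ?n - l + 1 then x j * y l else 0)" by simp
  qed
  also have "\<dots> = (\<Sum>l=1..?n. x (?n - l + 1) * y l)"
    by (intro sum.cong refl) auto
  finally show ?thesis .
qed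

text \<open>The matrix entries are fixed by Frobenius, so the twisted variables transform by the
  same matrix as the variables. Thus \<open>h_k\<close> is, up to the factor \<open>?c\<close>, a
  value of the invariant bilinear form.\<close>

lemma act_poly_h_poly:
  fixes g :: "'a::{field,finite} mat"
  assumes g: "g \<in> sylow_O_plus m" and two: "(2::'a) \<noteq> 0" and k: "k \<ge> 1"
  shows "act_poly (2 * m) g (h_poly m k) = h_poly m k"
proof -
  let ?n = "2 * m" and ?Q = "CARD('a) ^ (k - 1)"
  let ?h = "inv\<^bsub>ring_mat TYPE('a) ?n ()\<^esub> g"
  have h: "?h \<in> sylow_O_plus m" by (rule sylow_inv_mem[OF g refl])
  interpret act: comm_ring_hom "act_poly ?n g" by (rule comm_ring_hom_act_poly)
  let ?c = "if k = 1 then 2 else (1 :: 'a mpoly)"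
  have pow: "row_form ?n ?h j ^ ?Q = (\<Sum>l=1..?n. pconst (?h $$ (j - 1, l - 1)) * pvar l ^ ?Q)" for j
    unfolding row_form_def frob_iter_sum[OF frobenius_add_mpoly card_field_pos]
    by (simp add: power_mult_distrib power_card_power_eq_same flip: pconst_power)
  have "act_poly ?n g (?c * h_poly m k) = (\<Sum>i=1..?n. row_form ?n ?h (?n - i + 1) ^ ?Q * row_form ?n ?h i)"
    unfolding h_poly_full_sum[OF k] act.hom_sum act.hom_mult act.hom_power act_poly_pvar
    by (intro sum.cong refl) (auto simp: act_var_eq_row_form)
  also have "\<dots> = ?c * h_poly m k"
    unfolding h_poly_full_sum[OF k] pow unfolding row_form_def
    using sylow_bilinear[OF h comm_ring_hom_pconst, of "\<lambda>j. pvar j ^ ?Q" pvar] by simp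
  finally have *: "act_poly ?n g (?c * h_poly m k) = ?c * h_poly m k" .
  have "act_poly ?n g 2 = 2" using act.hom_add[of 1 1] by simp
  then have "act_poly ?n g ?c = ?c" by simp
  then have e: "?c * act_poly ?n g (h_poly m k) = ?c * h_poly m k"
    using * by (simp only: act.hom_mult)
  have "(2 :: 'a mpoly) = pconst 2" using pconst_add[of 1 "1::'a"] by (simp add: pconst_1)
  then have "?c \<noteq> 0" using two pconst_inj[of 2 "0::'a"] by (auto simp: pconst_0)
  then show ?thesis using e by (simp only: mult_cancel_left) simp
qed

section \<open>The invariants form a field containing the generators\<close>

lemma fun_field_V_Fract: "a \<in> poly_ring_V n \<Longrightarrow> b \<in> poly_ring_V n \<Longrightarrow> b \<noteq> 0 \<Longrightarrow> Fract a b \<in> fun_field_V n"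
  unfolding fun_field_V_def by blast

lemma fun_field_VE:
  assumes "z \<in> fun_field_V n"
  obtains a b where "z = Fract a b" "a \<in> poly_ring_V n" "b \<in> poly_ring_V n" "b \<noteq> 0"
  using assms unfolding fun_field_V_def by blast

context
  fixes G :: "'a::field mat set" and n :: nat
  assumes G: "\<And>g. g \<in> G \<Longrightarrow> g \<in> Units (ring_mat TYPE('a) n ())"
begin

text \<open>Invariance is kept in cross-multiplied form, since the numerator and denominator of an
  invariant fraction may move under the group.\<close>

lemma invariant_fieldE:
  assumes "z \<in> invariant_field n G"
  shows "\<exists>a b. z = Fract a b \<and> a \<in> poly_ring_V n \<and> b \<in> poly_ring_V n \<and> b \<noteq> 0 \<and>
    (\<forall>g\<in>G. act_poly n g a * b = a * act_poly n g b)"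
proof -
  obtain a b where ab: "z = Fract a b" "a \<in> poly_ring_V n" "b \<in> poly_ring_V n" "b \<noteq> 0"
    using assms fun_field_VE unfolding invariant_field_def by blast
  have "act_poly n g a * b = a * act_poly n g b" if g: "g \<in> G" for g
  proof -
    have "Fract (act_poly n g a) (act_poly n g b) = Fract a b"
      using assms ab(1) act_fract_Fract[OF G[OF g] ab(4)] g unfolding invariant_field_def by auto
    then show ?thesis
      using act_poly_eq_0_iff[OF G[OF g]] ab(4) by (simp add: eq_fract)
  qed
  then show ?thesis using ab by blast
qed

lemma invariant_fieldI:
  assumes "a \<in> poly_ring_V n" "b \<in> poly_ring_V n" "b \<noteq> 0"
    "\<And>g. g \<in> G \<Longrightarrow> act_poly n g a * b = a * act_poly n g b"
  shows "Fract a b \<in> invariant_field n G"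
  unfolding invariant_field_def
  using assms act_poly_eq_0_iff[OF G]
  by (auto simp: fun_field_V_Fract act_fract_Fract[OF G] eq_fract)

lemma invariant_field_to_fract:
  "a \<in> poly_ring_V n \<Longrightarrow> (\<And>g. g \<in> G \<Longrightarrow> act_poly n g a = a) \<Longrightarrow> to_fract a \<in> invariant_field n G"
  unfolding to_fract_def
  by (rule invariant_fieldI) (auto simp: poly_ring_V_1 act_poly_def psubst_one)

lemma invariant_field_add:
  assumes "x \<in> invariant_field n G" "y \<in> invariant_field n G"
  shows "x + y \<in> invariant_field n G"
proof -
  obtain a b where ab: "x = Fract a b" "a \<in> poly_ring_V n" "b \<in> poly_ring_V n" "b \<noteq> 0"
    "\<forall>g\<in>G. act_poly n g a * b = a * act_poly n g b" using invariant_fieldE[OF assms(1)] by blast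
  obtain c d where cd: "y = Fract c d" "c \<in> poly_ring_V n" "d \<in> poly_ring_V n" "d \<noteq> 0"
    "\<forall>g\<in>G. act_poly n g c * d = c * act_poly n g d" using invariant_fieldE[OF assms(2)] by blast
  have "x + y = Fract (a * d + c * b) (b * d)" using ab cd by simp
  also have "\<dots> \<in> invariant_field n G"
  proof (rule invariant_fieldI)
    fix g assume g: "g \<in> G"
    interpret act: comm_ring_hom "act_poly n g" by (rule comm_ring_hom_act_poly)
    let ?A = "act_poly n g"
    have "?A (a * d + c * b) * (b * d) = (?A a * b) * (?A d * d) + (?A c * d) * (?A b * b)"
      by (simp add: act.hom_add act.hom_mult algebra_simps)
    also have "\<dots> = (a * ?A b) * (?A d * d) + (c * ?A d) * (?A b * b)"
      using bspec[OF ab(5) g] bspec[OF cd(5) g] by simp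
    also have "\<dots> = (a * d + c * b) * ?A (b * d)" by (simp add: act.hom_mult algebra_simps)
    finally show "?A (a * d + c * b) * (b * d) = (a * d + c * b) * ?A (b * d)" .
  qed (use ab cd in \<open>auto intro: poly_ring_V_add poly_ring_V_mult\<close>)
  finally show ?thesis .
qed

lemma invariant_field_mult:
  assumes "x \<in> invariant_field n G" "y \<in> invariant_field n G"
  shows "x * y \<in> invariant_field n G"
proof -
  obtain a b where ab: "x = Fract a b" "a \<in> poly_ring_V n" "b \<in> poly_ring_V n" "b \<noteq> 0"
    "\<forall>g\<in>G. act_poly n g a * b = a * act_poly n g b" using invariant_fieldE[OF assms(1)] by blast
  obtain c d where cd: "y = Fract c d" "c \<in> poly_ring_V n" "d \<in> poly_ring_V n" "d \<noteq> 0"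
    "\<forall>g\<in>G. act_poly n g c * d = c * act_poly n g d" using invariant_fieldE[OF assms(2)] by blast
  have "x * y = Fract (a * c) (b * d)" using ab cd by simp
  also have "\<dots> \<in> invariant_field n G"
  proof (rule invariant_fieldI)
    fix g assume g: "g \<in> G"
    interpret act: comm_ring_hom "act_poly n g" by (rule comm_ring_hom_act_poly)
    let ?A = "act_poly n g"
    have "?A (a * c) * (b * d) = (?A a * b) * (?A c * d)" by (simp add: act.hom_mult algebra_simps)
    also have "\<dots> = (a * ?A b) * (c * ?A d)" using bspec[OF ab(5) g] bspec[OF cd(5) g] by simp
    also have "\<dots> = (a * c) * ?A (b * d)" by (simp add: act.hom_mult algebra_simps)
    finally show "?A (a * c) * (b * d) = (a * c) * ?A (b * d)" .
  qed (use ab cd in \<open>auto intro: poly_ring_V_mult\<close>)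
  finally show ?thesis .
qed

lemma invariant_field_pconst: "to_fract (pconst c) \<in> invariant_field n G"
  by (rule invariant_field_to_fract) (simp_all add: pconst_poly_ring_V act_poly_pconst)

lemma invariant_field_uminus:
  assumes "x \<in> invariant_field n G" shows "- x \<in> invariant_field n G"
  using invariant_field_mult[OF invariant_field_pconst[of "-1"] assms]
  by (simp add: pconst_uminus pconst_1)

lemma invariant_field_inverse:
  assumes "x \<in> invariant_field n G" "x \<noteq> 0" shows "inverse x \<in> invariant_field n G"
proof -
  obtain a b where ab: "x = Fract a b" "a \<in> poly_ring_V n" "b \<in> poly_ring_V n" "b \<noteq> 0"
    "\<forall>g\<in>G. act_poly n g a * b = a * act_poly n g b" using invariant_fieldE[OF assms(1)] by blast
  have "a \<noteq> 0" using assms(2) ab by (auto simp: Zero_fract_def eq_fract)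
  then have "Fract b a \<in> invariant_field n G"
    using ab by (intro invariant_fieldI) (auto simp: mult.commute)
  then show ?thesis by (simp add: ab(1))
qed

lemma field_gen_subset_invariant_field:
  assumes "\<And>f. f \<in> S \<Longrightarrow> f \<in> poly_ring_V n"
    and "\<And>f g. f \<in> S \<Longrightarrow> g \<in> G \<Longrightarrow> act_poly n g f = f"
  shows "field_gen S \<subseteq> invariant_field n G"
proof
  fix z assume "z \<in> field_gen S"
  then show "z \<in> invariant_field n G" unfolding field_gen_def
  proof (induction z rule: generate_field.induct)
    case one
    then show ?case using invariant_field_pconst[of 1] by (simp add: pconst_1)
  next
    case (incl h)
    then show ?case using assms by (auto intro: invariant_field_pconst invariant_field_to_fract)
  next
    case (a_inv h)
    then show ?case by (simp add: class_ring_simps invariant_field_uminus)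
  next
    case (m_inv h)
    then show ?case by (simp add: class_ring_simps invariant_field_inverse)
  next
    case (eng_add h1 h2)
    then show ?case by (simp add: invariant_field_add)
  next
    case (eng_mult h1 h2)
    then show ?case by (simp add: invariant_field_mult)
  qed
qed

end

lemma field_gen_gen: "f \<in> S \<Longrightarrow> to_fract f \<in> field_gen S"
  unfolding field_gen_def by (rule generate_field.incl) blast

lemma field_gen_fconst: "fconst c \<in> field_gen S"
  unfolding field_gen_def fconst_def by (rule generate_field.incl) blast

lemma field_gen_add: "x \<in> field_gen S \<Longrightarrow> y \<in> field_gen S \<Longrightarrow> x + y \<in> field_gen S"
  unfolding field_gen_def using generate_field.eng_add[of x class_ring _ y] by simp

lemma field_gen_mult: "x \<in> field_gen S \<Longrightarrow> y \<in> field_gen S \<Longrightarrow> x * y \<in> field_gen S"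
  unfolding field_gen_def using generate_field.eng_mult[of x class_ring _ y] by simp

lemma field_gen_uminus: "x \<in> field_gen S \<Longrightarrow> - x \<in> field_gen S"
  unfolding field_gen_def using generate_field.a_inv[of x class_ring] by (simp add: class_ring_simps)

lemma field_gen_inverse: "x \<in> field_gen S \<Longrightarrow> x \<noteq> 0 \<Longrightarrow> inverse x \<in> field_gen S"
  unfolding field_gen_def using generate_field.m_inv[of x class_ring] by (simp add: class_ring_simps)

lemma poly_ring_V_orbit_norm:
  assumes "m \<ge> 1" "(2::'a::field) \<noteq> 0" "i \<in> {1..m + 1}"
  shows "orbit_norm (2 * m) (sylow_O_plus m :: 'a mat set) i \<in> poly_ring_V (2 * m)"
  unfolding orbit_norm_eq[OF assms]
  by (intro poly_ring_V_prod poly_ring_V_add pvar_poly_ring_V)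
     (use assms in \<open>auto simp: orbit_dim_def intro: lspan_poly_ring_V\<close>)

lemma poly_ring_V_h_poly: "h_poly m k \<in> poly_ring_V (2 * m)"
  unfolding h_poly_def
  by (auto intro!: poly_ring_V_sum poly_ring_V_add poly_ring_V_mult poly_ring_V_power pvar_poly_ring_V)

section \<open>Congruences modulo the annihilator of a linear map\<close>

text \<open>This is \<open>f(x)\<close>, a constant of the outer polynomial ring, as opposed to
  \<open>f(T)\<close>, which is \<open>ev_fract f\<close>.\<close>

definition cst :: "'a::field mpoly \<Rightarrow> 'a mpoly fract mpoly" where
  "cst f = pconst (to_fract f)"

lemma comm_ring_hom_cst: "comm_ring_hom cst"
  unfolding cst_def by (rule comm_ring_hom_comp[OF comm_ring_hom_pconst comm_ring_hom_to_fract])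

interpretation cst: comm_ring_hom cst by (rule comm_ring_hom_cst)

interpretation ev_fract: comm_ring_hom ev_fract by (rule comm_ring_hom_ev_fract)

lemma cst_pconst: "cst (pconst c) = pconst (fconst c)"
  by (simp add: cst_def fconst_def)

lemma ev_fract_pconst: "ev_fract (pconst c) = cst (pconst c)"
  unfolding ev_fract_def meval_pconst[OF comm_ring_hom_ev_coeff] cst_pconst ..

lemma ev_fract_pvar: "ev_fract (pvar i) = pvar i"
  unfolding ev_fract_def by (rule meval_pvar[OF comm_ring_hom_ev_coeff])

lemma cst_inj: "cst f = cst g \<longleftrightarrow> f = g"
  by (simp add: cst_def pconst_inj)

lemma cst_unit: "f \<noteq> 0 \<Longrightarrow> \<exists>u. u * cst f = 1"
  by (rule exI[of _ "pconst (inverse (to_fract f))"]) (simp add: cst_def pconst_1 flip: pconst_mult)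

text \<open>Supplies the unit hypothesis of the splitting lemmas: nonzero constants come from a
  field.\<close>

lemma cst_diff_unit: "c \<in> range cst \<Longrightarrow> d \<in> range cst \<Longrightarrow> c \<noteq> d \<Longrightarrow> \<exists>u. u * (c - d) = 1"
proof -
  assume "c \<in> range cst" "d \<in> range cst" "c \<noteq> d"
  then obtain f g where "c = cst f" "d = cst g" "f - g \<noteq> 0" by auto
  then show ?thesis using cst_unit[of "f - g"] by (simp add: cst.hom_minus)
qed

text \<open>The substitution is unitriangular, so it is onto by solving for one variable after the
  other; finiteness of the span then gives injectivity.\<close>

lemma bij_betw_psubst_lspan:
  fixes y :: "nat \<Rightarrow> 'a::{field,finite} mpoly"
  assumes y: "\<And>j. j \<in> {1..k} \<Longrightarrow> y j - pvar j \<in> lspan (j - 1)"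
  shows "bij_betw (psubst y) (lspan k) (lspan k)"
proof -
  have yl: "y j \<in> lspan j" if "j \<in> {1..k}" for j
  proof -
    have "(y j - pvar j) + pvar j \<in> lspan j"
      using y[OF that] that lspan_mono[of "j - 1" j] by (intro lspan_add pvar_lspan) auto
    then show ?thesis by simp
  qed
  have sub: "psubst y u \<in> lspan l" if u: "u \<in> lspan l" and l: "l \<le> k" for u l
  proof -
    obtain c where "u = lcomb l c" using u unfolding lspan_def by blast
    then have "psubst y u = (\<Sum>j=1..l. pconst (c j) * y j)"
      by (simp add: lcomb_def psubst_sum psubst_mult psubst_pconst psubst_pvar)
    also have "\<dots> \<in> lspan l"
    proof (intro lspan_sum lspan_scale)
      fix j assume "j \<in> {1..l}"
      then show "y j \<in> lspan l" using yl[of j] l lspan_mono[of j l] by auto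
    qed
    finally show ?thesis .
  qed
  have sup: "l \<le> k \<Longrightarrow> u \<in> lspan l \<Longrightarrow> u \<in> psubst y ` lspan l" for u l
  proof (induction l arbitrary: u)
    case 0
    then have "u = 0" by (auto simp: lspan_def lcomb_def)
    then show ?case using lspan_0 by (intro image_eqI[of _ _ 0]) (auto simp: psubst_0)
  next
    case (Suc l)
    obtain c where "u = lcomb (Suc l) c" using Suc.prems(2) unfolding lspan_def by blast
    then have u: "u = lcomb l c + pconst (c (Suc l)) * pvar (Suc l)" by (simp add: lcomb_def)
    have "lcomb l c - pconst (c (Suc l)) * (y (Suc l) - pvar (Suc l)) \<in> lspan l"
    proof -
      have w: "y (Suc l) - pvar (Suc l) \<in> lspan l" using y[of "Suc l"] Suc.prems(1) by simp
      show ?thesis by (rule lspan_diff[OF _ lspan_scale[OF w]]) (simp add: lspan_def)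
    qed
    then obtain v where v: "v \<in> lspan l"
      "psubst y v = lcomb l c - pconst (c (Suc l)) * (y (Suc l) - pvar (Suc l))"
      using Suc.IH Suc.prems(1) by (metis Suc_leD imageE)
    have "psubst y (v + pconst (c (Suc l)) * pvar (Suc l)) = u"
      by (simp add: psubst_add psubst_mult psubst_pconst psubst_pvar v(2) u algebra_simps)
    moreover have "v + pconst (c (Suc l)) * pvar (Suc l) \<in> lspan (Suc l)"
      using v(1) lspan_mono[of l "Suc l"] by (intro lspan_add lspan_scale pvar_lspan) auto
    ultimately show ?case by blast
  qed
  have im: "psubst y ` lspan k = lspan k" using sub sup by blast
  then have "inj_on (psubst y) (lspan k)"
    by (intro eq_card_imp_inj_on) (auto simp: finite_lspan)
  then show ?thesis using im by (simp add: bij_betw_def)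
qed

text \<open>\<open>coset_poly_identity\<close> for the subgroup \<open>lspan k\<close>, evaluated at
  \<open>t\<close>. It factors an orbit norm relation into linear terms.\<close>

lemma cst_coset_prod:
  fixes t :: "'a::{field,finite} mpoly fract mpoly" and x :: "'a mpoly"
  shows "(\<Prod>u\<in>lspan k. t + cst u) - cst (\<Prod>u\<in>lspan k. x + u) = (\<Prod>u\<in>lspan k. t - cst (x + u))"
proof -
  let ?W = "to_fract ` (lspan k :: 'a mpoly set)"
  have W: "finite ?W" "0 \<in> ?W"
    using finite_lspan lspan_0 by (auto simp: image_iff intro!: bexI[of _ 0])
  have Wadd: "u + w \<in> ?W" if uw: "u \<in> ?W" "w \<in> ?W" for u w
  proof -
    obtain u' w' where "u' \<in> lspan k" "w' \<in> lspan k" "u = to_fract u'" "w = to_fract w'"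
      using uw by blast
    then show ?thesis
      using lspan_add[of u' k w'] by (intro image_eqI[of _ _ "u' + w'"]) auto
  qed
  have Wneg: "- u \<in> ?W" if u: "u \<in> ?W" for u
  proof -
    obtain u' where "u' \<in> lspan k" "u = to_fract u'" using u by blast
    then show ?thesis
      using lspan_uminus[of u' k] by (intro image_eqI[of _ _ "- u'"]) auto
  qed
  have inj: "inj_on to_fract (lspan k :: 'a mpoly set)" by (auto simp: inj_on_def)
  from pconst.coset_prod_identity[OF coset_poly_identity[OF W Wadd Wneg, of "to_fract x"] refl, of t]
  show ?thesis
    by (simp add: prod.reindex[OF inj] o_def cst_def to_fract_prod)
qed

text \<open>Modulo \<open>J\<close> the earlier \<open>T_j\<close> equal the \<open>y j\<close>, and
  substituting these permutes the span. So \<open>N(T_i)\<close> becomes a product over constants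
  \<open>u\<close>, and its difference from \<open>N(x_i)\<close> factors by
  \<open>cst_coset_prod\<close>.\<close>

lemma orbit_norm_split:
  fixes J :: "'a::{field,finite} mpoly fract mpoly set"
  assumes J: "rideal J" and m: "m \<ge> 1" and two: "(2::'a) \<noteq> 0" and i: "i \<in> {1..m + 1}"
    and N: "ev_fract (orbit_norm (2 * m) (sylow_O_plus m) i) - cst (orbit_norm (2 * m) (sylow_O_plus m) i) \<in> J"
    and y: "\<And>j. j \<in> {1..orbit_dim m i} \<Longrightarrow> y j - pvar j \<in> lspan (j - 1)"
      "\<And>j. j \<in> {1..orbit_dim m i} \<Longrightarrow> pvar j - cst (y j) \<in> J"
  shows "(\<Prod>u\<in>lspan (orbit_dim m i). pvar i - cst (pvar i + u)) \<in> J"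
proof -
  let ?k = "orbit_dim m i"
  note norm = orbit_norm_eq[OF m two i]
  have "(\<Prod>u\<in>lspan ?k. pvar i + ev_fract u) - (\<Prod>u\<in>lspan ?k. pvar i + cst (psubst y u)) \<in> J"
  proof (intro rideal_cong_prod[OF J] rideal_cong_add[OF J])
    fix u :: "'a mpoly" assume "u \<in> lspan ?k"
    then obtain c where u: "u = lcomb ?k c" unfolding lspan_def by blast
    show "ev_fract u - cst (psubst y u) \<in> J"
      unfolding u lcomb_def ev_fract.hom_sum psubst_sum cst.hom_sum
      by (intro rideal_cong_sum[OF J])
         (auto simp: ev_fract.hom_mult psubst_mult cst.hom_mult psubst_pconst psubst_pvar ev_fract_pconst
           ev_fract_pvar rideal_0[OF J] intro!: rideal_cong_mult[OF J] y(2))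
  qed (simp add: rideal_0[OF J])
  also have "(\<Prod>u\<in>lspan ?k. pvar i + cst (psubst y u)) = (\<Prod>u\<in>lspan ?k. pvar i + cst u)"
    by (rule prod.reindex_bij_betw[OF bij_betw_psubst_lspan[OF y(1)]])
  finally have "ev_fract (orbit_norm (2 * m) (sylow_O_plus m) i) - (\<Prod>u\<in>lspan ?k. pvar i + cst u) \<in> J"
    unfolding norm by (simp add: ev_fract.hom_prod ev_fract.hom_add ev_fract_pvar)
  then have "(\<Prod>u\<in>lspan ?k. pvar i + cst u) - cst (orbit_norm (2 * m) (sylow_O_plus m) i) \<in> J"
    using N rideal_trans[OF J] rideal_sym[OF J] by blast
  then show ?thesis unfolding norm cst_coset_prod .
qed

lemma triangular_reduction:
  fixes I :: "'a::{field,finite} mpoly fract mpoly set"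
  assumes I: "rideal I" and m: "m \<ge> 1" and two: "(2::'a) \<noteq> 0"
    and N: "\<And>i. i \<in> {1..m + 1} \<Longrightarrow>
      ev_fract (orbit_norm (2 * m) (sylow_O_plus m) i) - cst (orbit_norm (2 * m) (sylow_O_plus m) i) \<in> I"
    and leaf: "\<And>J y. rideal J \<Longrightarrow> I \<subseteq> J \<Longrightarrow> (\<And>j. j \<in> {1..m + 1} \<Longrightarrow> pvar j - cst (y j) \<in> J) \<Longrightarrow>
      (\<And>j. j \<in> {1..m + 1} \<Longrightarrow> y j - pvar j \<in> lspan (orbit_dim m j)) \<Longrightarrow> r \<in> J"
  shows "r \<in> I"
proof -
  define P where "P = (\<lambda>i. \<forall>J y. rideal J \<longrightarrow> I \<subseteq> J \<longrightarrow> (\<forall>j\<in>{1..i}. pvar j - cst (y j) \<in> J) \<longrightarrow>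
      (\<forall>j\<in>{1..i}. y j - pvar j \<in> lspan (orbit_dim m j)) \<longrightarrow> r \<in> J)"
  have "P 0"
  \<comment> \<open>The induction runs downwards: \<open>leaf\<close> is \<open>P (m + 1)\<close>,
    and \<open>P 0\<close> applied to \<open>I\<close> is the claim. Each step splits
    \<open>T_{i+1}\<close> over the orbit of \<open>x_{i+1}\<close>.\<close>
  proof (rule inc_induct[of 0 "m + 1"])
    show "P (m + 1)" unfolding P_def using leaf by blast
  next
    fix i assume i: "i < m + 1" and IH: "P (Suc i)"
    show "P i" unfolding P_def
    proof (intro allI impI)
      fix J y assume J: "rideal J" "I \<subseteq> J" and y: "\<forall>j\<in>{1..i}. pvar j - cst (y j) \<in> J"
        "\<forall>j\<in>{1..i}. y j - pvar j \<in> lspan (orbit_dim m j)"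
      let ?k = "orbit_dim m (Suc i)"
      have k: "?k \<le> i" by (simp add: orbit_dim_def)
      have S: "Suc i \<in> {1..m + 1}" using i by auto
      define C where "C = (\<lambda>u. cst (pvar (Suc i) + u)) ` (lspan ?k :: 'a mpoly set)"
      show "r \<in> J"
      proof (rule rideal_split[of C])
        show "finite C" unfolding C_def by (intro finite_imageI finite_lspan)
        have "(\<Prod>u\<in>lspan ?k. pvar (Suc i) - cst (pvar (Suc i) + u)) \<in> J"
        proof (rule orbit_norm_split[OF J(1) m two S])
          fix j assume j: "j \<in> {1..?k}"
          then have "orbit_dim m j \<le> j - 1" "j \<in> {1..i}" using k by (auto simp: orbit_dim_def)
          then show "y j - pvar j \<in> lspan (j - 1)" "pvar j - cst (y j) \<in> J"
            using y lspan_mono by blast+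
        qed (use N[OF S] J(2) in auto)
        then show "(\<Prod>c\<in>C. pvar (Suc i) - c) \<in> J"
          unfolding C_def by (subst prod.reindex) (auto simp: inj_on_def cst_inj)
        show "\<exists>u. u * (c - d) = 1" if "c \<in> C" "d \<in> C" "c \<noteq> d" for c d
          using that unfolding C_def by (intro cst_diff_unit) auto
        fix c J' assume c: "c \<in> C" and J': "rideal J'" "J \<subseteq> J'" "pvar (Suc i) - c \<in> J'"
        then obtain u where u: "u \<in> lspan ?k" "c = cst (pvar (Suc i) + u)" unfolding C_def by blast
        define y' where "y' = y(Suc i := pvar (Suc i) + u)"
        have "\<forall>j\<in>{1..Suc i}. pvar j - cst (y' j) \<in> J'" "\<forall>j\<in>{1..Suc i}. y' j - pvar j \<in> lspan (orbit_dim m j)"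
          using y J' u by (auto simp: y'_def le_Suc_eq)
        then show "r \<in> J'" using IH J J' unfolding P_def by blast
      qed (rule J(1))
    qed
  qed simp
  then show ?thesis unfolding P_def using I by auto
qed

lemma lcomb_eq_0_imp:
  assumes "lcomb n c = 0" "j \<in> {1..n}"
  shows "c j = (0::'a::field)"
proof -
  have hid: "comm_ring_hom (\<lambda>x. x :: 'a)" by standard auto
  let ?e = "\<lambda>i. if i = j then 1 else (0::'a)"
  interpret e: comm_ring_hom "meval (\<lambda>x. x) ?e" by (rule meval_hom[OF hid])
  have "meval (\<lambda>x. x) ?e (lcomb n c) = (\<Sum>i=1..n. c i * ?e i)"
    by (simp add: lcomb_def e.hom_sum e.hom_mult meval_pconst[OF hid] meval_pvar[OF hid])
  also have "\<dots> = c j" using assms(2) by (simp add: if_distrib[of "(*) _"] cong: if_cong)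
  finally show ?thesis using assms(1) by simp
qed

text \<open>The hypothesis has the shape of \<open>defect\<close> and of its Frobenius powers, so
  one rearrangement serves both halves of \<open>defect_isotropic\<close>.\<close>

lemma isotropic_sum_identity:
  fixes X d Z t :: "nat \<Rightarrow> 'b::comm_ring_1"
  assumes "\<And>i. i \<in> {1..n} \<Longrightarrow> d i = (\<Sum>j=1..n. p j i * t j) + a i * u + b i * v + a i * w - Z i"
  shows "(\<Sum>i=1..n. X i * d i) = (\<Sum>j=1..n. (\<Sum>i=1..n. p j i * X i) * t j) + (\<Sum>i=1..n. a i * X i) * u
    + (\<Sum>i=1..n. b i * X i) * v + (\<Sum>i=1..n. a i * X i) * w - (\<Sum>i=1..n. X i * Z i)"
proof -
  have "(\<Sum>i=1..n. X i * d i) = (\<Sum>i=1..n. (\<Sum>j=1..n. p j i * X i * t j) + a i * X i * u + b i * X i * v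
      + a i * X i * w - X i * Z i)"
    by (rule sum.cong) (auto simp: assms sum_distrib_left algebra_simps)
  also have "\<dots> = (\<Sum>i=1..n. \<Sum>j=1..n. p j i * X i * t j) + (\<Sum>i=1..n. a i * X i) * u
    + (\<Sum>i=1..n. b i * X i) * v + (\<Sum>i=1..n. a i * X i) * w - (\<Sum>i=1..n. X i * Z i)"
    by (simp add: sum.distrib sum_subtractf sum_distrib_right)
  also have "(\<Sum>i=1..n. \<Sum>j=1..n. p j i * X i * t j) = (\<Sum>j=1..n. (\<Sum>i=1..n. p j i * X i) * t j)"
    unfolding sum_distrib_right by (rule sum.swap)
  finally show ?thesis .
qed

text \<open>Modulo \<open>J\<close> the variables \<open>T\<close> are specialised to
  \<open>g x\<close> with \<open>g\<close> the inverse of \<open>M\<close>, so \<open>f(T)\<close>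
  becomes \<open>g f\<close>, and the relation is the invariance of \<open>a / b\<close> under
  \<open>g\<close>.\<close>

lemma ev_fract_final_relation:
  fixes J :: "'a::field mpoly fract mpoly set"
  assumes J: "rideal J" and M: "M \<in> sylow_O_plus m"
    and T: "\<And>j. j \<in> {1..2*m} \<Longrightarrow> pvar j - cst (row_form (2 * m) M j) \<in> J"
    and ab: "a \<in> poly_ring_V (2 * m)" "b \<in> poly_ring_V (2 * m)"
      "\<And>g. g \<in> sylow_O_plus m \<Longrightarrow> act_poly (2 * m) g a * b = a * act_poly (2 * m) g b"
  shows "cst b * ev_fract a - cst a * ev_fract b \<in> J"
proof -
  let ?g = "inv\<^bsub>ring_mat TYPE('a) (2 * m) ()\<^esub> M"
  have ev: "ev_fract f - cst (act_poly (2 * m) ?g f) \<in> J" if f: "f \<in> poly_ring_V (2 * m)" for f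
  proof -
    have "cst (act_poly (2 * m) ?g f) = meval (\<lambda>c. cst (pconst c)) (\<lambda>i. cst (act_var (2 * m) ?g i)) f"
      unfolding act_poly_def psubst_eq_meval by (rule cst.hom_meval)
    also have "\<dots> = meval (\<lambda>c. pconst (fconst c)) (\<lambda>i. cst (row_form (2 * m) M i)) f"
      unfolding cst_pconst by (rule meval_cong[OF f]) (simp add: act_var_inv[OF M refl])
    finally show ?thesis
      unfolding ev_fract_def using rideal_cong_meval[OF J f T] by simp
  qed
  have "cst b * ev_fract a - cst b * cst (act_poly (2 * m) ?g a) \<in> J"
    "cst a * ev_fract b - cst a * cst (act_poly (2 * m) ?g b) \<in> J"
    using ev[OF ab(1)] ev[OF ab(2)] rideal_0[OF J] by (auto intro!: rideal_cong_mult[OF J])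
  moreover have "cst b * cst (act_poly (2 * m) ?g a) = cst a * cst (act_poly (2 * m) ?g b)"
    using ab(3)[OF sylow_inv_mem[OF M refl]] by (simp add: mult.commute flip: cst.hom_mult)
  ultimately show ?thesis using rideal_trans[OF J] rideal_sym[OF J] by metis
qed

lemma h_poly_pair_sum:
  fixes m :: nat
  shows "(if k = 0 then 2 else 1) * (h_poly m (Suc k) :: 'a::{field,finite} mpoly) =
    (\<Sum>i=1..m. pvar (2 * m - i + 1) ^ (CARD('a) ^ k) * pvar i +
      pvar i ^ (CARD('a) ^ k) * pvar (2 * m - i + 1))"
  by (simp add: h_poly_def mult.commute mult_2_right sum.distrib)

section \<open>Determining the last \<open>m - 1\<close> variables\<close>

context
  fixes J :: "'a::{field,finite} mpoly fract mpoly set" and m :: nat and y :: "nat \<Rightarrow> 'a mpoly"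
    and c :: "nat \<Rightarrow> nat \<Rightarrow> 'a"
  assumes J: "rideal J" and m: "m \<ge> 1"
    and yJ: "\<And>j. j \<in> {1..m + 1} \<Longrightarrow> pvar j - cst (y j) \<in> J"
    and yc: "\<And>j. j \<in> {1..m + 1} \<Longrightarrow> y j = pvar j + lcomb (orbit_dim m j) (c j)"
    and h: "\<And>k. k \<in> {1..m - 1} \<Longrightarrow> ev_fract (h_poly m k) - cst (h_poly m k) \<in> J"
begin

abbreviation "kc (a::'a) \<equiv> cst (pconst a)"

abbreviation "alpha \<equiv> lcomb (m - 1) (c m)"

abbreviation "beta \<equiv> lcomb (m - 1) (c (m + 1))"

definition unip :: "nat \<Rightarrow> nat \<Rightarrow> 'a" where
  "unip j i = (if i = j then 1 else if i < j then c j i else 0)"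

text \<open>With \<open>P\<close> the unitriangular matrix of \<open>y\<^sub>1, \<dots>, y\<^sub>m\<^sub>-\<^sub>1\<close>, the vector \<open>defect\<close> is
  \<open>P\<^sup>T Y' + x\<^sub>m\<^sub>+\<^sub>1 a + x\<^sub>m b + \<beta> a - Y\<close>, where \<open>Y\<close> and \<open>Y'\<close> collect the last \<open>m - 1\<close> old
  and new variables and \<open>\<alpha> = a \<cdot> x\<close>, \<open>\<beta> = b \<cdot> x\<close>. It is chosen so that the relations
  \<open>h\<^sub>k(x') = h\<^sub>k(x)\<close> say that \<open>(x, defect)\<close> is isotropic together with its Frobenius twists.\<close>

definition defect :: "nat \<Rightarrow> 'a mpoly fract mpoly" where
  "defect i = (\<Sum>j=1..m-1. kc (unip j i) * pvar (2 * m - j + 1)) + kc (c m i) * cst (pvar (m + 1))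
     + kc (c (m + 1) i) * cst (pvar m) + kc (c m i) * cst beta - cst (pvar (2 * m - i + 1))"

lemma y_head: "j \<in> {1..m-1} \<Longrightarrow> y j = (\<Sum>i=1..m-1. pconst (unip j i) * pvar i)"
proof -
  assume j: "j \<in> {1..m-1}"
  have "(\<Sum>i=1..m-1. pconst (unip j i) * pvar i) =
      (\<Sum>i=1..m-1. (if i = j then pvar i else 0) + (if i < j then pconst (c j i) * pvar i else 0))"
    by (rule sum.cong) (auto simp: unip_def pconst_0 pconst_1)
  also have "\<dots> = pvar j + (\<Sum>i=1..m-1. if i < j then pconst (c j i) * pvar i else 0)"
    using j by (simp add: sum.distrib)
  also have "(\<Sum>i=1..m-1. if i < j then pconst (c j i) * pvar i else 0) = lcomb (orbit_dim m j) (c j)"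
    unfolding lcomb_def by (rule sum.mono_neutral_cong_right) (use j in \<open>auto simp: orbit_dim_def\<close>)
  finally show ?thesis using yc[of j] j m by auto
qed

lemma y_m: "y m = pvar m + alpha" and y_Suc_m: "y (m + 1) = pvar (m + 1) + beta"
  using yc[of m] yc[of "m + 1"] m by (simp_all add: orbit_dim_def)

lemmas frob_B = frobenius_add_mpoly_fract[where 'a='a]

lemma frob_B_iter: "(a + b :: 'a mpoly fract mpoly) ^ (CARD('a) ^ k) = a ^ (CARD('a) ^ k) + b ^ (CARD('a) ^ k)"
  by (rule frob_iter_add[OF frob_B card_field_pos])

lemma frob_B_sum: "(\<Sum>i\<in>A. f i :: 'a mpoly fract mpoly) ^ (CARD('a) ^ k) = (\<Sum>i\<in>A. f i ^ (CARD('a) ^ k))"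
  by (rule frob_iter_sum[OF frob_B card_field_pos])

lemma frob_B_diff: "(a - b :: 'a mpoly fract mpoly) ^ (CARD('a) ^ k) = a ^ (CARD('a) ^ k) - b ^ (CARD('a) ^ k)"
  using frob_B_iter[of "a - b" b k] by simp

lemma frob_kc: "kc a ^ (CARD('a) ^ k) = kc a"
  by (simp add: power_card_power_eq_same flip: cst.hom_power pconst_power)

text \<open>Modulo \<open>J\<close> the sum is \<open>E - H\<close>, the difference of
  \<open>h_{k+1}(T)\<close> and \<open>h_{k+1}(x)\<close>, both doubled when \<open>k = 0\<close>.
  The \<open>A\<close> terms pair new variables and the \<open>B\<close> terms old ones.\<close>

lemma defect_isotropic:
  assumes k: "k < m - 1"
  shows "(\<Sum>i=1..m-1. cst (pvar i) * defect i ^ (CARD('a) ^ k) + cst (pvar i) ^ (CARD('a) ^ k) * defect i) \<in> J"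
proof -
  let ?n = "m - 1" and ?Q = "CARD('a) ^ k"
  let ?X = "\<lambda>i. cst (pvar i :: 'a mpoly)" and ?t = "\<lambda>j. pvar (2 * m - j + 1) :: 'a mpoly fract mpoly"
  have cy: "(\<Sum>i=1..?n. kc (unip j i) * ?X i) = cst (y j)" if "j \<in> {1..?n}" for j
    by (simp add: y_head[OF that] cst.hom_sum cst.hom_mult)
  have cl: "(\<Sum>i=1..?n. kc (f i) * ?X i) = cst (lcomb ?n f)" for f
    by (simp add: lcomb_def cst.hom_sum cst.hom_mult)
  have cyQ: "(\<Sum>i=1..?n. kc (unip j i) * ?X i ^ ?Q) = cst (y j) ^ ?Q" if "j \<in> {1..?n}" for j
    unfolding cy[OF that, symmetric] frob_B_sum by (simp add: power_mult_distrib frob_kc)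
  have clQ: "(\<Sum>i=1..?n. kc (f i) * ?X i ^ ?Q) = cst (lcomb ?n f) ^ ?Q" for f
    unfolding cl[symmetric] frob_B_sum by (simp add: power_mult_distrib frob_kc)
  have dQ: "defect i ^ ?Q = (\<Sum>j=1..?n. kc (unip j i) * ?t j ^ ?Q) + kc (c m i) * ?X (m + 1) ^ ?Q
     + kc (c (m + 1) i) * ?X m ^ ?Q + kc (c m i) * cst beta ^ ?Q - ?X (2 * m - i + 1) ^ ?Q" for i
    unfolding defect_def frob_B_diff frob_B_iter frob_B_sum by (simp add: power_mult_distrib frob_kc)
  define A1 A2 B1 B2 where "A1 = (\<Sum>j=1..?n. cst (y j) * ?t j ^ ?Q)"
    and "A2 = (\<Sum>j=1..?n. cst (y j) ^ ?Q * ?t j)"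
    and "B1 = (\<Sum>i=1..?n. ?X i * ?X (2 * m - i + 1) ^ ?Q)"
    and "B2 = (\<Sum>i=1..?n. ?X i ^ ?Q * ?X (2 * m - i + 1))"
  have s1: "(\<Sum>i=1..?n. ?X i * defect i ^ ?Q) =
      A1 + cst alpha * ?X (m + 1) ^ ?Q + cst beta * ?X m ^ ?Q + cst alpha * cst beta ^ ?Q - B1"
  proof -
    have "(\<Sum>j=1..?n. (\<Sum>i=1..?n. kc (unip j i) * ?X i) * ?t j ^ ?Q) = A1"
      unfolding A1_def by (rule sum.cong[OF refl]) (simp only: cy)
    then show ?thesis
      unfolding isotropic_sum_identity[OF dQ] cl B1_def by simp
  qed
  have s2: "(\<Sum>i=1..?n. ?X i ^ ?Q * defect i) =
      A2 + cst alpha ^ ?Q * ?X (m + 1) + cst beta ^ ?Q * ?X m + cst alpha ^ ?Q * cst beta - B2"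
  proof -
    have "(\<Sum>j=1..?n. (\<Sum>i=1..?n. kc (unip j i) * ?X i ^ ?Q) * ?t j) = A2"
      unfolding A2_def by (rule sum.cong[OF refl]) (simp only: cyQ)
    then show ?thesis
      unfolding isotropic_sum_identity[OF defect_def] clQ B2_def by simp
  qed
  \<comment> \<open>The pair \<open>x_m, x_{m+1}\<close> is set apart: both of its new values are
    already known.\<close>
  have split: "(\<Sum>i=1..m. f i) = (\<Sum>i=1..?n. f i) + f m" for f :: "nat \<Rightarrow> 'a mpoly fract mpoly"
    using m by (cases m) simp_all
  let ?c = "if k = 0 then 2 else (1 :: 'a mpoly)"
  define E where "E = (\<Sum>i=1..m. pvar (2 * m - i + 1) ^ ?Q * pvar i + pvar i ^ ?Q * (pvar (2 * m - i + 1) :: 'a mpoly fract mpoly))"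
  define H where "H = (\<Sum>i=1..m. ?X (2 * m - i + 1) ^ ?Q * ?X i + ?X i ^ ?Q * ?X (2 * m - i + 1))"
  have "ev_fract ?c * (ev_fract (h_poly m (Suc k)) - cst (h_poly m (Suc k))) \<in> J"
    using h[of "Suc k"] k by (intro rideal_mult[OF J]) auto
  moreover have "ev_fract ?c = cst ?c"
    using ev_fract.hom_add[of 1 "1::'a mpoly"] cst.hom_add[of 1 "1::'a mpoly"] by simp
  ultimately have "ev_fract (?c * h_poly m (Suc k)) - cst (?c * h_poly m (Suc k)) \<in> J"
    by (simp only: right_diff_distrib ev_fract.hom_mult cst.hom_mult)
  then have EH: "E - H \<in> J"
    unfolding h_poly_pair_sum E_def H_def
    by (simp add: ev_fract.hom_sum ev_fract.hom_add ev_fract.hom_mult ev_fract.hom_power ev_fract_pvar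
        cst.hom_sum cst.hom_add cst.hom_mult cst.hom_power)
  have E: "E - (A1 + A2 + (cst (y (m + 1)) ^ ?Q * cst (y m) + cst (y m) ^ ?Q * cst (y (m + 1)))) \<in> J"
  proof -
    have "(\<Sum>i=1..?n. ?t i ^ ?Q * pvar i + pvar i ^ ?Q * ?t i)
        - (\<Sum>i=1..?n. ?t i ^ ?Q * cst (y i) + cst (y i) ^ ?Q * ?t i) \<in> J"
      by (intro rideal_cong_sum[OF J] rideal_cong_add[OF J] rideal_cong_mult[OF J] rideal_cong_power[OF J] yJ)
         (auto simp: rideal_0[OF J])
    moreover have "(\<Sum>i=1..?n. ?t i ^ ?Q * cst (y i) + cst (y i) ^ ?Q * ?t i) = A1 + A2"
      by (simp add: A1_def A2_def sum.distrib mult.commute)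
    moreover have "(pvar (m + 1) ^ ?Q * pvar m + pvar m ^ ?Q * pvar (m + 1)) -
        (cst (y (m + 1)) ^ ?Q * cst (y m) + cst (y m) ^ ?Q * cst (y (m + 1))) \<in> J"
      using m by (intro rideal_cong_add[OF J] rideal_cong_mult[OF J] rideal_cong_power[OF J] yJ) auto
    moreover have "2 * m - m + 1 = m + 1" by simp
    ultimately show ?thesis
      unfolding E_def split by (metis (no_types, lifting) rideal_cong_add[OF J])
  qed
  have H: "H = B1 + B2 + (?X (m + 1) ^ ?Q * ?X m + ?X m ^ ?Q * ?X (m + 1))"
    unfolding H_def split B1_def B2_def by (simp add: sum.distrib mult.commute)
  have "A1 + A2 + (cst (y (m + 1)) ^ ?Q * cst (y m) + cst (y m) ^ ?Q * cst (y (m + 1))) - H \<in> J"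
    by (rule rideal_trans[OF J rideal_sym[OF J E] EH])
  \<comment> \<open>Expanding the products of \<open>x_m + alpha\<close> and
    \<open>x_{m+1} + beta\<close> produces exactly the mixed terms of \<open>s1\<close> and
    \<open>s2\<close>.\<close>
  also have "A1 + A2 + (cst (y (m + 1)) ^ ?Q * cst (y m) + cst (y m) ^ ?Q * cst (y (m + 1))) - H =
      (\<Sum>i=1..?n. ?X i * defect i ^ ?Q) + (\<Sum>i=1..?n. ?X i ^ ?Q * defect i)"
    unfolding s1 s2 H y_m y_Suc_m cst.hom_add frob_B_iter by (simp only: algebra_simps)
  finally show ?thesis by (simp only: sum.distrib)
qed

text \<open>The matrix \<open>A\<close> with \<open>defect = A x\<close> satisfies
  \<open>A_ij^q = A_ij\<close> modulo \<open>J\<close>, so its entries are roots of the product of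
  all \<open>t - c\<close> over the finite field and can be specialised to scalars
  \<open>e i j\<close>.\<close>

lemma defect_linear_split:
  assumes two: "(2::'a) \<noteq> 0"
    and leaf: "\<And>J' e. rideal J' \<Longrightarrow> J \<subseteq> J' \<Longrightarrow>
      (\<And>i. i \<in> {1..m-1} \<Longrightarrow> defect i - cst (lcomb (m - 1) (e i)) \<in> J') \<Longrightarrow> r \<in> J'"
  shows "r \<in> J"
proof -
  let ?n = "m - 1" and ?q = "CARD('a)"
  have "\<exists>Y. (\<forall>i\<in>{1..?n}. \<forall>j\<in>{1..?n}. (\<Sum>k<?n. fvar i ^ (?q ^ k) * Y k j) = (if i = j then 1 else 0)) \<and>
    (\<forall>k<?n. \<forall>l<?n. (\<Sum>j=1..?n. Y k j * (fvar j :: 'a mpoly fract) ^ (?q ^ l)) = (if k = l then 1 else 0))"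
  proof (rule moore_matrix_inverse[OF comm_ring_hom_fconst frobenius_add_fract])
    fix f :: "nat \<Rightarrow> 'a" and j assume "(\<Sum>j=1..?n. fconst (f j) * fvar j) = 0" and j: "j \<in> {1..?n}"
    then have "to_fract (lcomb ?n f) = 0"
      by (simp add: lcomb_def to_fract_sum fconst_def fvar_def)
    then show "f j = 0" using lcomb_eq_0_imp[OF _ j] by simp
  qed
  then obtain Y where Y: "\<And>i j. i \<in> {1..?n} \<Longrightarrow> j \<in> {1..?n} \<Longrightarrow>
        (\<Sum>k<?n. fvar i ^ (?q ^ k) * Y k j) = (if i = j then 1 else 0)"
      "\<And>k l. k < ?n \<Longrightarrow> l < ?n \<Longrightarrow>
        (\<Sum>j=1..?n. Y k j * (fvar j :: 'a mpoly fract) ^ (?q ^ l)) = (if k = l then 1 else 0)"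
    by blast
  let ?X = "\<lambda>i. cst (pvar i :: 'a mpoly)"
  define Z where "Z k j = pconst (Y k j)" for k j
  have XZ: "(\<Sum>k<?n. ?X i ^ (?q ^ k) * Z k j) = (if i = j then 1 else 0)"
    if "i \<in> {1..?n}" "j \<in> {1..?n}" for i j
    using arg_cong[OF Y(1)[OF that], of pconst]
    by (simp add: Z_def cst_def fvar_def pconst_sum pconst_mult pconst_power pconst_0 pconst_1 split: if_splits)
  have ZX: "(\<Sum>j=1..?n. Z k j * ?X j ^ (?q ^ l)) = (if k = l then 1 else 0)" if "k < ?n" "l < ?n" for k l
    using arg_cong[OF Y(2)[OF that], of pconst]
    by (simp add: Z_def cst_def fvar_def pconst_sum pconst_mult pconst_power pconst_0 pconst_1 split: if_splits)
  have half: "kc (inverse 2) * 2 = 1"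
  proof -
    have "kc 2 = 2" using cst.hom_add[of "pconst 1" "pconst 1"] pconst_add[of 1 "1::'a"] by (simp add: pconst_1)
    then have "kc (inverse 2) * 2 = kc (inverse 2 * 2)" by (simp only: pconst_mult cst.hom_mult)
    then show ?thesis using two by (simp add: pconst_1)
  qed
  define A where "A i j = (\<Sum>k<?n. defect i ^ (?q ^ k) * Z k j)" for i j
  note iso = frob_fixed_of_isotropic[OF frob_B card_field_pos J half XZ ZX defect_isotropic, folded A_def]
  let ?C = "range (\<lambda>a. kc a)"
  show ?thesis
  proof (rule rideal_split_many[of "(\<lambda>(i, j). A i j) ` ({1..?n} \<times> {1..?n})" J ?C])
    fix p assume "p \<in> (\<lambda>(i, j). A i j) ` ({1..?n} \<times> {1..?n})"
    then obtain i j where ij: "i \<in> {1..?n}" "j \<in> {1..?n}" "p = A i j" by auto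
    have "(\<Prod>c\<in>?C. p - c) = (\<Prod>a\<in>UNIV. p - kc a)"
      by (subst prod.reindex) (auto simp: inj_on_def cst_inj pconst_inj)
    also have "\<dots> = p ^ ?q - p"
      by (rule prod_minus_hom_eq_power_diff[OF comm_ring_hom_comp[OF comm_ring_hom_cst comm_ring_hom_pconst]])
    also have "\<dots> \<in> J" unfolding ij(3) using ij by (intro iso(1)) auto
    finally show "(\<Prod>c\<in>?C. p - c) \<in> J" .
  next
    show "\<exists>u. u * (c - d) = 1" if "c \<in> ?C" "d \<in> ?C" "c \<noteq> d" for c d
      using that by (intro cst_diff_unit) auto
  next
    fix J' assume J': "rideal J'" "J \<subseteq> J'"
      and sp: "\<And>p. p \<in> (\<lambda>(i, j). A i j) ` ({1..?n} \<times> {1..?n}) \<Longrightarrow> \<exists>c\<in>?C. p - c \<in> J'"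
    have "\<exists>a. A i j - kc a \<in> J'" if "i \<in> {1..?n}" "j \<in> {1..?n}" for i j
    proof -
      have "A i j \<in> (\<lambda>(i, j). A i j) ` ({1..?n} \<times> {1..?n})"
        using that by (intro image_eqI[of _ _ "(i, j)"]) auto
      from sp[OF this] show ?thesis by blast
    qed
    then obtain e where e: "\<And>i j. i \<in> {1..?n} \<Longrightarrow> j \<in> {1..?n} \<Longrightarrow> A i j - kc (e i j) \<in> J'"
      by metis
    show "r \<in> J'"
    proof (rule leaf[OF J'])
      fix i assume i: "i \<in> {1..?n}"
      have "(\<Sum>j=1..?n. A i j * ?X j) - (\<Sum>j=1..?n. kc (e i j) * ?X j) \<in> J'"
        using e[OF i] by (intro rideal_cong_sum[OF J'(1)] rideal_cong_mult[OF J'(1)]) (auto simp: rideal_0[OF J'(1)])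
      moreover have "(\<Sum>j=1..?n. A i j * ?X j) = defect i" by (rule iso(2)[where j = i]) (use i in auto)
      moreover have "(\<Sum>j=1..?n. kc (e i j) * ?X j) = cst (lcomb ?n (e i))"
        by (simp add: lcomb_def cst.hom_sum cst.hom_mult)
      ultimately show "defect i - cst (lcomb ?n (e i)) \<in> J'" by simp
    qed
  qed (use J in auto)
qed

text \<open>As \<open>unip\<close> is unitriangular, the equation for \<open>defect i\<close>
  involves the new variable of index \<open>v = 2 * m - i + 1\<close> and new variables of smaller
  index only, so it can be solved by induction on \<open>v\<close>.\<close>

lemma unitriangular_of_defect:
  assumes J': "rideal J'" "J \<subseteq> J'"
    and e: "\<And>i. i \<in> {1..m-1} \<Longrightarrow> defect i - cst (lcomb (m - 1) (e i)) \<in> J'"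
    and v: "v \<in> {1..2*m}"
  shows "\<exists>f. pvar v - cst f \<in> J' \<and> f - pvar v \<in> lspan (v - 1)"
  using v
proof (induction v rule: less_induct)
  case (less v)
  let ?n = "m - 1"
  show ?case
  proof (cases "v \<le> m + 1")
    case True
    then have "v \<in> {1..m+1}" using less.prems by auto
    moreover have "orbit_dim m v \<le> v - 1" by (simp add: orbit_dim_def)
    ultimately have "pvar v - cst (y v) \<in> J' \<and> y v - pvar v \<in> lspan (v - 1)"
      using yJ[of v] yc[of v] J'(2) lspan_mono[of "orbit_dim m v" "v - 1"] by (auto simp: lspan_def)
    then show ?thesis by blast
  next
    case False
    define i where "i = 2 * m - v + 1"
    have i: "i \<in> {1..?n}" "v = 2 * m - i + 1" using False less.prems by (auto simp: i_def)
    have "\<exists>f. pvar (2 * m - j + 1) - cst f \<in> J' \<and> f \<in> lspan (v - 1)" if j: "j \<in> {i<..?n}" for j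
    proof -
      let ?w = "2 * m - j + 1"
      have w: "?w < v" "?w \<in> {1..2*m}" using j i by auto
      obtain f where f: "pvar ?w - cst f \<in> J'" "f - pvar ?w \<in> lspan (?w - 1)"
        using less.IH[OF w] by blast
      have "f - pvar ?w \<in> lspan (v - 1)"
        by (rule subsetD[OF lspan_mono f(2)]) (use w in simp)
      then have "(f - pvar ?w) + pvar ?w \<in> lspan (v - 1)"
        using w by (intro lspan_add pvar_lspan) auto
      then show ?thesis using f(1) by auto
    qed
    then obtain F where F: "\<And>j. j \<in> {i<..?n} \<Longrightarrow> pvar (2 * m - j + 1) - cst (F j) \<in> J'"
      "\<And>j. j \<in> {i<..?n} \<Longrightarrow> F j \<in> lspan (v - 1)" by metis
    define R where "R = pconst (c m i) * pvar (m + 1) + pconst (c (m + 1) i) * pvar m + pconst (c m i) * beta"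
    \<comment> \<open>The solution for \<open>pvar v\<close> of the equation
      \<open>defect i = lcomb ?n (e i)\<close>; the last summand comes from the old variable
      subtracted in \<open>defect\<close>.\<close>
    define f where "f = lcomb ?n (e i) - (\<Sum>j\<in>{i<..?n}. pconst (unip j i) * F j) - R + pvar v"
    have "(\<Sum>j=1..?n. kc (unip j i) * pvar (2 * m - j + 1)) =
        (\<Sum>j\<in>insert i {i<..?n}. kc (unip j i) * (pvar (2 * m - j + 1) :: 'a mpoly fract mpoly))"
      by (rule sum.mono_neutral_right) (use i in \<open>auto simp: unip_def pconst_0\<close>)
    also have "\<dots> = pvar v + (\<Sum>j\<in>{i<..?n}. kc (unip j i) * pvar (2 * m - j + 1))"
      by (simp add: unip_def pconst_1 i(2))
    finally have d: "defect i = pvar v + (\<Sum>j\<in>{i<..?n}. kc (unip j i) * pvar (2 * m - j + 1)) + (cst R - cst (pvar v))"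
      unfolding defect_def R_def i(2)[symmetric] by (simp add: cst.hom_add cst.hom_mult)
    have "(\<Sum>j\<in>{i<..?n}. kc (unip j i) * pvar (2 * m - j + 1)) - (\<Sum>j\<in>{i<..?n}. kc (unip j i) * cst (F j)) \<in> J'"
      using F(1) by (intro rideal_cong_sum[OF J'(1)] rideal_cong_mult[OF J'(1)]) (auto simp: rideal_0[OF J'(1)])
    from rideal_diff[OF J'(1) e[OF i(1)] this] have "pvar v - cst f \<in> J'"
      unfolding d f_def by (simp add: cst.hom_add cst.hom_minus cst.hom_sum cst.hom_mult algebra_simps)
    moreover have "f - pvar v \<in> lspan (v - 1)"
    proof -
      have v: "m + 1 \<le> v - 1" using False by simp
      have lc: "lcomb ?n g \<in> lspan (v - 1)" for g :: "nat \<Rightarrow> 'a"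
        by (rule subsetD[OF lspan_mono[of ?n]]) (use v in \<open>simp_all add: lspan_def\<close>)
      have "R \<in> lspan (v - 1)" unfolding R_def
        using v m by (intro lspan_add lspan_scale lc pvar_lspan) auto
      then have "lcomb ?n (e i) - (\<Sum>j\<in>{i<..?n}. pconst (unip j i) * F j) - R \<in> lspan (v - 1)"
        using F(2) by (intro lspan_diff lspan_sum lspan_scale lc) auto
      then show ?thesis by (simp add: f_def)
    qed
    ultimately show ?thesis by blast
  qed
qed

end

text \<open>Modulo \<open>J\<close> the relation for \<open>h_1\<close> compares two constants. A
  nonzero constant is a unit and cannot lie in the proper ideal \<open>J\<close>, so they are equal
  and the matrix preserves the quadratic form.\<close>

lemma isometry_of_unitriangular:
  fixes J :: "'a::{field,finite} mpoly fract mpoly set"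
  assumes J: "rideal J" and proper: "1 \<notin> J" and m: "m \<ge> 1"
    and ex: "\<And>v. v \<in> {1..2*m} \<Longrightarrow> \<exists>f. pvar v - cst f \<in> J \<and> f - pvar v \<in> lspan (v - 1)"
    and h: "ev_fract (h_poly m 1) - cst (h_poly m 1) \<in> J"
  shows "\<exists>M\<in>sylow_O_plus m. \<forall>v\<in>{1..2*m}. pvar v - cst (row_form (2 * m) M v) \<in> J"
proof -
  obtain f where f: "\<And>v. v \<in> {1..2*m} \<Longrightarrow> pvar v - cst (f v) \<in> J"
    "\<And>v. v \<in> {1..2*m} \<Longrightarrow> f v - pvar v \<in> lspan (v - 1)" using ex by metis
  have "\<exists>c. f v - pvar v = lcomb (v - 1) c" if "v \<in> {1..2*m}" for v
    using f(2)[OF that] by (auto simp: lspan_def)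
  then obtain c where c: "\<And>v. v \<in> {1..2*m} \<Longrightarrow> f v - pvar v = lcomb (v - 1) (c v)" by metis
  define M where "M = mat (2 * m) (2 * m) (\<lambda>(r, s). if r = s then 1 else if s < r then c (Suc r) (Suc s) else 0)"
  have M: "M \<in> lower_unitriangular (2 * m)" by (auto simp: M_def lower_unitriangular_def)
  have row: "row_form (2 * m) M v = f v" if v: "v \<in> {1..2*m}" for v
  proof -
    have "row_form (2 * m) M v =
        (\<Sum>j=1..2*m. (if j = v then pvar j else 0) + (if j < v then pconst (c v j) * pvar j else 0))"
      unfolding row_form_def
    proof (rule sum.cong)
      fix j assume j: "j \<in> {1..2*m}"
      have "M $$ (v - 1, j - 1) = (if j = v then 1 else if j < v then c v j else 0)"
        using j v by (auto simp: M_def)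
      then show "pconst (M $$ (v - 1, j - 1)) * pvar j =
        (if j = v then pvar j else 0) + (if j < v then pconst (c v j) * pvar j else 0)"
        by (simp add: pconst_0 pconst_1)
    qed simp
    also have "\<dots> = pvar v + (\<Sum>j=1..2*m. if j < v then pconst (c v j) * pvar j else 0)"
      using v by (simp add: sum.distrib)
    also have "(\<Sum>j=1..2*m. if j < v then pconst (c v j) * pvar j else 0) = lcomb (v - 1) (c v)"
      unfolding lcomb_def by (rule sum.mono_neutral_cong_right) (use v in auto)
    finally show ?thesis using c[OF v] by (simp add: algebra_simps)
  qed
  let ?h = "\<Sum>i=1..m. f (2 * m - i + 1) * f i"
  have "ev_fract (h_poly m 1) - cst ?h \<in> J"
    unfolding h_poly_def
    by (simp add: ev_fract.hom_sum cst.hom_sum ev_fract.hom_mult cst.hom_mult ev_fract_pvar)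
       (intro rideal_cong_sum[OF J] rideal_cong_mult[OF J] f, auto)
  then have "cst ?h - cst (h_poly m 1) \<in> J"
    using h rideal_trans[OF J] rideal_sym[OF J] by blast
  then have hJ: "cst (?h - h_poly m 1) \<in> J" by (simp only: cst.hom_minus)
  have "?h = h_poly m 1"
  proof (rule ccontr)
    assume "?h \<noteq> h_poly m 1"
    then have "?h - h_poly m 1 \<noteq> 0" by simp
    from cst_unit[OF this] obtain u where u: "u * cst (?h - h_poly m 1) = 1" by blast
    from rideal_mult[OF J hJ, of u] show False unfolding u using proper by simp
  qed
  moreover have "(\<Sum>i=1..m. row_form (2 * m) M (2 * m - i + 1) * row_form (2 * m) M i) = ?h"
    by (rule sum.cong[OF refl], subst (1 2) row) auto
  ultimately have "M \<in> sylow_O_plus m"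
    by (intro sylow_of_form[OF M]) (simp add: h_poly_def)
  moreover have "\<forall>v\<in>{1..2*m}. pvar v - cst (row_form (2 * m) M v) \<in> J" using f(1) row by simp
  ultimately show ?thesis by blast
qed

text \<open>The orbit norms specialise \<open>T_1, ..., T_{m+1}\<close>, the \<open>h_k\<close> make
  the defect linear over the finite field, and \<open>h_1\<close> then forces the resulting
  unitriangular matrix into the group.\<close>

lemma relation_mem:
  fixes I :: "'a::{field,finite} mpoly fract mpoly set"
  assumes I: "rideal I" and m: "m \<ge> 1" and two: "(2::'a) \<noteq> 0"
    and N: "\<And>i. i \<in> {1..m + 1} \<Longrightarrow>
      ev_fract (orbit_norm (2 * m) (sylow_O_plus m) i) - cst (orbit_norm (2 * m) (sylow_O_plus m) i) \<in> I"
    and h: "\<And>k. k \<in> {1..m - 1} \<Longrightarrow> ev_fract (h_poly m k) - cst (h_poly m k) \<in> I"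
    and ab: "a \<in> poly_ring_V (2 * m)" "b \<in> poly_ring_V (2 * m)"
      "\<And>g. g \<in> sylow_O_plus m \<Longrightarrow> act_poly (2 * m) g a * b = a * act_poly (2 * m) g b"
  shows "cst b * ev_fract a - cst a * ev_fract b \<in> I" (is "?r \<in> I")
proof (rule triangular_reduction[OF I m two N])
  fix J y assume J: "rideal J" "I \<subseteq> J" and yJ: "\<And>j. j \<in> {1..m + 1} \<Longrightarrow> pvar j - cst (y j) \<in> J"
    and yl: "\<And>j. j \<in> {1..m + 1} \<Longrightarrow> y j - pvar j \<in> lspan (orbit_dim m j)"
  have "\<exists>c. y j = pvar j + lcomb (orbit_dim m j) c" if "j \<in> {1..m + 1}" for j
    using yl[OF that] by (auto simp: lspan_def algebra_simps)
  then obtain c where yc: "\<And>j. j \<in> {1..m + 1} \<Longrightarrow> y j = pvar j + lcomb (orbit_dim m j) (c j)" by metis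
  have hJ: "ev_fract (h_poly m k) - cst (h_poly m k) \<in> J" if "k \<in> {1..m - 1}" for k
    using h[OF that] J(2) by blast
  \<comment> \<open>For \<open>m = 1\<close> the polynomial \<open>h_1\<close> is not among the
    generators, but both variables are then fixed by the group, so the relation follows from the
    orbit norms.\<close>
  have h1: "ev_fract (h_poly m 1) - cst (h_poly m 1) \<in> J"
  proof (cases "m = 1")
    case True
    have "y 1 = pvar 1" "y 2 = pvar 2"
      using yc[of 1] yc[of 2] True by (simp_all add: orbit_dim_def lcomb_def)
    then have "pvar 1 - cst (pvar 1) \<in> J" "pvar 2 - cst (pvar 2) \<in> J"
      using yJ[of 1] yJ[of 2] True by simp_all
    then have "pvar 2 * pvar 1 - cst (pvar 2) * cst (pvar 1) \<in> J"
      by (intro rideal_cong_mult[OF J(1)])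
    moreover have "h_poly m 1 = (pvar 2 * pvar 1 :: 'a mpoly)" using True by (simp add: h_poly_def numeral_2_eq_2)
    ultimately show ?thesis by (simp add: ev_fract.hom_mult cst.hom_mult ev_fract_pvar)
  qed (use hJ[of 1] m in auto)
  note D = J(1) m yJ yc hJ
  show "?r \<in> J"
  proof (rule defect_linear_split[OF D two])
    fix J' e assume J': "rideal J'" "J \<subseteq> J'"
      and e: "\<And>i. i \<in> {1..m-1} \<Longrightarrow> defect m c i - cst (lcomb (m - 1) (e i)) \<in> J'"
    show "?r \<in> J'"
    \<comment> \<open>A branch that has collapsed to the unit ideal contains everything.\<close>
    proof (cases "1 \<in> J'")
      case True
      then show ?thesis using rideal_mult[OF J'(1), of 1 ?r] by simp
    next
      case False
      have "\<exists>M\<in>sylow_O_plus m. \<forall>v\<in>{1..2*m}. pvar v - cst (row_form (2 * m) M v) \<in> J'"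
        by (rule isometry_of_unitriangular[OF J'(1) False m unitriangular_of_defect[OF D J' e]])
           (use h1 J'(2) in auto)
      then show ?thesis using ev_fract_final_relation[OF J'(1) _ _ ab] by blast
    qed
  qed
qed

theorem theorem4p16:
  fixes m :: nat
    and G :: "'a::{field,finite} mat set"
  assumes "odd CARD('a)"
    and "m \<ge> 1"
    and "G = sylow_O_plus m"
  shows "invariant_field (2 * m) G =
    field_gen ({orbit_norm (2 * m) G i | i. i \<in> {1..m + 1}} \<union> {h_poly m k | k. k \<in> {1..m - 1}})"
proof -
  note two = two_neq_0_of_odd_card[OF assms(1)] and m = assms(2) and G = assms(3)
  let ?S = "{orbit_norm (2 * m) G i | i. i \<in> {1..m + 1}} \<union> {h_poly m k | k. k \<in> {1..m - 1}}"
  have units: "g \<in> Units (ring_mat TYPE('a) (2 * m) ())" if "g \<in> G" for g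
    using sylow_O_plus_Units that unfolding G by blast
  have "field_gen ?S \<subseteq> invariant_field (2 * m) G"
    by (rule field_gen_subset_invariant_field[OF units])
       (auto simp: G poly_ring_V_orbit_norm[OF m two] poly_ring_V_h_poly act_poly_orbit_norm[OF _ m two]
         act_poly_h_poly[OF _ two])
  moreover have "z \<in> field_gen ?S" if z: "z \<in> invariant_field (2 * m) G" for z
  proof -
    obtain a b where ab: "z = Fract a b" "a \<in> poly_ring_V (2 * m)" "b \<in> poly_ring_V (2 * m)" "b \<noteq> 0"
      "\<forall>g\<in>G. act_poly (2 * m) g a * b = a * act_poly (2 * m) g b"
      using invariant_fieldE[OF units z] by blast
    show ?thesis
    proof (rule ccontr)
      assume n: "z \<notin> field_gen ?S"
      \<comment> \<open>A multiplier \<open>k\<close> in the generated field would be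
        \<open>z\<close> itself, so the separating functional exists.\<close>
      have "to_fract a \<noteq> k * to_fract b" if "k \<in> field_gen ?S" for k
      proof
        assume "to_fract a = k * to_fract b"
        then have "z = k" using ab(1,4) by (simp add: Fract_conv_to_fract)
        then show False using n that by simp
      qed
      then have "\<exists>L. (\<forall>x y. L (x + y) = L x + L y) \<and> (\<forall>k\<in>field_gen ?S. \<forall>x. L (k * x) = k * L x) \<and>
          L (to_fract b) = 0 \<and> L (to_fract a) = 1"
        using field_gen_fconst[of 0] field_gen_fconst[of 1]
        by (intro exists_linear_functional field_gen_add field_gen_mult field_gen_uminus field_gen_inverse)
           (simp_all add: fconst_def pconst_0 pconst_1)
      then obtain L where L: "\<And>x y. L (x + y) = L x + L y"
        "\<And>k x. k \<in> field_gen ?S \<Longrightarrow> L (k * x) = k * L x" "L (to_fract b) = 0" "L (to_fract a) = 1"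
        by blast
      note Lc = L(2)[OF field_gen_fconst]
      have gen: "ev_fract f - cst f \<in> annih L" if "f \<in> ?S" for f
        unfolding cst_def by (rule ev_fract_mem_annih[OF L(1) Lc L(2)[OF field_gen_gen[OF that]]])
      have "cst b * ev_fract a - cst a * ev_fract b \<in> annih L"
      proof (rule relation_mem[OF rideal_annih m two])
        show "ev_fract (orbit_norm (2 * m) (sylow_O_plus m) i) - cst (orbit_norm (2 * m) (sylow_O_plus m) i) \<in> annih L"
          if "i \<in> {1..m + 1}" for i
          using that by (intro gen) (auto simp: G)
        show "ev_fract (h_poly m k) - cst (h_poly m k) \<in> annih L" if "k \<in> {1..m - 1}" for k
          using that by (intro gen) auto
      qed (use ab G in auto)
      \<comment> \<open>With \<open>L b = 0\<close> and \<open>L a = 1\<close> the relation becomes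
        \<open>b = 0\<close>.\<close>
      from ev_fract_relation[OF L(1) Lc this[unfolded cst_def]] show False
        using L(3,4) ab(4) by simp
    qed
  qed
  ultimately show ?thesis by blast
qed

end
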